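(* Let $D\subset\mathbb C^n$ be a bounded convex domain, let $f:\mathbb D\to D$ be a complex geodesic and let $G:D\to\mathbb D$ be a left inverse to $f$. Then for every $z\in D$ there is exactly one $\lambda=:H(z)\in\mathbb D$ such that $$(z-f(\lambda))\bullet G'(f(\lambda))=0,$$ and the function $H:D\to\mathbb D$ so defined is holomorphic. Consequently, $H$ is a Lempert left inverse to $f$ with $H'(f(\lambda))=G'(f(\lambda))$ for all $\lambda\in\mathbb D$. Moreover, if $G$ is a Lempert left inverse to $f$, then $H\equiv G$. Finally, if the supporting hyperplanes are determined uniquely for the Kobayashi balls $B_{k_D^*}(f(0),R)$, $0<R<1$, centered at $f(0)$ (i.e. each such ball has exactly one supporting real affine hyperplane at each of its boundary points), then there is only one Lempert left inverse to $f$; this holds for instance when $D$ is strongly convex.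
   Context: $\mathbb D$ is the open unit disc in $\mathbb C$. For $w,z\in\mathbb C^n$, $w\bullet z:=\sum_{j=1}^n w_jz_j$ (bilinear, no conjugation). For a holomorphic function $G$ on $D$, $G'(z)=(\partial G/\partial z_1(z),\ldots,\partial G/\partial z_n(z))\in\mathbb C^n$. A holomorphic map $f:\mathbb D\to D$ is a complex geodesic if there is a holomorphic function $G:D\to\mathbb D$ with $G(f(\lambda))=\lambda$ for all $\lambda\in\mathbb D$; any such $G$ is called a left inverse to $f$. A left inverse $G$ is called a Lempert left inverse if for every $\lambda\in\mathbb D$ the fiber $G^{-1}(\lambda)$ is the intersection of $D$ with a complex affine hyperplane of $\mathbb C^n$. $k_D$ denotes the Kobayashi distance of $D$, normalized so that on $\mathbb D$ it is the Poincaré distance $p$ with $\tanh p(0,\lambda)=|\lambda|$; $k_D^*:=\tanh k_D$. For $q\in D$ and $0<R<1$ the Kobayashi ball is $B_{k_D^*}(q,R):=\{z\in D: k_D^*(q,z)<R\}$, which is convex when $D$ is bounded and convex. Strongly convex is understood in the usual sense: $D$ is bounded with $C^2$ boundary and has a $C^2$ defining function whose real Hessian is positive definite on the real tangent space at each boundary point. *)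

theory Defs
  imports "HOL-Analysis.Analysis"
begin

text \<open>
  The bilinear product \<open>\<Sum>j. w\<^sub>j z\<^sub>j\<close> is the library's \<^const>\<open>scalar_product\<close>; the
  library's \<open>\<bullet>\<close> on \<open>complex ^ 'n\<close> is instead the real inner product of the underlying
  real space, and is used only for real hyperplanes and for the real gradient and Hessian.
\<close>

abbreviation unit_disc :: "complex set" where
  "unit_disc \<equiv> ball 0 1"

subsection \<open>Holomorphic functions and discs\<close>

definition holomorphic_fun_on :: "(complex ^ 'n \<Rightarrow> complex) \<Rightarrow> (complex ^ 'n) set \<Rightarrow> bool" where
  "holomorphic_fun_on G D \<longleftrightarrow>
     (\<forall>z\<in>D. \<exists>L. (G has_derivative L) (at z within D) \<and> (\<forall>c v. L (c *s v) = c * L v))"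

definition holomorphic_disc :: "(complex \<Rightarrow> complex ^ 'n) \<Rightarrow> (complex ^ 'n) set \<Rightarrow> bool" where
  "holomorphic_disc f D \<longleftrightarrow>
     (\<forall>i. (\<lambda>\<zeta>. f \<zeta> $ i) holomorphic_on unit_disc) \<and> f ` unit_disc \<subseteq> D"

text \<open>The vector of complex partial derivatives.\<close>

definition cgrad :: "(complex ^ 'n \<Rightarrow> complex) \<Rightarrow> complex ^ 'n \<Rightarrow> complex ^ 'n" where
  "cgrad G z = (\<chi> j. deriv (\<lambda>w. G (\<chi> k. if k = j then w else z $ k)) (z $ j))"

subsection \<open>Complex geodesics and left inverses\<close>

definition left_inverse ::
    "(complex ^ 'n) set \<Rightarrow> (complex \<Rightarrow> complex ^ 'n) \<Rightarrow> (complex ^ 'n \<Rightarrow> complex) \<Rightarrow> bool" where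
  "left_inverse D f G \<longleftrightarrow>
     holomorphic_fun_on G D \<and> G ` D \<subseteq> unit_disc \<and> (\<forall>\<zeta>\<in>unit_disc. G (f \<zeta>) = \<zeta>)"

definition complex_geodesic :: "(complex ^ 'n) set \<Rightarrow> (complex \<Rightarrow> complex ^ 'n) \<Rightarrow> bool" where
  "complex_geodesic D f \<longleftrightarrow> holomorphic_disc f D \<and> (\<exists>G. left_inverse D f G)"

definition complex_hyperplane :: "(complex ^ 'n) set \<Rightarrow> bool" where
  "complex_hyperplane P \<longleftrightarrow> (\<exists>a b. a \<noteq> 0 \<and> P = {z. scalar_product a z = b})"

definition lempert_left_inverse ::
    "(complex ^ 'n) set \<Rightarrow> (complex \<Rightarrow> complex ^ 'n) \<Rightarrow> (complex ^ 'n \<Rightarrow> complex) \<Rightarrow> bool" where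
  "lempert_left_inverse D f G \<longleftrightarrow>
     left_inverse D f G \<and>
     (\<forall>\<zeta>\<in>unit_disc. \<exists>P. complex_hyperplane P \<and> {z \<in> D. G z = \<zeta>} = D \<inter> P)"

text \<open>
  The function \<open>H\<close> built from \<open>f\<close> and \<open>G\<close>. It is meaningful at \<open>z\<close> only where the defining
  equation has exactly one solution in the disc, which is part of what has to be shown.
\<close>

definition lempert_fun_of ::
    "(complex \<Rightarrow> complex ^ 'n) \<Rightarrow> (complex ^ 'n \<Rightarrow> complex) \<Rightarrow> complex ^ 'n \<Rightarrow> complex" where
  "lempert_fun_of f G z =
     (THE \<zeta>. \<zeta> \<in> unit_disc \<and> scalar_product (z - f \<zeta>) (cgrad G (f \<zeta>)) = 0)"

subsection \<open>Kobayashi distance and balls\<close>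

definition poincare_dist :: "complex \<Rightarrow> complex \<Rightarrow> real" where
  "poincare_dist a b = artanh (cmod ((a - b) / (1 - cnj a * b)))"

text \<open>
  Kobayashi's chain definition: infimum of total Poincare length over finite chains of
  holomorphic discs from \<open>z\<close> to \<open>w\<close>. The set below is bounded below by \<open>0\<close>, and for a domain it
  is nonempty, so the real infimum is the intended one.
\<close>

definition kobayashi_dist :: "(complex ^ 'n) set \<Rightarrow> complex ^ 'n \<Rightarrow> complex ^ 'n \<Rightarrow> real" where
  "kobayashi_dist D z w =
     Inf {\<Sum>j<N. poincare_dist (a j) (b j) | (N::nat) a b.
            \<exists>p \<phi>. p 0 = z \<and> p N = w \<and>
              (\<forall>j<N. a j \<in> unit_disc \<and> b j \<in> unit_disc \<and> holomorphic_disc (\<phi> j) D \<and>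
                     \<phi> j (a j) = p j \<and> \<phi> j (b j) = p (Suc j))}"

definition kobayashi_ball :: "(complex ^ 'n) set \<Rightarrow> complex ^ 'n \<Rightarrow> real \<Rightarrow> (complex ^ 'n) set" where
  "kobayashi_ball D q R = {z \<in> D. tanh (kobayashi_dist D q z) < R}"

subsection \<open>Supporting real hyperplanes and strong convexity\<close>

definition supporting_hyperplane :: "'a::euclidean_space set \<Rightarrow> 'a \<Rightarrow> 'a set \<Rightarrow> bool" where
  "supporting_hyperplane B x P \<longleftrightarrow>
     (\<exists>u. u \<noteq> 0 \<and> P = {y. u \<bullet> y = u \<bullet> x} \<and> B \<subseteq> {y. u \<bullet> y \<le> u \<bullet> x})"

definition unique_supporting_hyperplanes :: "'a::euclidean_space set \<Rightarrow> bool" where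
  "unique_supporting_hyperplanes B \<longleftrightarrow> (\<forall>x\<in>frontier B. \<exists>!P. supporting_hyperplane B x P)"

text \<open>
  Here \<open>r\<close> is the \<open>C\<^sup>2\<close> defining function on a neighbourhood \<open>U\<close> of the boundary, \<open>g\<close> its real
  gradient (nonzero on the boundary, so that the boundary is a \<open>C\<^sup>2\<close> hypersurface) and \<open>h\<close> its
  real Hessian, the derivative of the gradient; \<open>{v. g x \<bullet> v = 0}\<close> is the real tangent space.
\<close>

definition strongly_convex :: "'a::euclidean_space set \<Rightarrow> bool" where
  "strongly_convex D \<longleftrightarrow>
     bounded D \<and>
     (\<exists>U (r :: 'a \<Rightarrow> real) (g :: 'a \<Rightarrow> 'a) (h :: 'a \<Rightarrow> 'a \<Rightarrow>\<^sub>L 'a).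
        open U \<and> D \<inter> U = {x \<in> U. r x < 0} \<and> frontier D = {x \<in> U. r x = 0} \<and>
        (\<forall>x\<in>U. (r has_derivative (\<lambda>v. g x \<bullet> v)) (at x)) \<and>
        (\<forall>x\<in>U. (g has_derivative blinfun_apply (h x)) (at x)) \<and>
        continuous_on U h \<and>
        (\<forall>x\<in>frontier D. g x \<noteq> 0 \<and>
           (\<forall>v. v \<noteq> 0 \<and> g x \<bullet> v = 0 \<longrightarrow> blinfun_apply (h x) v \<bullet> v > 0)))"

end

theory Submission
  imports Defs "HOL-Complex_Analysis.Riemann_Mapping"
begin

text \<open>
  Write \<open>w \<zeta> = cgrad G (f \<zeta>)\<close>. The function \<open>\<zeta> \<mapsto> (z - f \<zeta>) \<odot> w \<zeta>\<close> is the derivative at \<open>t = 0\<close>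
  of \<open>G ((1 - t) f \<zeta> + t z)\<close>, so its zeros are the infinitesimal fixed points of the self-maps
  \<open>\<zeta> \<mapsto> G ((1 - t) f \<zeta> + t z)\<close> of the disc. For \<open>0 < t < 1\<close> convexity puts the points
  \<open>(1 - t) f \<zeta> + t z\<close> in a compact part of \<open>D\<close>, so the self-map contracts the Poincare distance
  strictly and has exactly one fixed point \<open>K\<^sub>t z\<close>; it is holomorphic in \<open>z\<close>, and for \<open>z = f \<zeta>\<close>
  it is \<open>\<zeta>\<close> because \<open>G (f \<zeta>) = \<zeta>\<close> (\<open>contracted_fixed_point\<close>). A pointwise cluster point for
  \<open>t \<rightarrow> 0\<close> is a left inverse whose values are zeros (\<open>section_exists\<close>). A second zero \<open>\<zeta>\<close> for the
  same \<open>z\<close> is excluded along the complex line through \<open>f \<zeta>\<close> and \<open>z\<close>: the zero at \<open>f \<zeta>\<close> is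
  simple, so near \<open>f \<zeta>\<close> the left inverse is constantly \<open>\<zeta>\<close> on this line, and by the identity
  theorem it is so at \<open>z\<close> (\<open>zero_unique\<close>). The fibres of the resulting \<open>H\<close> are slices of \<open>D\<close> by
  the hyperplanes \<open>(z - f \<zeta>) \<odot> w \<zeta> = 0\<close>; together with \<open>G (f \<zeta>) = \<zeta>\<close> this yields the gradient of
  \<open>H\<close> along \<open>f\<close>, and it shows that a Lempert left inverse \<open>G\<close> is its own \<open>H\<close>.

  A Lempert left inverse is therefore determined by its gradient along \<open>f\<close>. By the Schwarz
  lemma, applied to \<open>G\<close> on convex combinations of \<open>f\<close> with competing discs, the covector \<open>w \<zeta>\<close>
  (times \<open>cnj \<zeta>\<close>, with the real part taken) supports the Kobayashi ball of radius \<open>norm \<zeta>\<close> about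
  \<open>f 0\<close> at \<open>f \<zeta>\<close>. If the support is unique, two left inverses have proportional gradients at
  \<open>f \<zeta>\<close>, and the chain rule in \<open>G (f \<zeta>) = \<zeta>\<close> makes the factor equal to one
  (\<open>unique_lempert_left_inverse\<close>).

  The definition of the Kobayashi distance uses chains of discs. That one disc suffices, and
  that it has a left inverse, is Lempert's theorem (\<open>geodesic_through_two_points\<close>), obtained
  here by duality. For given \<open>q\<close>, \<open>x\<close> and \<open>0 < R < 1\<close>, a disc \<open>\<phi>\<close> in \<open>D\<close> with \<open>\<phi> 0 = q\<close> and
  \<open>\<phi> R = x\<close> produces a positive measure on the product of the circle and \<open>D\<close>, namely \<open>R\<close> times
  harmonic measure at \<open>R\<close> carried to the graph of \<open>\<phi>\<close>, whose moments depend on \<open>q\<close>, \<open>x\<close> and \<open>R\<close>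
  alone. If finitely supported measures come arbitrarily close to these moments, a limit of
  their Cauchy transforms is such a disc (\<open>disc_from_moments\<close>). If they do not, the residual of
  a near-best approximation gives polynomials \<open>w\<close> and \<open>\<kappa>\<close> for which \<open>z \<odot> w - \<kappa>\<close> points into the
  disc at every point of the circle and every \<open>z\<close> in \<open>D\<close>; its zero in the disc, as a function of
  \<open>z\<close>, maps \<open>D\<close> to the disc, \<open>q\<close> to \<open>0\<close> and \<open>x\<close> to \<open>R\<close> (\<open>function_from_gap\<close>). At the smallest
  \<open>R\<close> that admits a disc both objects exist, and equality in the Schwarz lemma makes the
  function a left inverse of the disc.

  Along a geodesic \<open>w\<close> is bounded, and \<open>w \<zeta>\<close> supports \<open>D\<close> itself up to an error of order
  \<open>1 - norm \<zeta>\<close>. A strongly convex \<open>D\<close> moreover has interior tangent balls of a uniform radius.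
  By Hopf's boundary point lemma they bound the radial component of \<open>w\<close> from below, and near the
  circle a ball of this radius in \<open>D\<close> that contains \<open>f \<zeta>\<close> has its centre almost on the inner
  normal given by \<open>w \<zeta>\<close>. Hence \<open>f + s g\<close> stays in \<open>D\<close> for small \<open>s > 0\<close> whenever \<open>g\<close> is a
  bounded holomorphic field with \<open>Re (cnj \<zeta> (g \<zeta> \<odot> w \<zeta>)) \<le> - e < 0\<close> near the circle. Such fields
  may vanish at \<open>0\<close> and take at a given \<open>\<zeta>\<close> any value in the open half space determined by
  \<open>w \<zeta>\<close>, so every support of the Kobayashi ball at \<open>f \<zeta>\<close> is the one given by \<open>w \<zeta>\<close>
  (\<open>strongly_convex_unique_supports\<close>).
\<close>

section \<open>The bilinear product and holomorphic functions\<close>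

notation scalar_product (infixl "\<odot>" 70)

lemma scalar_product_add_left: "(a + b) \<odot> (w :: complex ^ 'n) = a \<odot> w + b \<odot> w"
  by (simp add: scalar_product_def algebra_simps sum.distrib)

lemma scalar_product_diff_left: "(a - b) \<odot> (w :: complex ^ 'n) = a \<odot> w - b \<odot> w"
  by (simp add: scalar_product_def algebra_simps sum_subtractf)

lemma scalar_product_add_right: "(w :: complex ^ 'n) \<odot> (a + b) = w \<odot> a + w \<odot> b"
  by (simp add: scalar_product_def algebra_simps sum.distrib)

lemma scalar_product_cmult_left: "(c *s a) \<odot> (w :: complex ^ 'n) = c * (a \<odot> w)"
  by (simp add: scalar_product_def algebra_simps sum_distrib_left)

lemma scalar_product_scaleR_left: "(t *\<^sub>R a) \<odot> (w :: complex ^ 'n) = t *\<^sub>R (a \<odot> w)"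
  by (simp add: scalar_product_def scaleR_sum_right)

lemma scalar_product_zero_left [simp]: "0 \<odot> (w :: complex ^ 'n) = 0"
  by (simp add: scalar_product_def)

lemma scalar_product_zero_right [simp]: "(w :: complex ^ 'n) \<odot> 0 = 0"
  by (simp add: scalar_product_def)

lemma scalar_product_minus_left: "(- a) \<odot> (w :: complex ^ 'n) = - (a \<odot> w)"
  by (simp add: scalar_product_def sum_negf)

lemma scalar_product_commute: "(a :: complex ^ 'n) \<odot> w = w \<odot> a"
  by (simp add: scalar_product_def mult.commute)

lemmas scalar_product_left_simps =
  scalar_product_add_left scalar_product_diff_left scalar_product_cmult_left
  scalar_product_scaleR_left scalar_product_minus_left

lemma norm_scalar_product_le: "norm ((a :: complex ^ 'n) \<odot> w) \<le> norm a * norm w"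
proof -
  have "norm (a \<odot> w) \<le> (\<Sum>i\<in>UNIV. \<bar>norm (a $ i)\<bar> * \<bar>norm (w $ i)\<bar>)"
    unfolding scalar_product_def by (rule order_trans[OF norm_sum]) (simp add: norm_mult)
  also have "\<dots> \<le> L2_set (\<lambda>i. norm (a $ i)) UNIV * L2_set (\<lambda>i. norm (w $ i)) UNIV"
    by (rule L2_set_mult_ineq)
  finally show ?thesis by (simp add: norm_vec_def)
qed

lemma bounded_linear_scalar_product_left: "bounded_linear (\<lambda>v :: complex ^ 'n. v \<odot> w)"
  by (rule bounded_linear_intro[where K = "norm w"])
     (auto simp: scalar_product_left_simps norm_scalar_product_le)

lemma norm_cmult_vec: "norm (c *s (v :: complex ^ 'n)) = norm c * norm v"
  by (simp add: norm_vec_def norm_mult L2_set_left_distrib[symmetric] L2_set_right_distrib)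

lemma bounded_linear_cmult_left: "bounded_linear (\<lambda>c. c *s (v :: complex ^ 'n))"
  by (rule bounded_linear_intro[where K = "norm v"])
     (auto simp: norm_cmult_vec vec_eq_iff algebra_simps)

lemma clinear_eq_scalar_product:
  fixes L :: "complex ^ 'n \<Rightarrow> complex"
  assumes "linear L" and "\<And>c v. L (c *s v) = c * L v"
  shows "L v = v \<odot> (\<chi> j. L (axis j 1))"
proof -
  have v: "v = (\<Sum>j\<in>UNIV. (v $ j) *s axis j 1)"
    by (simp add: vec_eq_iff axis_def if_distrib cong: if_cong)
  have "L v = (\<Sum>j\<in>UNIV. L ((v $ j) *s axis j 1))"
    by (subst v) (rule linear_sum[OF assms(1)])
  then show ?thesis by (simp add: assms(2) scalar_product_def)
qed

lemma has_derivative_cgrad: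
  fixes G :: "complex ^ 'n \<Rightarrow> complex"
  assumes G: "holomorphic_fun_on G D" and D: "open D" "z \<in> D"
  shows "(G has_derivative (\<lambda>v. v \<odot> cgrad G z)) (at z)"
proof -
  from G D obtain L where L: "(G has_derivative L) (at z)" and cl: "\<And>c v. L (c *s v) = c * L v"
    unfolding holomorphic_fun_on_def by (metis at_within_open)
  have "cgrad G z $ j = L (axis j 1)" for j
  proof -
    have "(\<chi> k. if k = j then w else z $ k) = z + (w - z $ j) *s axis j 1" for w
      by (simp add: vec_eq_iff axis_def)
    moreover have "((\<lambda>w. z + (w - z $ j) *s axis j 1) has_derivative (\<lambda>h. h *s axis j 1)) (at (z $ j))"
      by (auto intro!: derivative_eq_intros bounded_linear.has_derivative[OF bounded_linear_cmult_left])
    ultimately have "((\<lambda>w. \<chi> k. if k = j then w else z $ k) has_derivative (\<lambda>h. h *s axis j 1)) (at (z $ j))"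
      by simp
    moreover have "(\<chi> k. if k = j then z $ j else z $ k) = z" by (simp add: vec_eq_iff)
    ultimately have "((\<lambda>w. G (\<chi> k. if k = j then w else z $ k)) has_derivative (\<lambda>h. L (h *s axis j 1))) (at (z $ j))"
      using has_derivative_compose[of "\<lambda>w. \<chi> k. if k = j then w else z $ k" "\<lambda>h. h *s axis j 1" "z $ j" UNIV G L] L
      by simp
    moreover have "(\<lambda>h. L (h *s axis j 1)) = (*) (L (axis j 1))"
      by (rule ext) (simp only: cl mult.commute)
    ultimately have "((\<lambda>w. G (\<chi> k. if k = j then w else z $ k)) has_field_derivative L (axis j 1)) (at (z $ j))"
      unfolding has_field_derivative_def by simp
    then show ?thesis by (simp add: cgrad_def DERIV_imp_deriv)
  qed
  then have "cgrad G z = (\<chi> j. L (axis j 1))" by (simp add: vec_eq_iff)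
  then have "L v = v \<odot> cgrad G z" for v
    using clinear_eq_scalar_product[OF has_derivative_linear[OF L] cl, of v] by (rule ssubst)
  then have "L = (\<lambda>v. v \<odot> cgrad G z)" by (rule ext)
  with L show ?thesis by simp
qed

lemma holomorphic_fun_onI:
  assumes "\<And>z. z \<in> D \<Longrightarrow> \<exists>w. (G has_derivative (\<lambda>v. v \<odot> w)) (at z)"
  shows "holomorphic_fun_on G D"
  unfolding holomorphic_fun_on_def
proof
  fix z assume "z \<in> D"
  then obtain w where "(G has_derivative (\<lambda>v. v \<odot> w)) (at z)" using assms by blast
  then show "\<exists>L. (G has_derivative L) (at z within D) \<and> (\<forall>c v. L (c *s v) = c * L v)"
    by (intro exI[of _ "\<lambda>v. v \<odot> w"]) (auto simp: scalar_product_cmult_left has_derivative_at_withinI)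
qed

lemma holomorphic_fun_on_clinearI:
  assumes "\<And>z. z \<in> D \<Longrightarrow> \<exists>L. (G has_derivative L) (at z) \<and> (\<forall>c v. L (c *s v) = c * L v)"
  shows "holomorphic_fun_on G D"
  unfolding holomorphic_fun_on_def using assms has_derivative_at_withinI by blast

lemma holomorphic_fun_on_subset:
  "holomorphic_fun_on G D \<Longrightarrow> E \<subseteq> D \<Longrightarrow> holomorphic_fun_on G E"
  unfolding holomorphic_fun_on_def by (meson has_derivative_subset subsetD)

lemma holomorphic_fun_on_cong:
  assumes "holomorphic_fun_on G D" "\<And>z. z \<in> D \<Longrightarrow> H z = G z"
  shows "holomorphic_fun_on H D"
  unfolding holomorphic_fun_on_def
proof
  fix z assume z: "z \<in> D"
  then obtain L where "(G has_derivative L) (at z within D)" "\<forall>c v. L (c *s v) = c * L v"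
    using assms(1) unfolding holomorphic_fun_on_def by blast
  then show "\<exists>L. (H has_derivative L) (at z within D) \<and> (\<forall>c v. L (c *s v) = c * L v)"
    using has_derivative_transform[OF z, of H G] assms(2) by blast
qed

lemma holomorphic_fun_on_imp_continuous_on: "holomorphic_fun_on G D \<Longrightarrow> continuous_on D G"
  unfolding holomorphic_fun_on_def continuous_on_eq_continuous_within
  by (meson has_derivative_continuous)

definition vec_deriv :: "(complex \<Rightarrow> complex ^ 'n) \<Rightarrow> complex \<Rightarrow> complex ^ 'n" where
  "vec_deriv f x = (\<chi> i. deriv (\<lambda>\<zeta>. f \<zeta> $ i) x)"

lemma has_derivative_vec_deriv:
  fixes f :: "complex \<Rightarrow> complex ^ 'n"
  assumes "\<And>i. (\<lambda>\<zeta>. f \<zeta> $ i) holomorphic_on S" "open S" "x \<in> S"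
  shows "(f has_derivative (\<lambda>h. h *s vec_deriv f x)) (at x)"
  unfolding has_derivative_def
proof (intro conjI bounded_linear_cmult_left vec_tendstoI)
  fix i
  have "((\<lambda>\<zeta>. f \<zeta> $ i) has_field_derivative deriv (\<lambda>\<zeta>. f \<zeta> $ i) x) (at x)"
    using assms by (meson holomorphic_derivI)
  then have "((\<lambda>\<zeta>. f \<zeta> $ i) has_derivative (\<lambda>h. h * deriv (\<lambda>\<zeta>. f \<zeta> $ i) x)) (at x)"
    unfolding has_field_derivative_def by (subst mult_commute_abs)
  then show "((\<lambda>y. ((f y - f (Lim (at x) (\<lambda>x. x)) - (y - Lim (at x) (\<lambda>x. x)) *s vec_deriv f x) /\<^sub>R
               norm (y - Lim (at x) (\<lambda>x. x))) $ i) \<longlongrightarrow> 0 $ i) (at x)"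
    by (simp add: has_derivative_def vec_deriv_def left_diff_distrib)
qed

lemma holomorphic_on_vec_imp_continuous_on:
  fixes f :: "complex \<Rightarrow> complex ^ 'n"
  assumes "\<And>i. (\<lambda>\<zeta>. f \<zeta> $ i) holomorphic_on S"
  shows "continuous_on S f"
  unfolding continuous_on_def
  using assms holomorphic_on_imp_continuous_on continuous_on_def by (blast intro: vec_tendstoI)

lemma compose_disc_deriv:
  fixes G :: "complex ^ 'n \<Rightarrow> complex"
  assumes "holomorphic_fun_on G D" "open D"
    and "\<And>i. (\<lambda>\<zeta>. f \<zeta> $ i) holomorphic_on S" "open S" "x \<in> S" "f x \<in> D"
  shows "((\<lambda>\<zeta>. G (f \<zeta>)) has_field_derivative (vec_deriv f x \<odot> cgrad G (f x))) (at x)"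
  using has_derivative_compose[OF has_derivative_vec_deriv[OF assms(3-5)] has_derivative_cgrad[OF assms(1,2,6)]]
  by (simp add: has_field_derivative_def scalar_product_cmult_left mult.commute[of _ "_ \<odot> _"])

lemma compose_disc_holomorphic:
  fixes G :: "complex ^ 'n \<Rightarrow> complex"
  assumes "holomorphic_fun_on G D" "open D"
    and "\<And>i. (\<lambda>\<zeta>. f \<zeta> $ i) holomorphic_on S" "open S" "f ` S \<subseteq> D"
  shows "(\<lambda>\<zeta>. G (f \<zeta>)) holomorphic_on S"
  using compose_disc_deriv[OF assms(1-4)] assms(4,5)
  by (subst holomorphic_on_open) auto

text \<open>
  Conjugation carries a covector \<open>w\<close> for the bilinear product to the vector whose real inner
  product is \<open>Re (_ \<odot> w)\<close>; it translates between complex covectors and real normals.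
\<close>

definition cnj_vec :: "complex ^ 'n \<Rightarrow> complex ^ 'n" where
  "cnj_vec w = (\<chi> i. cnj (w $ i))"

lemma inner_cnj_vec: "cnj_vec w \<bullet> v = Re (v \<odot> w)"
  by (simp add: inner_vec_def scalar_product_def cnj_vec_def inner_complex_def algebra_simps)

lemma norm_cnj_vec [simp]: "norm (cnj_vec w) = norm w"
  by (simp add: norm_vec_def cnj_vec_def)

lemma cnj_vec_cnj_vec [simp]: "cnj_vec (cnj_vec w) = w"
  by (simp add: cnj_vec_def vec_eq_iff)

lemma cnj_vec_eq_0_iff [simp]: "cnj_vec w = 0 \<longleftrightarrow> w = 0"
  by (simp add: cnj_vec_def vec_eq_iff)

lemma cnj_vec_scalar_product: "cnj_vec w \<odot> w = of_real ((norm w)\<^sup>2)"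
  by (simp add: scalar_product_def cnj_vec_def norm_vec_def L2_set_def sum_nonneg
      complex_norm_square[symmetric] mult.commute[of "cnj _"])

section \<open>Cauchy estimates and limits of holomorphic functions\<close>

text \<open>
  Limits are taken along filters finer than a given one instead of along subsequences, so that
  compactness of a product (which need not be sequential) can be used directly.
\<close>

lemma cluster_subfilter:
  fixes \<phi> :: "'i \<Rightarrow> 'a :: topological_space"
  assumes "F \<noteq> bot" "compact K" "eventually (\<lambda>i. \<phi> i \<in> K) F"
  obtains F' x where "F' \<le> F" "F' \<noteq> bot" "x \<in> K" "(\<phi> \<longlongrightarrow> x) F'"
proof -
  have "filtermap \<phi> F \<noteq> bot" using assms(1) by (simp add: filtermap_bot_iff)
  moreover have "eventually (\<lambda>x. x \<in> K) (filtermap \<phi> F)"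
    using assms(3) by (simp add: eventually_filtermap)
  ultimately obtain x where x: "x \<in> K" "inf (nhds x) (filtermap \<phi> F) \<noteq> bot"
    using assms(2) unfolding compact_filter by blast
  define F' where "F' = inf F (filtercomap \<phi> (nhds x))"
  have "F' \<noteq> bot"
  proof
    assume "F' = bot"
    then have "eventually (\<lambda>_. False) (inf F (filtercomap \<phi> (nhds x)))"
      by (simp add: F'_def)
    then obtain P Q where PQ: "eventually P F" "eventually Q (filtercomap \<phi> (nhds x))" "\<And>i. P i \<Longrightarrow> Q i \<Longrightarrow> False"
      unfolding eventually_inf by blast
    from PQ(2) obtain R where R: "eventually R (nhds x)" "\<And>i. R (\<phi> i) \<Longrightarrow> Q i"
      unfolding eventually_filtercomap by blast
    have "eventually (\<lambda>y. \<not> R y) (filtermap \<phi> F)"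
      unfolding eventually_filtermap using PQ(1) by (rule eventually_mono) (use PQ(3) R(2) in blast)
    then have "eventually (\<lambda>_. False) (inf (nhds x) (filtermap \<phi> F))"
      unfolding eventually_inf using R(1) by blast
    then show False using x(2) by (simp add: trivial_limit_def[symmetric] eventually_False)
  qed
  moreover have "F' \<le> F" by (simp add: F'_def)
  moreover have "(\<phi> \<longlongrightarrow> x) F'"
    unfolding filterlim_iff F'_def
  proof (intro allI impI)
    fix P assume "eventually P (nhds x)"
    then have "eventually (\<lambda>i. P (\<phi> i)) (filtercomap \<phi> (nhds x))"
      by (auto simp: eventually_filtercomap)
    then show "eventually (\<lambda>i. P (\<phi> i)) (inf F (filtercomap \<phi> (nhds x)))"
      by (meson filter_leD inf.cobounded2)
  qed
  ultimately show thesis using that x(1) by blast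
qed

text \<open>
  Tychonoff: pointwise bounded families lie in a product of closed balls. For locally bounded
  holomorphic functions this already makes the limit holomorphic, see below.
\<close>

lemma pointwise_cluster:
  fixes h :: "'i \<Rightarrow> 'a \<Rightarrow> 'b :: {heine_borel, real_normed_vector}"
  assumes F: "F \<noteq> bot" and M: "\<And>i z. z \<in> S \<Longrightarrow> norm (h i z) \<le> M z"
  obtains F' H where "F' \<le> F" "F' \<noteq> bot" "\<And>z. z \<in> S \<Longrightarrow> ((\<lambda>i. h i z) \<longlongrightarrow> H z) F'"
proof -
  define k where "k i z = (if z \<in> S then h i z else 0)" for i z
  define K where "K = PiE UNIV (\<lambda>z. cball (0::'b) (if z \<in> S then M z else 0))"
  have "compactin (product_topology (\<lambda>_. euclidean) UNIV) K"
    unfolding K_def by (subst compactin_PiE) auto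
  then have "compact K" by (simp add: euclidean_product_topology)
  moreover have "k i \<in> K" for i using M by (auto simp: K_def k_def)
  ultimately obtain F' H where F': "F' \<le> F" "F' \<noteq> bot" "(k \<longlongrightarrow> H) F'"
    using cluster_subfilter[OF F, of K k] by (metis always_eventually)
  have "((\<lambda>i. h i z) \<longlongrightarrow> H z) F'" if "z \<in> S" for z
  proof (rule topological_tendstoI)
    fix U :: "'b set" assume U: "open U" "H z \<in> U"
    have "open ((\<lambda>f :: 'a \<Rightarrow> 'b. f z) -` U)"
      by (rule open_vimage[OF U(1) continuous_on_product_coordinates])
    then have "eventually (\<lambda>i. k i \<in> (\<lambda>f. f z) -` U) F'"
      using topological_tendstoD[OF F'(3)] U(2) by (metis vimageI)
    then show "eventually (\<lambda>i. h i z \<in> U) F'" using that by (simp add: k_def)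
  qed
  then show thesis using that F' by blast
qed

text \<open>
  The factor 32 comes from Cauchy's estimate of the second derivative on circles of radius
  \<open>r / 4\<close>, which stay in the disc when their centres have modulus at most \<open>r / 2\<close>.
\<close>

lemma taylor_remainder_1:
  assumes g: "g holomorphic_on ball 0 r" and r: "0 < r"
    and M: "\<And>x. x \<in> ball 0 r \<Longrightarrow> norm (g x) \<le> M" and w: "norm w \<le> r / 2"
  shows "norm (g w - g 0 - deriv g 0 * w) \<le> 32 * M / r\<^sup>2 * (norm w)\<^sup>2"
proof -
  define S where "S = cball (0::complex) (r / 2)"
  have SB: "S \<subseteq> ball 0 r" using r by (auto simp: S_def)
  have "cmod ((deriv ^^ 0) g w - (\<Sum>i\<le>1. (deriv ^^ i) g 0 * (w - 0) ^ i / fact i)) \<le> 32 * M / r\<^sup>2 * cmod (w - 0) ^ Suc 1 / fact 1"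
  proof (rule complex_Taylor[where S = S])
    show "convex S" by (simp add: S_def)
    show "((deriv ^^ i) g has_field_derivative (deriv ^^ Suc i) g x) (at x within S)" if "x \<in> S" for i x
      using holomorphic_derivI[OF holomorphic_higher_deriv[OF g, of i], of x] that SB
      by (auto intro: DERIV_subset)
    show "cmod ((deriv ^^ Suc 1) g x) \<le> 32 * M / r\<^sup>2" if "x \<in> S" for x
    proof -
      have sub: "cball x (r / 4) \<subseteq> ball 0 r"
      proof
        fix y assume "y \<in> cball x (r / 4)"
        moreover have "norm y \<le> norm x + dist x y" by norm
        ultimately show "y \<in> ball 0 r" using that r by (simp add: S_def)
      qed
      have "norm ((deriv ^^ 2) g x) \<le> fact 2 * M / (r / 4) ^ 2"
      proof (rule Cauchy_inequality)
        show "g holomorphic_on ball x (r / 4)" using sub by (meson ball_subset_cball g holomorphic_on_subset order_trans)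
        show "continuous_on (cball x (r / 4)) g" using sub g holomorphic_on_imp_continuous_on continuous_on_subset by blast
        show "norm (g y) \<le> M" if "norm (x - y) = r / 4" for y
          using M sub that by (metis dist_norm mem_cball order_refl subsetD)
      qed (use r in auto)
      then show ?thesis by (simp add: numeral_2_eq_2[symmetric] power_divide)
    qed
  qed (use w r in \<open>auto simp: S_def\<close>)
  then show ?thesis by (simp add: power2_eq_square algebra_simps)
qed

lemma affine_disc_holomorphic: "(\<lambda>\<zeta>. (a + \<zeta> *s b) $ i) holomorphic_on S"
  by (auto intro!: holomorphic_intros)

lemma vec_deriv_affine [simp]: "vec_deriv (\<lambda>\<zeta>. a + \<zeta> *s b) x = b"
proof -
  have "deriv (\<lambda>\<zeta>. (a + \<zeta> *s b) $ i) x = b $ i" for i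
    by (rule DERIV_imp_deriv) (auto intro!: derivative_eq_intros)
  then show ?thesis by (simp only: vec_deriv_def) (simp add: vec_eq_iff)
qed

lemma holomorphic_fun_on_line:
  fixes G :: "complex ^ 'n \<Rightarrow> complex"
  assumes "holomorphic_fun_on G D" "open D" "open S" "\<And>\<zeta>. \<zeta> \<in> S \<Longrightarrow> a + \<zeta> *s b \<in> D"
  shows "(\<lambda>\<zeta>. G (a + \<zeta> *s b)) holomorphic_on S"
    and "x \<in> S \<Longrightarrow> ((\<lambda>\<zeta>. G (a + \<zeta> *s b)) has_field_derivative (b \<odot> cgrad G (a + x *s b))) (at x)"
proof -
  show "(\<lambda>\<zeta>. G (a + \<zeta> *s b)) holomorphic_on S"
    by (rule compose_disc_holomorphic[OF assms(1,2) affine_disc_holomorphic assms(3)]) (use assms(4) in auto)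
  show "((\<lambda>\<zeta>. G (a + \<zeta> *s b)) has_field_derivative (b \<odot> cgrad G (a + x *s b))) (at x)" if "x \<in> S"
    using compose_disc_deriv[OF assms(1,2) affine_disc_holomorphic[of a b] assms(3) that assms(4)[OF that]]
    by simp
qed

text \<open>
  The one-variable remainder on the complex line spanned by \<open>v\<close>.
\<close>

lemma cauchy_remainder:
  fixes G :: "complex ^ 'n \<Rightarrow> complex"
  assumes G: "holomorphic_fun_on G (ball z r)" and r: "0 < r"
    and M: "\<And>y. y \<in> ball z r \<Longrightarrow> norm (G y) \<le> M" and v: "norm v \<le> r / 2"
  shows "norm (G (z + v) - G z - v \<odot> cgrad G z) \<le> 32 * M / r\<^sup>2 * (norm v)\<^sup>2"
proof (cases "v = 0")
  case False
  define u where "u = (1 / norm v) *\<^sub>R v"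
  have nu: "norm u = 1" using False by (simp add: u_def)
  define g where "g \<zeta> = G (z + \<zeta> *s u)" for \<zeta>
  have in_ball: "z + \<zeta> *s u \<in> ball z r" if "\<zeta> \<in> ball 0 r" for \<zeta>
    using that by (simp add: dist_norm norm_cmult_vec nu)
  have vu: "v = of_real (norm v) *s u" using False by (simp add: u_def vec_eq_iff) (simp add: scaleR_conv_of_real)
  have "g holomorphic_on ball 0 r"
    unfolding g_def by (rule holomorphic_fun_on_line(1)[OF G]) (use in_ball in auto)
  moreover have "deriv g 0 = u \<odot> cgrad G z"
  proof -
    have "(g has_field_derivative u \<odot> cgrad G (z + 0 *s u)) (at 0)"
      unfolding g_def by (rule holomorphic_fun_on_line(2)[OF G, where S = "ball 0 r"]) (use in_ball r in auto)
    then show ?thesis by (simp add: DERIV_imp_deriv)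
  qed
  ultimately have "norm (g (norm v) - g 0 - (u \<odot> cgrad G z) * norm v) \<le> 32 * M / r\<^sup>2 * (norm (complex_of_real (norm v)))\<^sup>2"
    using taylor_remainder_1[of g r M "of_real (norm v)"] r v M in_ball by (simp add: g_def)
  moreover have "v \<odot> cgrad G z = (u \<odot> cgrad G z) * norm v"
    by (subst vu) (simp add: scalar_product_cmult_left)
  moreover have "g (norm v) = G (z + v)" "g 0 = G z" using vu by (simp_all add: g_def)
  ultimately show ?thesis by simp
qed simp

text \<open>
  The quadratic remainder at a vector of length \<open>r / 2\<close> that is aligned with the gradient is at
  most \<open>8 * M\<close>; two values of \<open>G\<close> add \<open>2 * M\<close>.
\<close>

lemma norm_cgrad_le:
  fixes G :: "complex ^ 'n \<Rightarrow> complex"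
  assumes G: "holomorphic_fun_on G (ball z r)" and r: "0 < r"
    and M: "\<And>y. y \<in> ball z r \<Longrightarrow> norm (G y) \<le> M"
  shows "norm (cgrad G z) \<le> 20 * M / r"
proof (cases "cgrad G z = 0")
  case True
  have "0 \<le> M" using M[of z] r by (smt (verit) centre_in_ball norm_ge_zero)
  then show ?thesis using True r by simp
next
  case False
  define c where "c = cgrad G z"
  define v where "v = (r / (2 * norm c)) *\<^sub>R cnj_vec c"
  have nv: "norm v = r / 2" using False r by (simp add: v_def c_def)
  have zv: "z + v \<in> ball z r" using nv r by (simp add: dist_norm)
  have "v \<odot> c = (r / (2 * norm c)) *\<^sub>R of_real ((norm c)\<^sup>2)"
    by (simp only: v_def scalar_product_scaleR_left cnj_vec_scalar_product)
  then have vc: "norm (v \<odot> c) = r / 2 * norm c"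
    using False r by (simp add: c_def power2_eq_square norm_mult norm_divide)
  have "norm (v \<odot> c) \<le> norm (G (z + v) - G z - v \<odot> c) + norm (G (z + v)) + norm (G z)"
    by norm
  also have "\<dots> \<le> 32 * M / r\<^sup>2 * (norm v)\<^sup>2 + M + M"
    using cauchy_remainder[OF G r M, of v] nv M[OF zv] M[of z] r unfolding c_def
    by (intro add_mono) auto
  also have "\<dots> = 10 * M" using r by (simp add: nv power2_eq_square field_simps)
  finally show ?thesis using r by (simp add: vc c_def[symmetric] field_simps)
qed

lemma has_derivative_quadratic:
  fixes H :: "'a :: real_normed_vector \<Rightarrow> 'b :: real_normed_vector"
  assumes "bounded_linear L" "0 < \<delta>"
    and "\<And>v. norm v \<le> \<delta> \<Longrightarrow> norm (H (z + v) - H z - L v) \<le> C * (norm v)\<^sup>2"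
  shows "(H has_derivative L) (at z)"
proof (rule has_derivativeI_sandwich[where e = \<delta> and H = "\<lambda>y. C * norm (y - z)"])
  show "((\<lambda>y. C * norm (y - z)) \<longlongrightarrow> 0) (at z)"
    by (auto intro!: tendsto_eq_intros)
  fix y assume "dist y z < \<delta>" "y \<noteq> z"
  then show "norm (H y - H z - L (y - z)) / norm (y - z) \<le> C * norm (y - z)"
    using assms(3)[of "y - z"] by (simp add: dist_norm power2_eq_square field_simps)
qed (use assms in auto)

text \<open>
  The gradients at \<open>z\<close> are bounded by Cauchy's estimate and so converge along a finer filter;
  the uniform quadratic remainder passes to the limit and gives differentiability there.
\<close>

lemma holomorphic_fun_on_limit:
  fixes h :: "'i \<Rightarrow> complex ^ 'n \<Rightarrow> complex"
  assumes F: "F \<noteq> bot"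
    and loc: "\<And>z. z \<in> D \<Longrightarrow> \<exists>r>0. \<exists>M. ball z r \<subseteq> D \<and>
      eventually (\<lambda>i. holomorphic_fun_on (h i) (ball z r) \<and> (\<forall>y\<in>ball z r. norm (h i y) \<le> M)) F"
    and lim: "\<And>z. z \<in> D \<Longrightarrow> ((\<lambda>i. h i z) \<longlongrightarrow> H z) F"
  shows "holomorphic_fun_on H D"
proof (rule holomorphic_fun_onI)
  fix z assume z: "z \<in> D"
  then obtain r M where r: "0 < r" "ball z r \<subseteq> D"
    and ev: "eventually (\<lambda>i. holomorphic_fun_on (h i) (ball z r) \<and> (\<forall>y\<in>ball z r. norm (h i y) \<le> M)) F"
    using loc by blast
  have "eventually (\<lambda>i. cgrad (h i) z \<in> cball 0 (20 * M / r)) F"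
    using ev
  proof eventually_elim
    case (elim i)
    then show ?case using norm_cgrad_le[of "h i" z r M] r(1) by simp
  qed
  then obtain F' c where F': "F' \<le> F" "F' \<noteq> bot" and c: "((\<lambda>i. cgrad (h i) z) \<longlongrightarrow> c) F'"
    using cluster_subfilter[OF F compact_cball, of "\<lambda>i. cgrad (h i) z" 0 "20 * M / r"] by metis
  have "norm (H (z + v) - H z - v \<odot> c) \<le> 32 * M / r\<^sup>2 * (norm v)\<^sup>2" if v: "norm v \<le> r / 2" for v
  proof (rule tendsto_upperbound[OF _ _ F'(2)])
    have zv: "z + v \<in> D" using v r by (auto simp: dist_norm intro!: subsetD[OF r(2)])
    have *: "((\<lambda>i. h i y) \<longlongrightarrow> H y) F'" if "y \<in> D" for y
      using lim[OF that] F'(1) tendsto_mono by blast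
    have "((\<lambda>i. v \<odot> cgrad (h i) z) \<longlongrightarrow> v \<odot> c) F'"
      unfolding scalar_product_def by (intro tendsto_intros c)
    then show "((\<lambda>i. norm (h i (z + v) - h i z - v \<odot> cgrad (h i) z)) \<longlongrightarrow> norm (H (z + v) - H z - v \<odot> c)) F'"
      by (intro tendsto_intros * z zv)
    show "eventually (\<lambda>i. norm (h i (z + v) - h i z - v \<odot> cgrad (h i) z) \<le> 32 * M / r\<^sup>2 * (norm v)\<^sup>2) F'"
      using filter_leD[OF F'(1) ev] 
    proof eventually_elim
      case (elim i)
      then show ?case using cauchy_remainder[of "h i" z r M v] r(1) v by simp
    qed
  qed
  then have "(H has_derivative (\<lambda>v. v \<odot> c)) (at z)"
    using r(1) by (intro has_derivative_quadratic[where \<delta> = "r / 2" and C = "32 * M / r\<^sup>2"]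
      bounded_linear_scalar_product_left) auto
  then show "\<exists>w. (H has_derivative (\<lambda>v. v \<odot> w)) (at z)" by blast
qed

lemma holomorphic_fun_on_bounded_limit:
  fixes h :: "'i \<Rightarrow> complex ^ 'n \<Rightarrow> complex"
  assumes F: "F \<noteq> bot" and D: "open D" and h: "\<And>i. holomorphic_fun_on (h i) D"
    and B: "\<And>i z. z \<in> D \<Longrightarrow> norm (h i z) \<le> B"
    and lim: "\<And>z. z \<in> D \<Longrightarrow> ((\<lambda>i. h i z) \<longlongrightarrow> H z) F"
  shows "holomorphic_fun_on H D"
proof (rule holomorphic_fun_on_limit[OF F _ lim])
  fix z assume "z \<in> D"
  then obtain r where r: "0 < r" "ball z r \<subseteq> D" using D open_contains_ball by blast
  then have "\<forall>i. holomorphic_fun_on (h i) (ball z r) \<and> (\<forall>y\<in>ball z r. norm (h i y) \<le> B)"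
    using holomorphic_fun_on_subset[OF h] B by blast
  then show "\<exists>r>0. \<exists>M. ball z r \<subseteq> D \<and>
      eventually (\<lambda>i. holomorphic_fun_on (h i) (ball z r) \<and> (\<forall>y\<in>ball z r. norm (h i y) \<le> M)) F"
    using r by (intro exI[of _ r] exI[of _ B] conjI always_eventually)
qed

text \<open>
  A substitute for Montel's theorem: the cluster filter replaces a subsequence, and the
  convergence is only pointwise.
\<close>

lemma bounded_sequence_cluster:
  fixes h :: "nat \<Rightarrow> complex ^ 'n \<Rightarrow> complex"
  assumes D: "open D" and h: "\<And>n. holomorphic_fun_on (h n) D"
    and B: "\<And>n z. z \<in> D \<Longrightarrow> norm (h n z) \<le> B"
  obtains F H where "F \<le> sequentially" "F \<noteq> bot" "\<And>z. z \<in> D \<Longrightarrow> ((\<lambda>n. h n z) \<longlongrightarrow> H z) F"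
    "holomorphic_fun_on H D" "\<And>z. z \<in> D \<Longrightarrow> norm (H z) \<le> B"
proof -
  obtain F H where F: "F \<le> sequentially" "F \<noteq> bot" and lim: "\<And>z. z \<in> D \<Longrightarrow> ((\<lambda>n. h n z) \<longlongrightarrow> H z) F"
    using pointwise_cluster[OF sequentially_bot, of D h "\<lambda>_. B"] B by metis
  moreover have "holomorphic_fun_on H D" by (rule holomorphic_fun_on_bounded_limit[OF F(2) D h B lim])
  moreover have "norm (H z) \<le> B" if "z \<in> D" for z
    by (rule tendsto_upperbound[OF tendsto_norm[OF lim[OF that]] _ F(2)]) (use B[OF that] in simp)
  ultimately show thesis using that by blast
qed

lemma holomorphic_fun_on_local:
  assumes "\<And>z. z \<in> D \<Longrightarrow> \<exists>r>0. holomorphic_fun_on G (ball z r)"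
  shows "holomorphic_fun_on G D"
  using assms has_derivative_cgrad by (metis centre_in_ball holomorphic_fun_onI open_ball)

lemma locally_bounded_ball:
  fixes G :: "complex ^ 'n \<Rightarrow> complex"
  assumes "holomorphic_fun_on G D" "open D" "z \<in> D"
  obtains r M where "0 < r" "ball z r \<subseteq> D" "\<And>y. y \<in> ball z r \<Longrightarrow> norm (G y) \<le> M"
proof -
  obtain r where r: "0 < r" "cball z r \<subseteq> D" using assms open_contains_cball by blast
  have "compact (G ` cball z r)"
    using holomorphic_fun_on_imp_continuous_on[OF assms(1)] r(2)
    by (intro compact_continuous_image continuous_on_subset[OF _ r(2)]) auto
  then obtain M where "\<And>y. y \<in> cball z r \<Longrightarrow> norm (G y) \<le> M"
    using compact_imp_bounded bounded_iff by (metis imageI)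
  then show thesis using that[of r M] r by (meson ball_subset_cball order_trans subsetD)
qed

lemma holomorphic_fun_on_translate:
  fixes G :: "complex ^ 'n \<Rightarrow> complex"
  assumes "holomorphic_fun_on G D" "open D" "\<And>z. z \<in> E \<Longrightarrow> z + u \<in> D"
  shows "holomorphic_fun_on (\<lambda>z. G (z + u)) E"
proof (rule holomorphic_fun_onI)
  fix z assume "z \<in> E"
  then have G: "(G has_derivative (\<lambda>v. v \<odot> cgrad G (z + u))) (at (z + u))"
    using has_derivative_cgrad[OF assms(1,2)] assms(3) by blast
  have "((\<lambda>z. z + u) has_derivative (\<lambda>v. v)) (at z)" by (auto intro!: derivative_eq_intros)
  from has_derivative_compose[OF this G]
  show "\<exists>w. ((\<lambda>z. G (z + u)) has_derivative (\<lambda>v. v \<odot> w)) (at z)" by blast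
qed

lemma holomorphic_fun_on_scaled_diff:
  assumes "holomorphic_fun_on G D" "holomorphic_fun_on K D" "open D"
  shows "holomorphic_fun_on (\<lambda>z. c * (G z - K z)) D"
proof (rule holomorphic_fun_onI)
  fix z assume z: "z \<in> D"
  have "((\<lambda>z. c * (G z - K z)) has_derivative (\<lambda>v. c * (v \<odot> cgrad G z - v \<odot> cgrad K z))) (at z)"
    by (intro derivative_intros has_derivative_cgrad[OF _ assms(3) z] assms)
  moreover have "c * (v \<odot> cgrad G z - v \<odot> cgrad K z) = v \<odot> (c *s (cgrad G z - cgrad K z))" for v
    by (simp add: scalar_product_def sum_distrib_left sum_subtractf algebra_simps)
  ultimately show "\<exists>w. ((\<lambda>z. c * (G z - K z)) has_derivative (\<lambda>v. v \<odot> w)) (at z)"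
    by auto
qed

text \<open>
  Derivatives of holomorphic functions of several variables are holomorphic because they are
  locally bounded limits of difference quotients.
\<close>

lemma holomorphic_cgrad:
  fixes G :: "complex ^ 'n \<Rightarrow> complex"
  assumes G: "holomorphic_fun_on G D" and D: "open D"
  shows "holomorphic_fun_on (\<lambda>z. v \<odot> cgrad G z) D"
proof (rule holomorphic_fun_on_local)
  fix z0 assume z0: "z0 \<in> D"
  obtain R M where R: "0 < R" "ball z0 R \<subseteq> D" and M: "\<And>y. y \<in> ball z0 R \<Longrightarrow> norm (G y) \<le> M"
    using locally_bounded_ball[OF G D z0] by metis
  \<comment> \<open>A third of the radius leaves room for a ball of radius \<open>2 * r\<close> about every point of
    \<open>ball z0 r\<close> and for the shift by \<open>u n\<close>.\<close>
  define r where "r = R / 3"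
  have r: "0 < r" using R by (simp add: r_def)
  have sub: "ball y (2 * r) \<subseteq> ball z0 R" if "y \<in> ball z0 r" for y
  proof
    fix x assume "x \<in> ball y (2 * r)"
    moreover have "dist z0 x \<le> dist z0 y + dist y x" by (rule dist_triangle)
    ultimately show "x \<in> ball z0 R" using that by (simp add: r_def)
  qed
  define u where "u n = complex_of_real (1 / of_nat (Suc n)) *s v" for n
  define h where "h n z = of_nat (Suc n) * (G (z + u n) - G z)" for n :: nat and z
  define C where "C = 8 * M / r\<^sup>2 * (norm v)\<^sup>2"
  have M0: "0 \<le> M" using M[of z0] R by (smt (verit) centre_in_ball norm_ge_zero)
  have nu: "norm (u n) = norm v / of_nat (Suc n)" for n
    by (simp add: u_def norm_cmult_vec norm_divide del: of_nat_Suc)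
  have est: "norm (h n y - v \<odot> cgrad G y) \<le> C / of_nat (Suc n)"
    if y: "y \<in> ball z0 r" and n: "norm (u n) \<le> r" for n y
  proof -
    have "norm (G (y + u n) - G y - u n \<odot> cgrad G y) \<le> 32 * M / (2 * r)\<^sup>2 * (norm (u n))\<^sup>2"
      by (rule cauchy_remainder[OF holomorphic_fun_on_subset[OF G]])
         (use sub[OF y] R r n M in auto)
    also have "\<dots> = C / (of_nat (Suc n))\<^sup>2"
      by (simp add: nu C_def power2_eq_square field_simps del: of_nat_Suc)
    finally have "of_nat (Suc n) * norm (G (y + u n) - G y - u n \<odot> cgrad G y) \<le> C / of_nat (Suc n)"
      by (simp add: power2_eq_square field_simps del: of_nat_Suc)
    moreover have "h n y - v \<odot> cgrad G y = of_nat (Suc n) * (G (y + u n) - G y - u n \<odot> cgrad G y)"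
      by (simp add: h_def u_def scalar_product_cmult_left algebra_simps del: of_nat_Suc)
    ultimately show ?thesis by (simp add: norm_mult del: of_nat_Suc)
  qed
  have "(\<lambda>n. norm v / of_nat (Suc n)) \<longlonglongrightarrow> 0"
    by (rule LIMSEQ_Suc[OF lim_const_over_n])
  then have ev: "eventually (\<lambda>n. norm (u n) \<le> r) sequentially"
    using r order_tendstoD(2) by (force simp: nu elim: eventually_mono)
  have "holomorphic_fun_on (\<lambda>z. v \<odot> cgrad G z) (ball z0 r)"
  proof (rule holomorphic_fun_on_limit[where h = h and F = sequentially])
    fix z assume z: "z \<in> ball z0 r"
    define s where "s = r - dist z0 z"
    have s: "0 < s" "ball z s \<subseteq> ball z0 r"
      using z by (auto simp: s_def intro!: order_trans[OF dist_triangle]) (smt (verit) dist_triangle)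
    have "eventually (\<lambda>n. holomorphic_fun_on (h n) (ball z s) \<and> (\<forall>y\<in>ball z s. norm (h n y) \<le> norm v * (10 * M / r) + C)) sequentially"
      using ev
    proof eventually_elim
      case (elim n)
      have yR: "y + u n \<in> ball z0 R" if "y \<in> ball z0 r" for y
        by (rule subsetD[OF sub[OF that]]) (use elim r in \<open>simp add: dist_norm\<close>)
      have rR: "ball z0 r \<subseteq> ball z0 R" using r by (auto simp: r_def)
      have "holomorphic_fun_on (h n) (ball z s)"
        unfolding h_def
        by (intro holomorphic_fun_on_scaled_diff holomorphic_fun_on_translate[OF G D] holomorphic_fun_on_subset[OF G])
           (use yR rR s(2) R(2) in blast)+
      moreover have "norm (h n y) \<le> norm v * (10 * M / r) + C" if "y \<in> ball z s" for y
      proof -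
        have y: "y \<in> ball z0 r" using that s(2) by blast
        have "norm (cgrad G y) \<le> 20 * M / (2 * r)"
          by (rule norm_cgrad_le[OF holomorphic_fun_on_subset[OF G]]) (use sub[OF y] R r M in auto)
        then have "norm (v \<odot> cgrad G y) \<le> norm v * (10 * M / r)"
          by (intro order_trans[OF norm_scalar_product_le] mult_left_mono) auto
        moreover have "C / of_nat (Suc n) \<le> C / 1"
          by (rule divide_left_mono) (use M0 in \<open>auto simp: C_def\<close>)
        moreover have "norm (h n y) \<le> norm (v \<odot> cgrad G y) + norm (h n y - v \<odot> cgrad G y)"
          by (rule norm_triangle_sub)
        ultimately show ?thesis using est[OF y elim] by simp
      qed
      ultimately show ?case by blast
    qed
    then show "\<exists>s>0. \<exists>M. ball z s \<subseteq> ball z0 r \<and> eventually (\<lambda>n. holomorphic_fun_on (h n) (ball z s) \<and> (\<forall>y\<in>ball z s. norm (h n y) \<le> M)) sequentially"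
      using s by blast
    have "(\<lambda>n. h n z - v \<odot> cgrad G z) \<longlonglongrightarrow> 0"
    proof (rule Lim_null_comparison)
      show "eventually (\<lambda>n. norm (h n z - v \<odot> cgrad G z) \<le> C / of_nat (Suc n)) sequentially"
        using ev by eventually_elim (rule est[OF z])
      show "(\<lambda>n. C / of_nat (Suc n)) \<longlonglongrightarrow> 0" by (rule LIMSEQ_Suc[OF lim_const_over_n])
    qed
    then show "(\<lambda>n. h n z) \<longlonglongrightarrow> v \<odot> cgrad G z" by (simp add: LIM_zero_iff)
  qed simp
  then show "\<exists>r>0. holomorphic_fun_on (\<lambda>z. v \<odot> cgrad G z) (ball z0 r)" using r by blast
qed

lemma cgrad_along_disc_holomorphic:
  fixes G :: "complex ^ 'n \<Rightarrow> complex"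
  assumes "holomorphic_fun_on G D" "open D" "\<And>i. (\<lambda>\<zeta>. f \<zeta> $ i) holomorphic_on S" "open S" "f ` S \<subseteq> D"
  shows "(\<lambda>\<zeta>. cgrad G (f \<zeta>) $ j) holomorphic_on S"
proof -
  have "(\<lambda>\<zeta>. axis j 1 \<odot> cgrad G (f \<zeta>)) holomorphic_on S"
    by (rule compose_disc_holomorphic[OF holomorphic_cgrad[OF assms(1,2)] assms(2-5)])
  moreover have "axis j 1 \<odot> w = w $ j" for w :: "complex ^ 'n"
    by (simp add: scalar_product_def axis_def if_distrib[where f = "\<lambda>x. x * _"] cong: if_cong)
  ultimately show ?thesis by simp
qed

text \<open>
  The one-variable case, read off on \<open>complex ^ 1\<close>.
\<close>

lemma holomorphic_on_limit:
  fixes h :: "'i \<Rightarrow> complex \<Rightarrow> complex"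
  assumes F: "F \<noteq> bot" and S: "open S"
    and loc: "\<And>z. z \<in> S \<Longrightarrow> \<exists>r>0. \<exists>M. ball z r \<subseteq> S \<and>
      eventually (\<lambda>i. h i holomorphic_on ball z r \<and> (\<forall>y\<in>ball z r. norm (h i y) \<le> M)) F"
    and lim: "\<And>z. z \<in> S \<Longrightarrow> ((\<lambda>i. h i z) \<longlongrightarrow> H z) F"
  shows "H holomorphic_on S"
proof -
  define E where "E = {z :: complex ^ 1. z $ 1 \<in> S}"
  have E: "open E" unfolding E_def
    using open_vimage[OF S, of "\<lambda>z :: complex ^ 1. z $ 1"] by (simp add: vimage_def continuous_on_component)
  have "holomorphic_fun_on (\<lambda>z. H (z $ 1)) E"
  proof (rule holomorphic_fun_on_limit[OF F, where h = "\<lambda>i z. h i (z $ 1)"])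
    fix z assume z: "z \<in> E"
    then obtain r M where r: "0 < r" "ball (z $ 1) r \<subseteq> S"
      and ev: "eventually (\<lambda>i. h i holomorphic_on ball (z $ 1) r \<and> (\<forall>y\<in>ball (z $ 1) r. norm (h i y) \<le> M)) F"
      using loc[of "z $ 1"] z unfolding E_def by blast
    have sub: "y $ 1 \<in> ball (z $ 1) r" if "y \<in> ball z r" for y
      using that Finite_Cartesian_Product.norm_nth_le[of "z - y" 1] by (simp add: dist_norm)
    have "eventually (\<lambda>i. holomorphic_fun_on (\<lambda>z. h i (z $ 1)) (ball z r) \<and> (\<forall>y\<in>ball z r. norm (h i (y $ 1)) \<le> M)) F"
      using ev
    proof eventually_elim
      case (elim i)
      have "holomorphic_fun_on (\<lambda>z. h i (z $ 1)) (ball z r)"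
      proof (rule holomorphic_fun_on_clinearI)
        fix y assume "y \<in> ball z r"
        then have "(h i has_field_derivative deriv (h i) (y $ 1)) (at (y $ 1))"
          using sub elim by (meson holomorphic_derivI open_ball)
        then have "(h i has_derivative (\<lambda>k. deriv (h i) (y $ 1) * k)) (at (y $ 1))"
          by (simp add: has_field_derivative_def)
        from has_derivative_compose[OF bounded_linear.has_derivative[OF bounded_linear_vec_nth has_derivative_ident] this]
        show "\<exists>L. ((\<lambda>z. h i (z $ 1)) has_derivative L) (at y) \<and> (\<forall>c v. L (c *s v) = c * L v)"
          by (force simp: mult_ac)
      qed
      then show ?case using elim sub by blast
    qed
    moreover have "ball z r \<subseteq> E" using sub r(2) by (auto simp: E_def)
    ultimately show "\<exists>r>0. \<exists>M. ball z r \<subseteq> E \<and> eventually (\<lambda>i. holomorphic_fun_on (\<lambda>z. h i (z $ 1)) (ball z r) \<and> (\<forall>y\<in>ball z r. norm (h i (y $ 1)) \<le> M)) F"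
      using r(1) by blast
  qed (use lim in \<open>auto simp: E_def\<close>)
  from holomorphic_fun_on_line(1)[OF this E S, of 0 "vec 1"]
  show ?thesis by (simp add: E_def)
qed

text \<open>
  Slices by complex lines reduce the maximum principle and the identity theorem on convex
  domains to one variable.
\<close>

lemma line_convex_slice:
  fixes D :: "(complex ^ 'n) set"
  assumes "open D" "convex D"
  shows "open {s. a + s *s b \<in> D}" "connected {s. a + s *s b \<in> D}"
proof -
  have "continuous_on UNIV (\<lambda>s. a + s *s b)"
    by (intro continuous_intros bounded_linear.continuous_on[OF bounded_linear_cmult_left])
  from open_vimage[OF assms(1) this] show "open {s. a + s *s b \<in> D}" by (simp add: vimage_def)
  have "convex {s. a + s *s b \<in> D}"
  proof (rule convexI)
    fix x y :: complex and u v :: real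
    assume "x \<in> {s. a + s *s b \<in> D}" "y \<in> {s. a + s *s b \<in> D}" and uv: "0 \<le> u" "0 \<le> v" "u + v = 1"
    then have xy: "a + x *s b \<in> D" "a + y *s b \<in> D" by auto
    have v: "v = 1 - u" using uv(3) by simp
    have "a + (of_real u * x + of_real v * y) *s b = u *\<^sub>R (a + x *s b) + v *\<^sub>R (a + y *s b)"
      unfolding vec_eq_iff vector_add_component vector_smult_component vector_scaleR_component v
      by (simp add: scaleR_conv_of_real algebra_simps)
    moreover have "u *\<^sub>R (a + x *s b) + v *\<^sub>R (a + y *s b) \<in> D"
      using convexD[OF assms(2) xy uv] .
    ultimately show "u *\<^sub>R x + v *\<^sub>R y \<in> {s. a + s *s b \<in> D}"
      by (simp only: mem_Collect_eq scaleR_conv_of_real)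
  qed
  then show "connected {s. a + s *s b \<in> D}" by (rule convex_connected)
qed

lemma holomorphic_fun_strict_max:
  fixes H :: "complex ^ 'n \<Rightarrow> complex"
  assumes H: "holomorphic_fun_on H D" and D: "open D" "convex D"
    and le: "\<And>z. z \<in> D \<Longrightarrow> norm (H z) \<le> B" and q: "q \<in> D" "norm (H q) < B" and z: "z \<in> D"
  shows "norm (H z) < B"
proof (rule ccontr)
  assume "\<not> norm (H z) < B"
  then have Hz: "norm (H z) = B" using le[OF z] by simp
  define V where "V = {s. q + s *s (z - q) \<in> D}"
  have V: "open V" "connected V" unfolding V_def by (rule line_convex_slice[OF D])+
  define g where "g s = H (q + s *s (z - q))" for s
  have "g constant_on V"
  proof (rule maximum_modulus_principle[of g V V 1])
    show "g holomorphic_on V" unfolding g_def V_def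
      by (rule holomorphic_fun_on_line(1)[OF H D(1) V(1)[unfolded V_def]]) simp
    show "\<And>s. s \<in> V \<Longrightarrow> norm (g s) \<le> norm (g 1)" using le Hz by (auto simp: g_def V_def)
  qed (use V z in \<open>auto simp: V_def\<close>)
  moreover have "0 \<in> V" "1 \<in> V" using q z by (auto simp: V_def)
  ultimately have "g 0 = g 1" by (metis constant_on_def)
  then show False using Hz q(2) by (simp add: g_def)
qed

section \<open>Fixed points of contractions of the disc\<close>

text \<open>
  The pseudo-hyperbolic distance; the Poincare distance is its inverse hyperbolic tangent.
\<close>

definition pseudo_dist :: "complex \<Rightarrow> complex \<Rightarrow> real" where
  "pseudo_dist a b = norm (a - b) / norm (1 - cnj a * b)"

lemma one_minus_cnj_mult_nonzero:
  assumes "norm (a :: complex) < 1" "norm b < 1"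
  shows "1 - cnj a * b \<noteq> 0"
proof
  assume "1 - cnj a * b = 0"
  then have "norm (cnj a * b) = 1" by (metis norm_one right_minus_eq)
  moreover have "norm (cnj a * b) < 1 * 1"
    unfolding norm_mult complex_mod_cnj using assms by (intro mult_strict_mono') auto
  ultimately show False by simp
qed

lemma norm_Moebius_eq: "norm (Moebius_function 0 w z) = pseudo_dist w z"
  by (simp add: Moebius_function_simple pseudo_dist_def norm_divide norm_minus_commute)

lemma pseudo_dist_less_1: "norm a < 1 \<Longrightarrow> norm b < 1 \<Longrightarrow> pseudo_dist a b < 1"
  by (metis norm_Moebius_eq Moebius_function_norm_lt_1)

lemma pseudo_dist_nonneg: "0 \<le> pseudo_dist a b"
  by (simp add: pseudo_dist_def)

lemma Schwarz_Pick:
  assumes g: "g holomorphic_on ball 0 1" and le: "\<And>z. norm z < 1 \<Longrightarrow> norm (g z) < 1"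
    and a: "norm a < 1" and b: "norm b < 1"
  shows "pseudo_dist (g a) (g b) \<le> pseudo_dist a b"
proof -
  define k where "k \<xi> = Moebius_function 0 (g a) (g (Moebius_function 0 (- a) \<xi>))" for \<xi>
  have inner: "Moebius_function 0 (- a) \<xi> \<in> ball 0 1" if "\<xi> \<in> ball 0 1" for \<xi>
    using that a Moebius_function_norm_lt_1[of "- a" \<xi> 0] by simp
  have "(\<lambda>\<xi>. g (Moebius_function 0 (- a) \<xi>)) holomorphic_on ball 0 1"
    using holomorphic_on_compose_gen[OF Moebius_function_holomorphic[of "- a" 0] g] inner a
    by (simp add: o_def image_subset_iff)
  then have "k holomorphic_on ball 0 1"
    using holomorphic_on_compose_gen[OF _ Moebius_function_holomorphic[OF le[OF a]], of _ "ball 0 1"] inner le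
    unfolding k_def by (fastforce simp: o_def)
  moreover have "k 0 = 0"
    by (simp add: k_def Moebius_function_of_zero Moebius_function_eq_zero)
  moreover have "norm (k \<xi>) < 1" if "norm \<xi> < 1" for \<xi>
    using inner[of \<xi>] that le a by (auto simp: k_def intro!: Moebius_function_norm_lt_1)
  moreover have nb: "norm (Moebius_function 0 a b) < 1"
    using a b by (rule Moebius_function_norm_lt_1)
  ultimately have "norm (k (Moebius_function 0 a b)) \<le> norm (Moebius_function 0 a b)"
    using Schwarz_Lemma(1) by blast
  moreover have "Moebius_function 0 (- a) (Moebius_function 0 a b) = b"
    by (rule Moebius_function_compose) (use a b in auto)
  ultimately show ?thesis by (simp add: k_def norm_Moebius_eq)
qed

text \<open>
  This is the inequality by which multiplication by \<open>s < 1\<close> contracts the pseudo-hyperbolic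
  distance, with the factor \<open>2 * s / (1 + s^2)\<close>.
\<close>

lemma shrink_ratio:
  fixes c :: complex and s :: real
  assumes s: "0 \<le> s" "s \<le> 1" and c: "norm c \<le> 1"
  shows "(1 + s\<^sup>2) * norm (1 - c) \<le> 2 * norm (1 - of_real (s\<^sup>2) * c)"
proof (rule power2_le_imp_le)
  define R where "R = s\<^sup>2"
  define n where "n = norm c"
  have R: "0 \<le> R" "R \<le> 1" using s by (auto simp: R_def power_le_one)
  have n: "0 \<le> n" "n \<le> 1" "n\<^sup>2 = (Re c)\<^sup>2 + (Im c)\<^sup>2" "- n \<le> Re c"
    using c by (auto simp: n_def cmod_power2) (smt (verit) abs_Re_le_cmod)
  have e1: "(norm (1 - of_real R * c))\<^sup>2 = 1 - 2 * R * Re c + R\<^sup>2 * n\<^sup>2"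
    unfolding cmod_power2 n(3) by (simp add: power2_eq_square algebra_simps)
  have e2: "(norm (1 - c))\<^sup>2 = 1 - 2 * Re c + n\<^sup>2"
    unfolding cmod_power2 n(3) by (simp add: power2_eq_square algebra_simps)
  have "4 * (norm (1 - of_real R * c))\<^sup>2 - (1 + R)\<^sup>2 * (norm (1 - c))\<^sup>2
      = (1 - R) * ((3 + R) + 2 * Re c * (1 - R) - n\<^sup>2 * (1 + 3 * R))"
    unfolding e1 e2 by (simp add: power2_eq_square algebra_simps)
  also have "0 \<le> \<dots>"
  proof (rule mult_nonneg_nonneg)
    have "2 * (- n) * (1 - R) \<le> 2 * Re c * (1 - R)" using n R by (intro mult_right_mono) auto
    moreover have "(3 + R) - 2 * n * (1 - R) - n\<^sup>2 * (1 + 3 * R) = (1 - n) * ((3 + R) + n * (1 + 3 * R))"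
      by (simp add: power2_eq_square algebra_simps)
    moreover have "0 \<le> (1 - n) * ((3 + R) + n * (1 + 3 * R))" using n R by auto
    ultimately show "0 \<le> (3 + R) + 2 * Re c * (1 - R) - n\<^sup>2 * (1 + 3 * R)" by linarith
  qed (use R in auto)
  finally show "((1 + s\<^sup>2) * norm (1 - c))\<^sup>2 \<le> (2 * norm (1 - of_real (s\<^sup>2) * c))\<^sup>2"
    by (simp add: R_def power_mult_distrib)
qed auto

text \<open>
  A self-map with image in the disc of radius \<open>r < s < 1\<close> is \<open>s\<close> times another self-map, so
  multiplication by \<open>s\<close> contributes a factor \<open>\<kappa> < 1\<close> to the Schwarz-Pick inequality.
\<close>

lemma pseudo_dist_contraction:
  assumes g: "g holomorphic_on ball 0 1" and le: "\<And>z. norm z < 1 \<Longrightarrow> norm (g z) \<le> r" and r: "r < 1"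
  obtains \<kappa> where "0 \<le> \<kappa>" "\<kappa> < 1"
    "\<And>a b. norm a < 1 \<Longrightarrow> norm b < 1 \<Longrightarrow> pseudo_dist (g a) (g b) \<le> \<kappa> * pseudo_dist a b"
proof -
  define s where "s = (1 + r) / 2"
  have "0 \<le> r" using le[of 0] by (smt (verit) norm_ge_zero norm_zero)
  then have s: "0 < s" "r < s" "s < 1" using r by (auto simp: s_def)
  define k where "k z = g z / of_real s" for z
  have gk: "g z = of_real s * k z" for z using s by (simp add: k_def)
  have k1: "norm (k z) < 1" if "norm z < 1" for z
    using le[OF that] s by (simp add: k_def norm_divide divide_less_eq)
  have "k holomorphic_on ball 0 1" unfolding k_def using s by (intro holomorphic_intros g) auto
  have est: "pseudo_dist (g a) (g b) \<le> (2 * s / (1 + s\<^sup>2)) * pseudo_dist a b" if ab: "norm a < 1" "norm b < 1" for a b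
  proof -
    define c where "c = cnj (k a) * k b"
    have "norm (k a) * norm (k b) \<le> 1 * 1"
      using k1[OF ab(1)] k1[OF ab(2)] by (intro mult_mono) auto
    then have nc: "norm c \<le> 1" by (simp add: c_def norm_mult)
    have c1: "1 - c \<noteq> 0" unfolding c_def by (rule one_minus_cnj_mult_nonzero[OF k1[OF ab(1)] k1[OF ab(2)]])
    have sh: "(1 + s\<^sup>2) * norm (1 - c) \<le> 2 * norm (1 - of_real (s\<^sup>2) * c)"
      by (rule shrink_ratio) (use s nc in auto)
    have pos: "0 < (1 + s\<^sup>2) * norm (1 - c)" using c1 by (simp add: add_pos_nonneg)
    have "cnj (g a) * g b = of_real (s\<^sup>2) * c" by (simp add: gk c_def power2_eq_square)
    moreover have "norm (g a - g b) = s * norm (k a - k b)"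
      using s by (simp add: gk norm_mult flip: right_diff_distrib)
    ultimately have "pseudo_dist (g a) (g b) = s * norm (k a - k b) / norm (1 - of_real (s\<^sup>2) * c)"
      by (simp add: pseudo_dist_def)
    also have "\<dots> \<le> s * norm (k a - k b) / ((1 + s\<^sup>2) * norm (1 - c) / 2)"
      by (rule divide_left_mono) (use sh pos s in \<open>auto intro!: mult_pos_pos\<close>)
    also have "\<dots> = (2 * s / (1 + s\<^sup>2)) * pseudo_dist (k a) (k b)"
      by (simp add: pseudo_dist_def c_def)
    also have "\<dots> \<le> (2 * s / (1 + s\<^sup>2)) * pseudo_dist a b"
      using Schwarz_Pick[OF \<open>k holomorphic_on ball 0 1\<close> k1 ab] s by (intro mult_left_mono) auto
    finally show ?thesis .
  qed
  have "0 < (1 - s)\<^sup>2" using s by simp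
  then have "2 * s / (1 + s\<^sup>2) < 1"
    by (simp add: add_pos_nonneg divide_less_eq power2_eq_square algebra_simps)
  then show thesis using that[of "2 * s / (1 + s\<^sup>2)"] est s by simp
qed

text \<open>
  Banach's fixed point theorem for the pseudo-hyperbolic distance, which compares with the
  Euclidean distance by a factor two in the direction needed for summability. The convergence of
  the iterates is recorded because it carries holomorphic dependence on parameters.
\<close>

lemma disc_fixed_point:
  assumes g: "g holomorphic_on ball 0 1" and le: "\<And>z. norm z < 1 \<Longrightarrow> norm (g z) \<le> r" and r: "r < 1"
  obtains x where "norm x < 1" "g x = x" "(\<lambda>k. (g ^^ k) 0) \<longlonglongrightarrow> x"
    "\<And>y. norm y < 1 \<Longrightarrow> g y = y \<Longrightarrow> y = x"
proof -
  obtain \<kappa> where \<kappa>: "0 \<le> \<kappa>" "\<kappa> < 1"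
    and ct: "\<And>a b. norm a < 1 \<Longrightarrow> norm b < 1 \<Longrightarrow> pseudo_dist (g a) (g b) \<le> \<kappa> * pseudo_dist a b"
    using pseudo_dist_contraction[OF g le r] by blast
  have r0: "0 \<le> r" using le[of 0] by (smt (verit) norm_ge_zero norm_zero)
  define x where "x k = (g ^^ k) 0" for k
  have xS: "x (Suc k) = g (x k)" for k by (simp add: x_def)
  have xr: "norm (x k) \<le> r" for k
  proof (induction k)
    case (Suc k) then show ?case using le[of "x k"] r by (simp add: xS)
  qed (simp add: x_def r0)
  then have x1: "norm (x k) < 1" for k using r by (meson le_less_trans)
  have pd: "pseudo_dist (x k) (x (Suc k)) \<le> \<kappa> ^ k" for k
  proof (induction k)
    case 0 show ?case using pseudo_dist_less_1[OF x1 x1, of 0 "Suc 0"] by simp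
  next
    case (Suc k)
    have "pseudo_dist (x (Suc k)) (x (Suc (Suc k))) \<le> \<kappa> * pseudo_dist (x k) (x (Suc k))"
      using ct[OF x1[of k] x1[of "Suc k"]] by (simp add: xS)
    also have "\<dots> \<le> \<kappa> * \<kappa> ^ k" using Suc \<kappa> by (intro mult_left_mono)
    finally show ?case by simp
  qed
  have step: "norm (x (Suc k) - x k) \<le> 2 * \<kappa> ^ k" for k
  proof -
    have nz: "1 - cnj (x k) * x (Suc k) \<noteq> 0" by (rule one_minus_cnj_mult_nonzero[OF x1 x1])
    have "norm (x k) * norm (x (Suc k)) \<le> 1 * 1"
      using x1 by (intro mult_mono) (auto intro: less_imp_le)
    then have "norm (1 - cnj (x k) * x (Suc k)) \<le> 2"
      using norm_triangle_ineq4[of 1 "cnj (x k) * x (Suc k)"] by (simp add: norm_mult)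
    then have "pseudo_dist (x k) (x (Suc k)) * norm (1 - cnj (x k) * x (Suc k)) \<le> \<kappa> ^ k * 2"
      using pd by (intro mult_mono) (auto simp: \<kappa>)
    then show ?thesis using nz by (simp add: pseudo_dist_def norm_minus_commute)
  qed
  have "summable (\<lambda>k. x (Suc k) - x k)"
    by (rule summable_comparison_test'[of "\<lambda>k. 2 * \<kappa> ^ k" 0]) (use step \<kappa> in \<open>auto intro!: summable_mult summable_geometric\<close>)
  then have "(\<lambda>n. \<Sum>k<n. x (Suc k) - x k) \<longlonglongrightarrow> (\<Sum>k. x (Suc k) - x k)" by (rule summable_LIMSEQ)
  then have "(\<lambda>n. x n - x 0) \<longlonglongrightarrow> (\<Sum>k. x (Suc k) - x k)"
    by (simp only: sum_lessThan_telescope)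
  then obtain L where L: "x \<longlonglongrightarrow> L"
    using tendsto_add[OF _ tendsto_const[of "x 0"], of "\<lambda>n. x n - x 0"] by fastforce
  have nL: "norm L < 1"
    using tendsto_upperbound[OF tendsto_norm[OF L], of r] xr r by fastforce
  have "isCont g L"
    using holomorphic_on_imp_continuous_on[OF g] nL by (simp add: continuous_on_eq_continuous_at)
  then have "(\<lambda>k. g (x k)) \<longlonglongrightarrow> g L" using L isCont_tendsto_compose by blast
  moreover have "(\<lambda>k. g (x k)) \<longlonglongrightarrow> L" using LIMSEQ_Suc[OF L] by (simp add: xS)
  ultimately have gL: "g L = L" using LIMSEQ_unique by blast
  have "y = L" if y: "norm y < 1" "g y = y" for y
  proof -
    have "pseudo_dist y L \<le> \<kappa> * pseudo_dist y L" using ct[OF y(1) nL] gL y(2) by simp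
    then have "pseudo_dist y L = 0"
      using \<kappa> pseudo_dist_nonneg[of y L] by (smt (verit) mult_le_cancel_right1)
    then show ?thesis using one_minus_cnj_mult_nonzero[OF y(1) nL] by (simp add: pseudo_dist_def)
  qed
  then show thesis using that[of L] nL gL L unfolding x_def by blast
qed

text \<open>
  The iterates from \<open>0\<close> are bounded holomorphic functions of the parameter \<open>z\<close>, and so is their
  pointwise limit.
\<close>

lemma holomorphic_fixed_point:
  fixes h :: "complex ^ 'n \<Rightarrow> complex \<Rightarrow> complex"
  assumes D: "open D"
    and h: "\<And>z. z \<in> D \<Longrightarrow> h z holomorphic_on ball 0 1"
    and r: "\<And>z. z \<in> D \<Longrightarrow> \<exists>r<1. \<forall>\<zeta>\<in>ball 0 1. norm (h z \<zeta>) \<le> r"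
    and hol: "\<And>g. holomorphic_fun_on g D \<Longrightarrow> g ` D \<subseteq> ball 0 1 \<Longrightarrow> holomorphic_fun_on (\<lambda>z. h z (g z)) D"
  obtains H where "holomorphic_fun_on H D" "H ` D \<subseteq> ball 0 1" "\<And>z. z \<in> D \<Longrightarrow> h z (H z) = H z"
    "\<And>z \<zeta>. z \<in> D \<Longrightarrow> norm \<zeta> < 1 \<Longrightarrow> h z \<zeta> = \<zeta> \<Longrightarrow> \<zeta> = H z"
proof -
  have "\<exists>x. norm x < 1 \<and> h z x = x \<and> (\<lambda>k. (h z ^^ k) 0) \<longlonglongrightarrow> x \<and> (\<forall>y. norm y < 1 \<longrightarrow> h z y = y \<longrightarrow> y = x)"
    if z: "z \<in> D" for z
  proof -
    obtain s where "s < 1" "\<And>\<zeta>. norm \<zeta> < 1 \<Longrightarrow> norm (h z \<zeta>) \<le> s" using r[OF z] by auto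
    then show ?thesis using disc_fixed_point[OF h[OF z], of s] by blast
  qed
  then obtain H where H: "\<And>z. z \<in> D \<Longrightarrow> norm (H z) < 1 \<and> h z (H z) = H z \<and> (\<lambda>k. (h z ^^ k) 0) \<longlonglongrightarrow> H z
      \<and> (\<forall>y. norm y < 1 \<longrightarrow> h z y = y \<longrightarrow> y = H z)" by metis
  define it where "it k z = (h z ^^ k) 0" for k z
  have it: "holomorphic_fun_on (it k) D \<and> it k ` D \<subseteq> ball 0 1" for k
  proof (induction k)
    case 0
    have "holomorphic_fun_on (\<lambda>z :: complex ^ 'n. 0) D"
      by (rule holomorphic_fun_onI) (auto intro!: exI[of _ 0])
    then show ?case by (auto simp: it_def)
  next
    case (Suc k)
    have "norm (h z \<zeta>) < 1" if z: "z \<in> D" "norm \<zeta> < 1" for z \<zeta>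
    proof -
      obtain s where s: "s < 1" "\<forall>\<zeta>\<in>ball 0 1. norm (h z \<zeta>) \<le> s" using r[OF z(1)] by blast
      then have "norm (h z \<zeta>) \<le> s" using z(2) by simp
      then show ?thesis using s(1) by simp
    qed
    then have "it (Suc k) ` D \<subseteq> ball 0 1" using Suc by (auto simp: it_def)
    then show ?case using hol[of "it k"] Suc by (simp add: it_def)
  qed
  have "norm (it k z) \<le> 1" if "z \<in> D" for k z
  proof -
    have "it k z \<in> ball 0 1" using it[of k] that by blast
    then show ?thesis by simp
  qed
  then have "holomorphic_fun_on H D"
    using holomorphic_fun_on_bounded_limit[OF sequentially_bot D, of it 1 H] it H by (simp add: it_def)
  moreover have "H ` D \<subseteq> ball 0 1" using H by auto
  ultimately show thesis using that[of H] H by blast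
qed

section \<open>The left inverse with affine fibres\<close>

text \<open>
  The abbreviation \<open>w\<close> below is the covector field along \<open>f\<close> from which everything is built: the
  gradient of the left inverse at the points of the geodesic.
\<close>

locale geodesic =
  fixes D :: "(complex ^ 'n) set" and f :: "complex \<Rightarrow> complex ^ 'n" and G :: "complex ^ 'n \<Rightarrow> complex"
  assumes D_open: "open D" and D_bounded: "bounded D" and D_convex: "convex D"
    and f_disc: "holomorphic_disc f D" and G_left: "left_inverse D f G"
begin

abbreviation w :: "complex \<Rightarrow> complex ^ 'n" where "w \<zeta> \<equiv> cgrad G (f \<zeta>)"

lemma G_hol: "holomorphic_fun_on G D"
  using G_left by (simp add: left_inverse_def)

lemma G_less: "z \<in> D \<Longrightarrow> norm (G z) < 1"
  using G_left by (auto simp: left_inverse_def)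

lemma G_f: "norm \<zeta> < 1 \<Longrightarrow> G (f \<zeta>) = \<zeta>"
  using G_left by (auto simp: left_inverse_def)

lemma f_hol: "(\<lambda>\<zeta>. f \<zeta> $ i) holomorphic_on ball 0 1"
  using f_disc by (simp add: holomorphic_disc_def)

lemma f_in: "norm \<zeta> < 1 \<Longrightarrow> f \<zeta> \<in> D"
  using f_disc by (auto simp: holomorphic_disc_def)

lemma f_isCont: "norm \<zeta> < 1 \<Longrightarrow> isCont f \<zeta>"
  using holomorphic_on_vec_imp_continuous_on[OF f_hol] by (simp add: continuous_on_eq_continuous_at)

lemma w_hol: "(\<lambda>\<zeta>. w \<zeta> $ j) holomorphic_on ball 0 1"
  by (rule cgrad_along_disc_holomorphic[OF G_hol D_open f_hol]) (use f_in in auto)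

lemma w_isCont: "norm \<zeta> < 1 \<Longrightarrow> isCont w \<zeta>"
  using holomorphic_on_vec_imp_continuous_on[OF w_hol] by (simp add: continuous_on_eq_continuous_at)

lemma G_deriv: "z \<in> D \<Longrightarrow> (G has_derivative (\<lambda>v. v \<odot> cgrad G z)) (at z)"
  by (rule has_derivative_cgrad[OF G_hol D_open])

lemma f_deriv: "norm \<zeta> < 1 \<Longrightarrow> (f has_derivative (\<lambda>h. h *s vec_deriv f \<zeta>)) (at \<zeta>)"
  by (rule has_derivative_vec_deriv[OF f_hol]) auto

lemma left_inverse_deriv:
  assumes K: "left_inverse D f K" and \<zeta>: "norm \<zeta> < 1"
  shows "vec_deriv f \<zeta> \<odot> cgrad K (f \<zeta>) = 1"
proof -
  have "((\<lambda>\<xi>. K (f \<xi>)) has_field_derivative (vec_deriv f \<zeta> \<odot> cgrad K (f \<zeta>))) (at \<zeta>)"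
    by (rule compose_disc_deriv[OF _ D_open f_hol]) (use K \<zeta> f_in in \<open>auto simp: left_inverse_def\<close>)
  then have "((\<lambda>\<xi>. \<xi>) has_field_derivative (vec_deriv f \<zeta> \<odot> cgrad K (f \<zeta>))) (at \<zeta>)"
    by (rule has_field_derivative_transform_within_open[where S = "ball 0 1"])
       (use K \<zeta> in \<open>auto simp: left_inverse_def\<close>)
  then show ?thesis using DERIV_ident DERIV_unique by blast
qed

lemma w_nonzero: "norm \<zeta> < 1 \<Longrightarrow> w \<zeta> \<noteq> 0"
  using left_inverse_deriv[OF G_left] by fastforce

lemma convex_step: "x \<in> D \<Longrightarrow> z \<in> D \<Longrightarrow> 0 \<le> t \<Longrightarrow> t \<le> 1 \<Longrightarrow> x + t *\<^sub>R (z - x) \<in> D"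
  using convexD_alt[OF D_convex, of x z t] by (simp add: algebra_simps)

lemma diameter_bound:
  obtains B where "0 < B" "\<And>x y. x \<in> D \<Longrightarrow> y \<in> D \<Longrightarrow> norm (x - y) \<le> B"
proof -
  obtain b where b: "0 < b" "\<And>x. x \<in> D \<Longrightarrow> norm x \<le> b" using D_bounded bounded_pos by metis
  have "norm (x - y) \<le> 2 * b" if "x \<in> D" "y \<in> D" for x y
    using b(2)[OF that(1)] b(2)[OF that(2)] norm_triangle_ineq4[of x y] by linarith
  then show thesis using that[of "2 * b"] b(1) by simp
qed

text \<open>
  Moving \<open>f \<zeta>\<close> by the fixed proportion \<open>t\<close> towards \<open>z\<close> maps the closure of \<open>D\<close> into a compact
  subset of \<open>D\<close>, on which \<open>norm G\<close> has a maximum below one.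
\<close>

lemma contracted_fixed_point:
  assumes t: "0 < t" "t < 1"
  obtains H where "holomorphic_fun_on H D" "H ` D \<subseteq> ball 0 1"
    "\<And>z. z \<in> D \<Longrightarrow> G (f (H z) + t *\<^sub>R (z - f (H z))) = H z"
    "\<And>\<zeta>. norm \<zeta> < 1 \<Longrightarrow> H (f \<zeta>) = \<zeta>"
proof -
  define h where "h z \<zeta> = G (f \<zeta> + t *\<^sub>R (z - f \<zeta>))" for z \<zeta>
  obtain H where H: "holomorphic_fun_on H D" "H ` D \<subseteq> ball 0 1" "\<And>z. z \<in> D \<Longrightarrow> h z (H z) = H z"
    "\<And>z \<zeta>. z \<in> D \<Longrightarrow> norm \<zeta> < 1 \<Longrightarrow> h z \<zeta> = \<zeta> \<Longrightarrow> \<zeta> = H z"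
  proof (rule holomorphic_fixed_point[OF D_open, of h])
    fix z assume z: "z \<in> D"
    have inD: "f \<zeta> + t *\<^sub>R (z - f \<zeta>) \<in> D" if "norm \<zeta> < 1" for \<zeta>
      using convex_step[OF f_in[OF that] z] t by simp
    show "h z holomorphic_on ball 0 1" unfolding h_def
      by (rule compose_disc_holomorphic[OF G_hol D_open])
         (use inD in \<open>auto intro!: holomorphic_intros f_hol simp: scaleR_conv_of_real\<close>)
    \<comment> \<open>\<open>K\<close> is the image of the closure of \<open>D\<close> under the homothety with centre \<open>z\<close> and ratio
      \<open>1 - t\<close>.\<close>
    define K where "K = (\<lambda>x. x - t *\<^sub>R (x - z)) ` closure D"
    have "compact K" unfolding K_def
      using D_bounded by (intro compact_continuous_image continuous_intros) (simp add: compact_closure)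
    moreover have KD: "K \<subseteq> D"
      using mem_interior_closure_convex_shrink[OF D_convex, of z _ t] z D_open t
      by (auto simp: K_def interior_open)
    moreover have "K \<noteq> {}" using z by (auto simp: K_def)
    moreover have "continuous_on K (\<lambda>x. norm (G x))"
      using holomorphic_fun_on_imp_continuous_on[OF G_hol] KD
      by (intro continuous_on_norm) (rule continuous_on_subset)
    ultimately obtain m where m: "m \<in> K" "\<And>x. x \<in> K \<Longrightarrow> norm (G x) \<le> norm (G m)"
      using continuous_attains_sup by metis
    have "norm (h z \<zeta>) \<le> norm (G m)" if "norm \<zeta> < 1" for \<zeta>
    proof -
      have "f \<zeta> + t *\<^sub>R (z - f \<zeta>) = f \<zeta> - t *\<^sub>R (f \<zeta> - z)" by (simp add: algebra_simps)
      then have "f \<zeta> + t *\<^sub>R (z - f \<zeta>) \<in> K"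
        using f_in[OF that] closure_subset unfolding K_def by blast
      then show ?thesis using m(2) by (simp add: h_def)
    qed
    then show "\<exists>r<1. \<forall>\<zeta>\<in>ball 0 1. norm (h z \<zeta>) \<le> r"
      using G_less[of m] m(1) KD by (intro exI[of _ "norm (G m)"]) auto
  next
    fix g assume g: "holomorphic_fun_on g D" "g ` D \<subseteq> ball 0 1"
    show "holomorphic_fun_on (\<lambda>z. h z (g z)) D"
    proof (rule holomorphic_fun_on_clinearI)
      fix z assume z: "z \<in> D"
      have gz: "norm (g z) < 1" using g z by auto
      have "((\<lambda>z. f (g z)) has_derivative (\<lambda>v. (v \<odot> cgrad g z) *s vec_deriv f (g z))) (at z)"
        using has_derivative_compose[OF has_derivative_cgrad[OF g(1) D_open z] f_deriv[OF gz]] by simp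
      then have 1: "((\<lambda>z. f (g z) + t *\<^sub>R (z - f (g z))) has_derivative
          (\<lambda>v. (v \<odot> cgrad g z) *s vec_deriv f (g z) + t *\<^sub>R (v - (v \<odot> cgrad g z) *s vec_deriv f (g z)))) (at z)"
        by (intro derivative_intros)
      have 2: "(G has_derivative (\<lambda>v. v \<odot> cgrad G (f (g z) + t *\<^sub>R (z - f (g z))))) (at (f (g z) + t *\<^sub>R (z - f (g z))))"
        by (rule G_deriv) (use convex_step[OF f_in[OF gz] z] t in simp)
      show "\<exists>L. ((\<lambda>z. h z (g z)) has_derivative L) (at z) \<and> (\<forall>c v. L (c *s v) = c * L v)"
        unfolding h_def
        by (rule exI, rule conjI, rule has_derivative_compose[OF 1 2])
           (unfold scalar_product_left_simps, simp add: scaleR_conv_of_real algebra_simps)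
    qed
  qed blast
  show thesis
  proof (rule that[OF H(1,2)])
    show "G (f (H z) + t *\<^sub>R (z - f (H z))) = H z" if "z \<in> D" for z
      using H(3)[OF that] by (simp add: h_def)
    show "H (f \<zeta>) = \<zeta>" if "norm \<zeta> < 1" for \<zeta>
      using H(4)[OF f_in[OF that] that] that by (simp add: h_def G_f)
  qed
qed

text \<open>
  The fixed point equation \<open>G (f \<zeta> + t (z - f \<zeta>)) = \<zeta> = G (f \<zeta>)\<close> says that the increment of \<open>G\<close>
  vanishes; by Taylor's formula \<open>t\<close> times the bilinear product is of order \<open>t\<^sup>2\<close>, and dividing
  by \<open>t\<close> gives the zero in the limit.
\<close>

lemma section_exists:
  obtains H where "left_inverse D f H" "\<And>z. z \<in> D \<Longrightarrow> (z - f (H z)) \<odot> w (H z) = 0"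
proof -
  \<comment> \<open>The shift by two keeps the parameters strictly between zero and one.\<close>
  define t where "t n = 1 / real (n + 2)" for n :: nat
  have t: "0 < t n" "t n < 1" for n by (auto simp: t_def)
  have "\<forall>n. \<exists>H. holomorphic_fun_on H D \<and> H ` D \<subseteq> ball 0 1 \<and>
    (\<forall>z\<in>D. G (f (H z) + t n *\<^sub>R (z - f (H z))) = H z) \<and> (\<forall>\<zeta>. norm \<zeta> < 1 \<longrightarrow> H (f \<zeta>) = \<zeta>)"
  proof
    fix n
    obtain H where "holomorphic_fun_on H D" "H ` D \<subseteq> ball 0 1"
      "\<And>z. z \<in> D \<Longrightarrow> G (f (H z) + t n *\<^sub>R (z - f (H z))) = H z" "\<And>\<zeta>. norm \<zeta> < 1 \<Longrightarrow> H (f \<zeta>) = \<zeta>"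
      using contracted_fixed_point[OF t[of n]] by blast
    then show "\<exists>H. holomorphic_fun_on H D \<and> H ` D \<subseteq> ball 0 1 \<and>
      (\<forall>z\<in>D. G (f (H z) + t n *\<^sub>R (z - f (H z))) = H z) \<and> (\<forall>\<zeta>. norm \<zeta> < 1 \<longrightarrow> H (f \<zeta>) = \<zeta>)"
      by blast
  qed
  then obtain K where K: "\<And>n. holomorphic_fun_on (K n) D" "\<And>n z. z \<in> D \<Longrightarrow> norm (K n z) < 1"
    "\<And>n z. z \<in> D \<Longrightarrow> G (f (K n z) + t n *\<^sub>R (z - f (K n z))) = K n z" "\<And>n \<zeta>. norm \<zeta> < 1 \<Longrightarrow> K n (f \<zeta>) = \<zeta>"
    by (simp only: choice_iff image_subset_iff mem_ball dist_0_norm) blast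
  have K_le: "\<And>n z. z \<in> D \<Longrightarrow> norm (K n z) \<le> 1" by (rule less_imp_le) (rule K(2))
  obtain F H where F: "F \<le> sequentially" "F \<noteq> bot" and H: "\<And>z. z \<in> D \<Longrightarrow> ((\<lambda>n. K n z) \<longlongrightarrow> H z) F"
    and Hhol: "holomorphic_fun_on H D" and H_le: "\<And>z. z \<in> D \<Longrightarrow> norm (H z) \<le> 1"
    by (rule bounded_sequence_cluster[OF D_open, where h = K and B = 1]) (use K(1) K_le in blast)+
  have tF: "(t \<longlongrightarrow> 0) F"
  proof (rule tendsto_mono[OF F(1)])
    show "t \<longlonglongrightarrow> 0" unfolding t_def using LIMSEQ_ignore_initial_segment[OF lim_1_over_n, of 2] by simp
  qed
  have Hf: "H (f \<zeta>) = \<zeta>" if "norm \<zeta> < 1" for \<zeta>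
    using H[OF f_in[OF that]] F(2) by (simp add: K(4)[OF that] tendsto_const_iff)
  \<comment> \<open>The limit has values in the closed disc; since it maps \<open>f 0\<close> to \<open>0\<close>, the maximum principle
    excludes the circle.\<close>
  have H1: "norm (H z) < 1" if "z \<in> D" for z
    using holomorphic_fun_strict_max[OF Hhol D_open D_convex, of 1 "f 0"] H_le that f_in[of 0] Hf[of 0] by simp
  obtain B where B: "0 < B" "\<And>x y. x \<in> D \<Longrightarrow> y \<in> D \<Longrightarrow> norm (x - y) \<le> B"
    using diameter_bound by blast
  have "(z - f (H z)) \<odot> w (H z) = 0" if z: "z \<in> D" for z
  proof -
    define \<zeta> where "\<zeta> = H z"
    have \<zeta>: "norm \<zeta> < 1" using H1[OF z] by (simp add: \<zeta>_def)
    obtain R where R: "0 < R" "ball (f \<zeta>) R \<subseteq> D"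
      using f_in[OF \<zeta>] D_open open_contains_ball by blast
    define r where "r = R / 2"
    have r: "0 < r" using R by (simp add: r_def)
    have sub: "ball x r \<subseteq> D" if "dist x (f \<zeta>) < r" for x
    proof
      fix y assume "y \<in> ball x r"
      then have "dist (f \<zeta>) y < R" using that dist_triangle[of "f \<zeta>" y x] by (simp add: r_def dist_commute)
      then show "y \<in> D" using R(2) by auto
    qed
    have Kz: "((\<lambda>n. K n z) \<longlongrightarrow> \<zeta>) F" using H[OF z] by (simp add: \<zeta>_def)
    have fK: "((\<lambda>n. f (K n z)) \<longlongrightarrow> f \<zeta>) F"
      by (rule isCont_tendsto_compose[OF f_isCont[OF \<zeta>] Kz])
    have wK: "((\<lambda>n. w (K n z)) \<longlongrightarrow> w \<zeta>) F"
      by (rule isCont_tendsto_compose[OF w_isCont[OF \<zeta>] Kz])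
    have ev1: "eventually (\<lambda>n. dist (f (K n z)) (f \<zeta>) < r) F" using tendstoD[OF fK r] .
    have ev2: "eventually (\<lambda>n. t n < r / 2 / B) F"
      using order_tendstoD(2)[OF tF] r B(1) by simp
    have bd: "eventually (\<lambda>n. norm ((z - f (K n z)) \<odot> w (K n z)) \<le> 32 / r\<^sup>2 * B\<^sup>2 * t n) F"
      using ev1 ev2
    proof eventually_elim
      case (elim n)
      define x where "x = f (K n z)"
      have x: "x \<in> D" using f_in K(2)[OF z] by (simp add: x_def)
      have nv: "norm (t n *\<^sub>R (z - x)) \<le> t n * B" using B(2)[OF z x] t[of n] by simp
      also have "\<dots> \<le> r / 2" using elim(2) B(1) by (simp add: field_simps)
      finally have nv': "norm (t n *\<^sub>R (z - x)) \<le> r / 2" .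
      have sx: "ball x r \<subseteq> D" using sub[of x] elim(1) by (simp add: x_def)
      have "norm (G y) \<le> 1" if "y \<in> ball x r" for y
        using G_less[of y] sx that by (meson less_imp_le subsetD)
      then have "norm (G (x + t n *\<^sub>R (z - x)) - G x - (t n *\<^sub>R (z - x)) \<odot> cgrad G x)
          \<le> 32 * 1 / r\<^sup>2 * (norm (t n *\<^sub>R (z - x)))\<^sup>2"
        by (rule cauchy_remainder[OF holomorphic_fun_on_subset[OF G_hol sx] r _ nv'])
      moreover have "G (x + t n *\<^sub>R (z - x)) - G x = 0"
        using K(3)[OF z, of n] G_f K(2)[OF z] by (simp add: x_def)
      ultimately have "t n * norm ((z - x) \<odot> w (K n z)) \<le> 32 / r\<^sup>2 * (norm (t n *\<^sub>R (z - x)))\<^sup>2"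
        using t[of n] by (simp add: scalar_product_scaleR_left x_def)
      also have "\<dots> \<le> 32 / r\<^sup>2 * (t n * B)\<^sup>2"
        using nv by (intro mult_left_mono power_mono) auto
      finally have "t n * norm ((z - x) \<odot> w (K n z)) \<le> t n * (32 / r\<^sup>2 * B\<^sup>2 * t n)"
        by (simp add: power2_eq_square algebra_simps)
      then have "norm ((z - x) \<odot> w (K n z)) \<le> 32 / r\<^sup>2 * B\<^sup>2 * t n"
        by (rule mult_left_le_imp_le) (use t in auto)
      then show ?case by (simp add: x_def)
    qed
    have "((\<lambda>n. (z - f (K n z)) \<odot> w (K n z)) \<longlongrightarrow> 0) F"
      by (rule Lim_null_comparison[OF bd]) (use tF r in \<open>auto intro!: tendsto_eq_intros\<close>)
    moreover have "((\<lambda>n. (z - f (K n z)) \<odot> w (K n z)) \<longlongrightarrow> (z - f \<zeta>) \<odot> w \<zeta>) F"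
      unfolding scalar_product_def by (intro tendsto_intros fK wK)
    ultimately show ?thesis using tendsto_unique[OF F(2)] by (simp add: \<zeta>_def)
  qed
  moreover have "left_inverse D f H" using Hhol H1 Hf by (auto simp: left_inverse_def)
  ultimately show thesis using that by blast
qed

text \<open>
  On the line \<open>s \<mapsto> f \<zeta> + s (z - f \<zeta>)\<close> the zero equation for \<open>g s = H (...)\<close> reads
  \<open>A (g s) + s * B (g s) = 0\<close>, where \<open>A\<close> and \<open>B\<close> both vanish at \<open>\<zeta>\<close> and \<open>A\<close> has derivative \<open>- 1\<close>
  there. Near \<open>s = 0\<close> the common factor \<open>g s - \<zeta>\<close> must therefore vanish, and then it vanishes on
  the whole connected slice, in particular at \<open>s = 1\<close>.
\<close>

lemma zero_unique:
  assumes H: "left_inverse D f H" and H0: "\<And>z. z \<in> D \<Longrightarrow> (z - f (H z)) \<odot> w (H z) = 0"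
    and z: "z \<in> D" and \<zeta>: "norm \<zeta> < 1" and zero: "(z - f \<zeta>) \<odot> w \<zeta> = 0"
  shows "H z = \<zeta>"
proof -
  define V where "V = {s. f \<zeta> + s *s (z - f \<zeta>) \<in> D}"
  have V: "open V" "connected V" unfolding V_def by (rule line_convex_slice[OF D_open D_convex])+
  have V01: "0 \<in> V" "1 \<in> V" using z f_in[OF \<zeta>] by (auto simp: V_def)
  define g where "g s = H (f \<zeta> + s *s (z - f \<zeta>))" for s
  have Hhol: "holomorphic_fun_on H D" and H1: "\<And>z. z \<in> D \<Longrightarrow> norm (H z) < 1"
    and Hf: "\<And>\<zeta>. norm \<zeta> < 1 \<Longrightarrow> H (f \<zeta>) = \<zeta>" using H by (auto simp: left_inverse_def)
  have g: "g holomorphic_on V" unfolding g_def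
    by (rule holomorphic_fun_on_line(1)[OF Hhol D_open V(1)]) (simp add: V_def)
  have g0: "g 0 = \<zeta>" using Hf[OF \<zeta>] by (simp add: g_def)
  define A where "A \<xi> = (f \<zeta> - f \<xi>) \<odot> w \<xi>" for \<xi>
  define B where "B \<xi> = (z - f \<zeta>) \<odot> w \<xi>" for \<xi>
  have "A holomorphic_on ball 0 1" "B holomorphic_on ball 0 1"
    unfolding A_def B_def scalar_product_def vector_minus_component
    by (intro holomorphic_intros f_hol w_hol)+
  then have dB: "(B has_field_derivative deriv B \<zeta>) (at \<zeta>)"
    using \<zeta> by (auto intro: holomorphic_derivI)
  have dA: "(A has_field_derivative - 1) (at \<zeta>)"
  proof -
    have fi: "((\<lambda>\<xi>. f \<xi> $ i) has_field_derivative vec_deriv f \<zeta> $ i) (at \<zeta>)" for i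
      using holomorphic_derivI[OF f_hol[of i], of \<zeta>] \<zeta> by (simp add: vec_deriv_def)
    have wi: "((\<lambda>\<xi>. w \<xi> $ i) has_field_derivative deriv (\<lambda>\<xi>. w \<xi> $ i) \<zeta>) (at \<zeta>)" for i
      using holomorphic_derivI[OF w_hol[of i], of \<zeta>] \<zeta> by simp
    have "((\<lambda>\<xi>. (f \<zeta> $ i - f \<xi> $ i) * w \<xi> $ i) has_field_derivative - (vec_deriv f \<zeta> $ i * w \<zeta> $ i)) (at \<zeta>)" for i
      by (rule DERIV_cong, (rule fi wi derivative_intros)+) simp
    then have "(A has_field_derivative (\<Sum>i\<in>UNIV. - (vec_deriv f \<zeta> $ i * w \<zeta> $ i))) (at \<zeta>)"
      unfolding A_def scalar_product_def vector_minus_component by (intro DERIV_sum)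
    moreover have "(\<Sum>i\<in>UNIV. - (vec_deriv f \<zeta> $ i * w \<zeta> $ i)) = - (vec_deriv f \<zeta> \<odot> w \<zeta>)"
      by (simp add: scalar_product_def sum_negf)
    ultimately show ?thesis using left_inverse_deriv[OF G_left \<zeta>] by simp
  qed
  obtain A1 where A1: "\<And>\<xi>. A \<xi> - A \<zeta> = A1 \<xi> * (\<xi> - \<zeta>)" "isCont A1 \<zeta>" "A1 \<zeta> = - 1"
    using dA unfolding CARAT_DERIV by blast
  obtain B1 where B1: "\<And>\<xi>. B \<xi> - B \<zeta> = B1 \<xi> * (\<xi> - \<zeta>)" "isCont B1 \<zeta>"
    using dB unfolding CARAT_DERIV by blast
  have AB: "A \<zeta> = 0" "B \<zeta> = 0" using zero by (auto simp: A_def B_def)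
  have gc: "(g \<longlongrightarrow> \<zeta>) (at 0)"
    using holomorphic_on_imp_continuous_on[OF g] V(1) V01(1) g0
    by (metis continuous_on_eq_continuous_at isCont_def)
  have "((\<lambda>s. A1 (g s) + s * B1 (g s)) \<longlongrightarrow> A1 \<zeta> + 0 * B1 \<zeta>) (at 0)"
    by (intro tendsto_intros isCont_tendsto_compose[OF A1(2) gc] isCont_tendsto_compose[OF B1(2) gc])
  then have "eventually (\<lambda>s. A1 (g s) + s * B1 (g s) \<noteq> 0) (at 0)"
    by (rule tendsto_imp_eventually_ne) (simp add: A1(3))
  moreover have "eventually (\<lambda>s. s \<in> V) (at 0)" using V(1) V01(1) by (rule eventually_at_in_open')
  ultimately have "eventually (\<lambda>s. g s = \<zeta>) (at 0)"
  proof eventually_elim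
    case (elim s)
    have "f \<zeta> + s *s (z - f \<zeta>) \<in> D" using elim by (simp add: V_def)
    from H0[OF this] have "(f \<zeta> + s *s (z - f \<zeta>) - f (g s)) \<odot> w (g s) = 0" by (simp only: g_def)
    then have "A (g s) + s * B (g s) = 0"
      by (simp add: A_def B_def scalar_product_left_simps algebra_simps)
    moreover have "A (g s) = A1 (g s) * (g s - \<zeta>)" "B (g s) = B1 (g s) * (g s - \<zeta>)"
      using A1(1)[of "g s"] B1(1)[of "g s"] AB by simp_all
    ultimately have "(A1 (g s) + s * B1 (g s)) * (g s - \<zeta>) = 0"
      by (simp only: distrib_right mult.assoc)
    then show ?case using elim(1) by simp
  qed
  then obtain e where e: "0 < e" "\<And>s. dist s 0 < e \<Longrightarrow> g s = \<zeta>"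
    unfolding eventually_at using g0 by (metis UNIV_I)
  have "g 1 - \<zeta> = 0"
  proof (rule analytic_continuation_open[of "ball 0 e \<inter> V" V "\<lambda>s. g s - \<zeta>" "\<lambda>_. 0"])
    have "0 \<in> ball 0 e \<inter> V" using e(1) V01(1) by simp
    then show "ball 0 e \<inter> V \<noteq> {}" by blast
  qed (use V V01 g e in \<open>auto intro!: holomorphic_intros simp: dist_commute\<close>)
  then show ?thesis by (simp add: g_def)
qed

abbreviation H :: "complex ^ 'n \<Rightarrow> complex" where "H \<equiv> lempert_fun_of f G"

lemma H_unique:
  assumes z: "z \<in> D"
  shows "\<exists>!\<zeta>. \<zeta> \<in> unit_disc \<and> (z - f \<zeta>) \<odot> w \<zeta> = 0"
proof -
  obtain K where K: "left_inverse D f K" "\<And>z. z \<in> D \<Longrightarrow> (z - f (K z)) \<odot> w (K z) = 0"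
    using section_exists by blast
  have "K z \<in> unit_disc" using K(1) z by (auto simp: left_inverse_def)
  moreover have "\<zeta> = K z" if "\<zeta> \<in> unit_disc" "(z - f \<zeta>) \<odot> w \<zeta> = 0" for \<zeta>
    using zero_unique[OF K z _ that(2)] that(1) by simp
  ultimately show ?thesis using K(2)[OF z] by blast
qed

lemma H_in: "z \<in> D \<Longrightarrow> norm (H z) < 1"
  and H_zero: "z \<in> D \<Longrightarrow> (z - f (H z)) \<odot> w (H z) = 0"
  using theI'[OF H_unique] by (auto simp: lempert_fun_of_def)

lemma H_eqI: "z \<in> D \<Longrightarrow> norm \<zeta> < 1 \<Longrightarrow> (z - f \<zeta>) \<odot> w \<zeta> = 0 \<Longrightarrow> H z = \<zeta>"
  using the1_equality[OF H_unique] by (auto simp: lempert_fun_of_def)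

lemma H_left_inverse: "left_inverse D f H"
proof -
  obtain K where K: "left_inverse D f K" "\<And>z. z \<in> D \<Longrightarrow> (z - f (K z)) \<odot> w (K z) = 0"
    using section_exists by blast
  have "H z = K z" if "z \<in> D" for z
    using K(1) that by (intro H_eqI K(2)) (auto simp: left_inverse_def)
  then show ?thesis
    using K(1) holomorphic_fun_on_cong[of K D H] f_in by (auto simp: left_inverse_def)
qed

lemma H_lempert: "lempert_left_inverse D f H"
  unfolding lempert_left_inverse_def
proof (intro conjI ballI H_left_inverse)
  fix \<zeta> :: complex assume \<zeta>: "\<zeta> \<in> unit_disc"
  define P where "P = {z. w \<zeta> \<odot> z = w \<zeta> \<odot> f \<zeta>}"
  have "complex_hyperplane P"
    using w_nonzero \<zeta> unfolding complex_hyperplane_def P_def by auto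
  moreover have "{z \<in> D. H z = \<zeta>} = D \<inter> P"
    using H_zero H_eqI \<zeta>
    by (auto simp: P_def scalar_product_commute[of "w _"] scalar_product_diff_left)
  ultimately show "\<exists>P. complex_hyperplane P \<and> {z \<in> D. H z = \<zeta>} = D \<inter> P" by blast
qed

lemma small_step_in: 
  assumes "x \<in> D"
  obtains e where "0 < e" "\<And>s. norm s < e \<Longrightarrow> x + s *s (v :: complex ^ 'n) \<in> D"
proof -
  have "open {s. x + s *s v \<in> D}" by (rule line_convex_slice[OF D_open D_convex])
  moreover have "0 \<in> {s. x + s *s v \<in> D}" using assms by simp
  ultimately obtain e where "0 < e" "ball 0 e \<subseteq> {s. x + s *s v \<in> D}"
    using open_contains_ball by blast
  then have "x + s *s v \<in> D" if "norm s < e" for s using that by (auto simp: subset_iff)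
  then show thesis using \<open>0 < e\<close> \<open>\<And>e. 0 < e \<Longrightarrow> (\<And>s. norm s < e \<Longrightarrow> x + s *s v \<in> D) \<Longrightarrow> thesis\<close> by blast
qed

lemma deriv_zero_if_const_on_line:
  assumes K: "holomorphic_fun_on K D" and x: "x \<in> D" and c: "\<And>s. x + s *s v \<in> D \<Longrightarrow> K (x + s *s v) = K x"
  shows "v \<odot> cgrad K x = 0"
proof -
  obtain e where e: "0 < e" "\<And>s. norm s < e \<Longrightarrow> x + s *s v \<in> D" using small_step_in[OF x] by blast
  have "((\<lambda>s. K (x + s *s v)) has_field_derivative (v \<odot> cgrad K (x + 0 *s v))) (at 0)"
    by (rule holomorphic_fun_on_line(2)[OF K D_open, of "ball 0 e"]) (use e in auto)
  then have "((\<lambda>s. K x) has_field_derivative (v \<odot> cgrad K x)) (at 0)"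
    using has_field_derivative_transform_within_open[of _ _ 0 "ball 0 e" "\<lambda>s. K x"] e c by auto
  then show ?thesis using DERIV_const DERIV_unique by blast
qed

text \<open>
  A covector is determined by a hyperplane in its kernel and its value at one vector off it.
\<close>

lemma covector_eqI:
  assumes ker: "\<And>v. v \<odot> w1 = 0 \<Longrightarrow> v \<odot> w2 = 0" and e: "e \<odot> w1 = 1" "e \<odot> w2 = 1"
  shows "w2 = (w1 :: complex ^ 'n)"
proof -
  have "v \<odot> w2 = v \<odot> w1" for v
    using ker[of "v - (v \<odot> w1) *s e"] by (simp add: scalar_product_left_simps e)
  then have "axis j 1 \<odot> w2 = axis j 1 \<odot> w1" for j by simp
  then show ?thesis
    by (simp add: scalar_product_def axis_def if_distrib[where f = "\<lambda>x. x * _"] vec_eq_iff cong: if_cong)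
qed

lemma cgrad_H:
  assumes \<zeta>: "norm \<zeta> < 1"
  shows "cgrad H (f \<zeta>) = w \<zeta>"
proof (rule covector_eqI[where e = "vec_deriv f \<zeta>"])
  show "vec_deriv f \<zeta> \<odot> cgrad H (f \<zeta>) = 1" by (rule left_inverse_deriv[OF H_left_inverse \<zeta>])
  show "vec_deriv f \<zeta> \<odot> w \<zeta> = 1" by (rule left_inverse_deriv[OF G_left \<zeta>])
  fix v assume v: "v \<odot> w \<zeta> = 0"
  show "v \<odot> cgrad H (f \<zeta>) = 0"
  proof (rule deriv_zero_if_const_on_line[OF _ f_in[OF \<zeta>]])
    show "holomorphic_fun_on H D" using H_left_inverse by (simp add: left_inverse_def)
    fix s assume "f \<zeta> + s *s v \<in> D"
    then have "H (f \<zeta> + s *s v) = \<zeta>" using v \<zeta> by (intro H_eqI) (auto simp: scalar_product_left_simps)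
    then show "H (f \<zeta> + s *s v) = H (f \<zeta>)" using H_left_inverse \<zeta> by (auto simp: left_inverse_def)
  qed
qed

text \<open>
  If \<open>z\<close> and \<open>f (G z)\<close> lie in one fibre and the fibre is a hyperplane section, then \<open>G\<close> is
  constant on the complex line through them, so its derivative in that direction vanishes; this
  is the equation that defines \<open>H z\<close>.
\<close>

lemma lempert_eq_H:
  assumes L: "lempert_left_inverse D f G" and z: "z \<in> D"
  shows "H z = G z"
proof (rule H_eqI[OF z G_less[OF z]])
  define \<zeta> where "\<zeta> = G z"
  have \<zeta>: "norm \<zeta> < 1" using G_less[OF z] by (simp add: \<zeta>_def)
  then obtain P where P: "complex_hyperplane P" "{z \<in> D. G z = \<zeta>} = D \<inter> P"
    using L unfolding lempert_left_inverse_def by (metis dist_0_norm mem_ball)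
  then obtain a b where ab: "P = {z. a \<odot> z = b}" by (auto simp: complex_hyperplane_def)
  have "f \<zeta> \<in> D \<inter> P" "z \<in> D \<inter> P" using P(2) z f_in[OF \<zeta>] G_f[OF \<zeta>] \<zeta>_def by blast+
  then have *: "a \<odot> f \<zeta> = b" "a \<odot> z = b" by (auto simp: ab)
  have "(z - f \<zeta>) \<odot> cgrad G (f \<zeta>) = 0"
  proof (rule deriv_zero_if_const_on_line[OF G_hol f_in[OF \<zeta>]])
    fix s assume s: "f \<zeta> + s *s (z - f \<zeta>) \<in> D"
    have "a \<odot> (f \<zeta> + s *s (z - f \<zeta>)) = b"
      using * by (simp add: scalar_product_commute[of a] scalar_product_left_simps)
    then have "f \<zeta> + s *s (z - f \<zeta>) \<in> D \<inter> P" using s by (simp add: ab)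
    then have "f \<zeta> + s *s (z - f \<zeta>) \<in> {z \<in> D. G z = \<zeta>}" by (simp only: P(2))
    then show "G (f \<zeta> + s *s (z - f \<zeta>)) = G (f \<zeta>)" by (simp add: G_f[OF \<zeta>])
  qed
  then show "(z - f (G z)) \<odot> w (G z) = 0" by (simp add: \<zeta>_def)
qed

end

section \<open>Functions from a gap in the moment problem\<close>

lemma scalar_product_scaleR_right: "(a :: complex ^ 'n) \<odot> (t *\<^sub>R w) = t *\<^sub>R (a \<odot> w)"
  by (simp add: scalar_product_def scaleR_sum_right)

lemma scalar_product_cmult_right: "(a :: complex ^ 'n) \<odot> (c *s w) = c * (a \<odot> w)"
  by (simp add: scalar_product_def sum_distrib_left mult_ac)

lemma bounded_bilinear_scalar_product:
  "bounded_bilinear (\<lambda>(a :: complex ^ 'n) w. a \<odot> w)"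
  by (standard)
     (auto simp: scalar_product_add_left scalar_product_add_right scalar_product_scaleR_left
       scalar_product_scaleR_right intro!: exI[of _ 1] norm_scalar_product_le)

text \<open>
  If \<open>S\<^sub>z \<zeta> = z \<odot> w \<zeta> - \<kappa> \<zeta>\<close> points strictly into the disc on the circle, then \<open>\<zeta> \<mapsto> \<zeta> + \<tau> S\<^sub>z \<zeta>\<close>
  maps the closed disc strictly into itself for small \<open>\<tau>\<close>, and its fixed point is the zero of
  \<open>S\<^sub>z\<close>.
\<close>

lemma zero_of_inward_family:
  fixes w :: "complex \<Rightarrow> complex ^ 'n"
  assumes D: "open D" "bounded D"
    and w: "\<And>i. (\<lambda>\<zeta>. w \<zeta> $ i) holomorphic_on UNIV" and \<kappa>: "\<kappa> holomorphic_on UNIV" and c: "0 < c"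
    and inward: "\<And>z \<zeta>. z \<in> D \<Longrightarrow> norm \<zeta> = 1 \<Longrightarrow> Re (cnj \<zeta> * (z \<odot> w \<zeta> - \<kappa> \<zeta>)) \<le> - c"
  obtains G where "holomorphic_fun_on G D" "G ` D \<subseteq> ball 0 1"
    "\<And>z \<zeta>. z \<in> D \<Longrightarrow> norm \<zeta> < 1 \<Longrightarrow> z \<odot> w \<zeta> = \<kappa> \<zeta> \<Longrightarrow> G z = \<zeta>"
proof -
  have wc: "continuous_on UNIV w" by (rule holomorphic_on_vec_imp_continuous_on[OF w])
  have \<kappa>c: "continuous_on UNIV \<kappa>" by (rule holomorphic_on_imp_continuous_on[OF \<kappa>])
  obtain B where B: "0 < B" "\<And>z. z \<in> D \<Longrightarrow> norm z \<le> B" using D(2) bounded_pos by metis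
  have "compact (w ` sphere 0 1)" "compact (\<kappa> ` sphere 0 1)"
    by (auto intro!: compact_continuous_image continuous_on_subset[OF wc] continuous_on_subset[OF \<kappa>c])
  then obtain W K where W: "0 < W" "\<And>\<zeta>. norm \<zeta> = 1 \<Longrightarrow> norm (w \<zeta>) \<le> W"
    and K: "0 < K" "\<And>\<zeta>. norm \<zeta> = 1 \<Longrightarrow> norm (\<kappa> \<zeta>) \<le> K"
    using compact_imp_bounded bounded_pos by (metis imageI mem_sphere_0)
  define M where "M = B * W + K"
  have M: "norm (z \<odot> w \<zeta> - \<kappa> \<zeta>) \<le> M" if "z \<in> D" "norm \<zeta> = 1" for z \<zeta>
  proof -
    have "norm (z \<odot> w \<zeta>) \<le> B * W"
      by (rule order_trans[OF norm_scalar_product_le]) (use B W that in \<open>auto intro!: mult_mono\<close>)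
    then show ?thesis using K(2)[OF that(2)] norm_triangle_ineq4[of "z \<odot> w \<zeta>" "\<kappa> \<zeta>"]
      by (simp add: M_def)
  qed
  \<comment> \<open>On the circle \<open>norm (\<zeta> + \<tau> S)^2 \<le> 1 - 2 \<tau> c + \<tau>\<^sup>2 M\<^sup>2\<close>; this \<open>\<tau>\<close> makes the last term at
    most \<open>\<tau> c\<close>.\<close>
  define \<tau> where "\<tau> = c / (M\<^sup>2 + 1)"
  have M1: "0 < M\<^sup>2 + 1" by (rule add_nonneg_pos) auto
  have \<tau>: "0 < \<tau>" "\<tau> * M\<^sup>2 \<le> c"
    using c M1 by (auto simp: \<tau>_def divide_le_eq algebra_simps)
  define h where "h z \<zeta> = \<zeta> + of_real \<tau> * (z \<odot> w \<zeta> - \<kappa> \<zeta>)" for z \<zeta>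
  have h_hol: "h z holomorphic_on UNIV" for z
    unfolding h_def scalar_product_def by (intro holomorphic_intros w \<kappa>)
  have circle: "norm (h z \<zeta>) \<le> sqrt (1 - \<tau> * c)" if z: "z \<in> D" "norm \<zeta> = 1" for z \<zeta>
  proof (rule real_le_rsqrt)
    define S where "S = z \<odot> w \<zeta> - \<kappa> \<zeta>"
    have "(norm (h z \<zeta>))\<^sup>2 = (norm \<zeta>)\<^sup>2 + 2 * \<tau> * Re (cnj \<zeta> * S) + \<tau>\<^sup>2 * (norm S)\<^sup>2"
      unfolding h_def S_def[symmetric] cmod_power2 by (simp add: power2_eq_square algebra_simps)
    also have "\<dots> \<le> 1 + 2 * \<tau> * (- c) + \<tau>\<^sup>2 * M\<^sup>2"
      using inward[OF z] M[OF z] z(2) \<tau>(1)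
      by (intro add_mono mult_left_mono power_mono) (auto simp: S_def)
    also have "\<tau>\<^sup>2 * M\<^sup>2 \<le> \<tau> * c"
      using mult_left_mono[OF \<tau>(2), of \<tau>] \<tau>(1) by (simp add: power2_eq_square)
    finally show "(norm (h z \<zeta>))\<^sup>2 \<le> 1 - \<tau> * c" by simp
  qed
  obtain H where H: "holomorphic_fun_on H D" "H ` D \<subseteq> ball 0 1" "\<And>z. z \<in> D \<Longrightarrow> h z (H z) = H z"
    "\<And>z \<zeta>. z \<in> D \<Longrightarrow> norm \<zeta> < 1 \<Longrightarrow> h z \<zeta> = \<zeta> \<Longrightarrow> \<zeta> = H z"
  proof (rule holomorphic_fixed_point[OF D(1), of h])
    fix z assume z: "z \<in> D"
    show "h z holomorphic_on ball 0 1" using h_hol holomorphic_on_subset by blast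
    have "norm (h z \<zeta>) \<le> sqrt (1 - \<tau> * c)" if "\<zeta> \<in> ball 0 1" for \<zeta>
    proof (rule maximum_modulus_frontier[where S = "ball 0 1" and f = "h z"])
      show "h z holomorphic_on interior (ball 0 1)" using h_hol holomorphic_on_subset by blast
      show "continuous_on (closure (ball 0 1)) (h z)"
        using h_hol holomorphic_on_imp_continuous_on continuous_on_subset by blast
      show "norm (h z \<xi>) \<le> sqrt (1 - \<tau> * c)" if "\<xi> \<in> frontier (ball 0 1)" for \<xi>
        using circle[OF z, of \<xi>] that by simp
    qed (use that in auto)
    then show "\<exists>r<1. \<forall>\<zeta>\<in>ball 0 1. norm (h z \<zeta>) \<le> r"
      using \<tau>(1) c by (intro exI[of _ "sqrt (1 - \<tau> * c)"]) auto
  next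
    fix g assume g: "holomorphic_fun_on g D" "g ` D \<subseteq> ball 0 1"
    show "holomorphic_fun_on (\<lambda>z. h z (g z)) D"
    proof (rule holomorphic_fun_on_clinearI)
      fix z assume z: "z \<in> D"
      have dg: "(g has_derivative (\<lambda>v. v \<odot> cgrad g z)) (at z)" by (rule has_derivative_cgrad[OF g(1) D(1) z])
      have dw: "((\<lambda>z. w (g z)) has_derivative (\<lambda>v. (v \<odot> cgrad g z) *s vec_deriv w (g z))) (at z)"
        using has_derivative_compose[OF dg has_derivative_vec_deriv[OF w open_UNIV]] by simp
      have "(\<kappa> has_derivative (\<lambda>u. deriv \<kappa> (g z) * u)) (at (g z))"
        using holomorphic_derivI[OF \<kappa> open_UNIV] by (simp add: has_field_derivative_def)
      from has_derivative_compose[OF dg this]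
      have d\<kappa>: "((\<lambda>z. \<kappa> (g z)) has_derivative (\<lambda>v. deriv \<kappa> (g z) * (v \<odot> cgrad g z))) (at z)" .
      note dd = bounded_bilinear.FDERIV[OF bounded_bilinear_scalar_product has_derivative_ident dw]
      show "\<exists>L. ((\<lambda>z. h z (g z)) has_derivative L) (at z) \<and> (\<forall>c v. L (c *s v) = c * L v)"
        unfolding h_def
        by (rule exI, rule conjI, rule has_derivative_add[OF dg has_derivative_mult_right[OF has_derivative_diff[OF dd d\<kappa>]]])
           (simp add: scalar_product_left_simps scalar_product_cmult_right algebra_simps)
    qed
  qed blast
  show thesis
  proof (rule that[OF H(1,2)])
    show "H z = \<zeta>" if "z \<in> D" "norm \<zeta> < 1" "z \<odot> w \<zeta> = \<kappa> \<zeta>" for z \<zeta>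
      using H(4)[OF that(1,2)] that(3) by (simp add: h_def)
  qed
qed

text \<open>
  A quantitative separation of a point \<open>B\<close> from a cone \<open>\<C>\<close> of finite sequences. The residual \<open>r\<close>
  of a near-minimizer of the distance to \<open>B\<close> is almost a separating functional: adding a
  generator \<open>e \<in> \<E>\<close> or rescaling the near-minimizer cannot decrease the distance appreciably. A
  near-minimizer takes the place of a nearest point because the cone of moments need not be
  closed.
\<close>

lemma cone_near_projection:
  fixes \<C> :: "(nat \<Rightarrow> 'e :: real_inner) set" and B :: "nat \<Rightarrow> 'e"
  assumes ne: "\<C> \<noteq> {}"
    and add: "\<And>A e \<tau>. A \<in> \<C> \<Longrightarrow> e \<in> \<E> \<Longrightarrow> 0 \<le> \<tau> \<Longrightarrow> (\<lambda>k. A k + \<tau> *\<^sub>R e k) \<in> \<C>"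
    and scale: "\<And>A s. A \<in> \<C> \<Longrightarrow> 0 \<le> s \<Longrightarrow> (\<lambda>k. s *\<^sub>R A k) \<in> \<C>"
    and M: "\<And>e. e \<in> \<E> \<Longrightarrow> (\<Sum>k\<le>N. (norm (e k))\<^sup>2) \<le> M" "0 \<le> M"
    and gap: "\<And>A. A \<in> \<C> \<Longrightarrow> Q0 \<le> (\<Sum>k\<le>N. (norm (A k - B k))\<^sup>2)" and \<delta>: "0 < \<delta>"
  obtains r where "\<And>e. e \<in> \<E> \<Longrightarrow> - \<delta> \<le> (\<Sum>k\<le>N. r k \<bullet> e k)" "(\<Sum>k\<le>N. r k \<bullet> B k) \<le> - Q0 + \<delta>"
proof -
  define Q where "Q A = (\<Sum>k\<le>N. (norm (A k - B k))\<^sup>2)" for A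
  define q where "q = Inf (Q ` \<C>)"
  have bdd: "bdd_below (Q ` \<C>)" by (intro bdd_belowI2[of _ 0]) (simp add: Q_def sum_nonneg)
  have qle: "q \<le> Q A" if "A \<in> \<C>" for A unfolding q_def using bdd that by (intro cInf_lower) auto
  have Q0q: "Q0 \<le> q" unfolding q_def using ne gap by (intro cInf_greatest) (auto simp: Q_def)
  define S where "S = 1 + M + 2 * (q + 1) + 2 * (\<Sum>k\<le>N. (norm (B k))\<^sup>2)"
  have q0: "0 \<le> q" unfolding q_def using ne by (intro cInf_greatest) (auto simp: Q_def sum_nonneg)
  then have S: "1 \<le> S" "1 + M \<le> S" "1 + 2 * (q + 1) + 2 * (\<Sum>k\<le>N. (norm (B k))\<^sup>2) \<le> S"
    using M(2) by (auto simp: S_def sum_nonneg)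
  \<comment> \<open>The distance squared is within \<open>\<epsilon>\<^sup>2\<close> of its infimum and competitors at step size \<open>\<epsilon>\<close> are
    compared; every term quadratic in the step is controlled by \<open>S\<close>.\<close>
  define \<epsilon> where "\<epsilon> = min 1 (\<delta> / S)"
  have \<epsilon>: "0 < \<epsilon>" "\<epsilon> \<le> 1" "\<epsilon> * S \<le> \<delta>" using \<delta> S(1) by (auto simp: \<epsilon>_def min_def field_simps)
  have "q < q + \<epsilon>\<^sup>2" using \<epsilon> by simp
  then obtain A where A: "A \<in> \<C>" "Q A < q + \<epsilon>\<^sup>2"
    using cInf_lessD[of "Q ` \<C>" "q + \<epsilon>\<^sup>2"] ne unfolding q_def by auto
  define r where "r k = A k - B k" for k
  have expand: "Q (\<lambda>k. A k + \<tau> *\<^sub>R e k) = Q A + 2 * \<tau> * (\<Sum>k\<le>N. r k \<bullet> e k) + \<tau>\<^sup>2 * (\<Sum>k\<le>N. (norm (e k))\<^sup>2)" for \<tau> e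
  proof -
    have "(norm (A k + \<tau> *\<^sub>R e k - B k))\<^sup>2 = (norm (A k - B k))\<^sup>2 + 2 * \<tau> * (r k \<bullet> e k) + \<tau>\<^sup>2 * (norm (e k))\<^sup>2" for k
    proof -
      have "A k + \<tau> *\<^sub>R e k - B k = r k + \<tau> *\<^sub>R e k" by (simp add: r_def)
      then show ?thesis
        unfolding power2_norm_eq_inner r_def[symmetric]
        by (simp add: inner_add_left inner_add_right inner_commute power2_eq_square algebra_simps)
    qed
    then show ?thesis by (simp add: Q_def sum.distrib sum_distrib_left)
  qed
  have half: "- \<delta> \<le> X" if "- (\<epsilon>\<^sup>2 * S) \<le> 2 * \<epsilon> * X" for X
  proof -
    have "\<epsilon>\<^sup>2 * S \<le> \<epsilon> * \<delta>"
      using mult_left_mono[OF \<epsilon>(3), of \<epsilon>] \<epsilon>(1) by (simp add: power2_eq_square mult.assoc)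
    moreover have "0 \<le> \<epsilon> * \<delta>" using \<epsilon> \<delta> by simp
    ultimately have "\<epsilon> * (- \<delta>) \<le> \<epsilon> * X" using that by linarith
    then show ?thesis using \<epsilon>(1) by (rule mult_left_le_imp_le)
  qed
  show thesis
  proof (rule that[of r])
    fix e assume e: "e \<in> \<E>"
    have "q \<le> Q A + 2 * \<epsilon> * (\<Sum>k\<le>N. r k \<bullet> e k) + \<epsilon>\<^sup>2 * (\<Sum>k\<le>N. (norm (e k))\<^sup>2)"
      using qle[OF add[OF A(1) e, of \<epsilon>]] \<epsilon>(1) expand by simp
    moreover have "\<epsilon>\<^sup>2 * (\<Sum>k\<le>N. (norm (e k))\<^sup>2) \<le> \<epsilon>\<^sup>2 * M" using M(1)[OF e] by (intro mult_left_mono) auto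
    moreover have "\<epsilon>\<^sup>2 * (1 + M) \<le> \<epsilon>\<^sup>2 * S" using S(2) by (intro mult_left_mono) auto
    ultimately have "- (\<epsilon>\<^sup>2 * S) \<le> 2 * \<epsilon> * (\<Sum>k\<le>N. r k \<bullet> e k)" using A(2) by (simp add: algebra_simps)
    from half[OF this] show "- \<delta> \<le> (\<Sum>k\<le>N. r k \<bullet> e k)" .
  next
    have norm_A: "(\<Sum>k\<le>N. (norm (A k))\<^sup>2) \<le> 2 * Q A + 2 * (\<Sum>k\<le>N. (norm (B k))\<^sup>2)"
    proof -
      have "(norm (A k))\<^sup>2 \<le> 2 * (norm (A k - B k))\<^sup>2 + 2 * (norm (B k))\<^sup>2" for k
      proof -
        have "(norm (A k))\<^sup>2 \<le> (norm (A k - B k) + norm (B k))\<^sup>2"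
          by (intro power_mono) (auto simp: norm_triangle_sub add.commute)
        also have "\<dots> \<le> 2 * (norm (A k - B k))\<^sup>2 + 2 * (norm (B k))\<^sup>2"
          using sum_squares_bound[of "norm (A k - B k)" "norm (B k)"] by (simp add: power2_sum)
        finally show ?thesis .
      qed
      then show ?thesis unfolding Q_def sum_distrib_left sum.distrib[symmetric] by (intro sum_mono)
    qed
    have "\<epsilon>\<^sup>2 \<le> 1" using \<epsilon> by (simp add: power_le_one)
    then have nA: "1 + (\<Sum>k\<le>N. (norm (A k))\<^sup>2) \<le> S" using norm_A A(2) S(3) by simp
    have "(\<lambda>k. A k + (- \<epsilon>) *\<^sub>R A k) = (\<lambda>k. (1 - \<epsilon>) *\<^sub>R A k)" by (simp add: algebra_simps)
    then have "q \<le> Q (\<lambda>k. A k + (- \<epsilon>) *\<^sub>R A k)" using qle[OF scale[OF A(1), of "1 - \<epsilon>"]] \<epsilon> by simp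
    then have "q \<le> Q A + 2 * \<epsilon> * (- (\<Sum>k\<le>N. r k \<bullet> A k)) + \<epsilon>\<^sup>2 * (\<Sum>k\<le>N. (norm (A k))\<^sup>2)"
      using expand[of "- \<epsilon>" A] by simp
    moreover have "\<epsilon>\<^sup>2 * (1 + (\<Sum>k\<le>N. (norm (A k))\<^sup>2)) \<le> \<epsilon>\<^sup>2 * S" using nA by (intro mult_left_mono) auto
    ultimately have "- (\<epsilon>\<^sup>2 * S) \<le> 2 * \<epsilon> * (- (\<Sum>k\<le>N. r k \<bullet> A k))" using A(2) by (simp add: algebra_simps)
    from half[OF this] have rA: "(\<Sum>k\<le>N. r k \<bullet> A k) \<le> \<delta>" by simp
    have "(\<Sum>k\<le>N. r k \<bullet> B k) = (\<Sum>k\<le>N. r k \<bullet> A k) - Q A"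
      unfolding Q_def sum_subtractf[symmetric]
      by (rule sum.cong) (auto simp: r_def power2_norm_eq_inner inner_diff_right inner_diff_left inner_commute)
    then show "(\<Sum>k\<le>N. r k \<bullet> B k) \<le> - Q0 + \<delta>" using rA qle[OF A(1)] Q0q by simp
  qed
qed

text \<open>
  The moment sequence of the unit mass at the point \<open>(\<zeta>, z)\<close> of the product of the circle and
  \<open>D\<close>. The factor \<open>cnj \<zeta>\<close> makes the pairing with polynomials \<open>w\<close>, \<open>\<kappa>\<close> equal to
  \<open>Re (cnj \<zeta> (z \<odot> w \<zeta> - \<kappa> \<zeta>))\<close>, the inward component of a vector field on the circle; the scalar
  second component accompanies the vector moments as those of the constant function one.
\<close>

definition moment_atom :: "complex \<Rightarrow> complex ^ 'n \<Rightarrow> nat \<Rightarrow> (complex ^ 'n) \<times> complex" where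
  "moment_atom \<zeta> z k = ((cnj \<zeta> * \<zeta> ^ k) *s z, cnj \<zeta> * \<zeta> ^ k)"

definition moments :: "nat \<Rightarrow> (nat \<Rightarrow> real) \<Rightarrow> (nat \<Rightarrow> complex) \<Rightarrow> (nat \<Rightarrow> complex ^ 'n) \<Rightarrow> nat \<Rightarrow> (complex ^ 'n) \<times> complex" where
  "moments n c \<zeta> z k = (\<Sum>i<n. c i *\<^sub>R moment_atom (\<zeta> i) (z i) k)"

text \<open>
  A positive measure on the product of the circle and \<open>D\<close> with finitely many atoms, presented by
  weights and positions.
\<close>

definition circle_measure :: "(complex ^ 'n) set \<Rightarrow> nat \<Rightarrow> (nat \<Rightarrow> real) \<Rightarrow> (nat \<Rightarrow> complex) \<Rightarrow> (nat \<Rightarrow> complex ^ 'n) \<Rightarrow> bool" where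
  "circle_measure D n c \<zeta> z \<longleftrightarrow> (\<forall>i<n. 0 \<le> c i \<and> norm (\<zeta> i) = 1 \<and> z i \<in> D)"

text \<open>
  The moments of \<open>R\<close> times harmonic measure at \<open>R\<close>, carried by the graph of a disc \<open>\<phi>\<close> with
  \<open>\<phi> 0 = q\<close> and \<open>\<phi> R = x\<close>: for \<open>k > 0\<close> the function \<open>\<zeta> ^ (k - 1) * \<phi> \<zeta>\<close> is holomorphic with
  value \<open>R ^ (k - 1) *s x\<close> at \<open>R\<close>; for \<open>k = 0\<close> the harmonic extension of \<open>cnj \<zeta> *s \<phi> \<zeta>\<close> is
  \<open>(1 / \<zeta>) *s (\<phi> \<zeta> - q) + cnj \<zeta> *s q\<close>.
\<close>

definition moment_target :: "complex ^ 'n \<Rightarrow> complex ^ 'n \<Rightarrow> real \<Rightarrow> nat \<Rightarrow> (complex ^ 'n) \<times> complex" where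
  "moment_target q x R k = (of_real (R ^ k) *s x - of_real (if k = 0 then 1 - R\<^sup>2 else 0) *s q,
      of_real (R ^ k) - of_real (if k = 0 then 1 - R\<^sup>2 else 0))"

lemma sum_delta_0: "(\<Sum>k\<le>(N::nat). (if k = 0 then a else 0) * g k) = a * (g 0 :: complex)"
  by (subst sum.cong[OF refl, of _ _ "\<lambda>k. if k = 0 then a * g 0 else 0"]) auto

text \<open>
  The residual of a near-best approximation provides polynomials \<open>w\<close> and \<open>\<kappa>\<close> such that
  \<open>S\<^sub>z \<zeta> = z \<odot> w \<zeta> - \<kappa> \<zeta>\<close> is almost inward on the circle, while \<open>S\<^sub>x R - (1 - R\<^sup>2) S\<^sub>q 0\<close> has a
  definite positive real part. Changing \<open>\<kappa>\<close> so that \<open>S\<^sub>q\<close> vanishes at \<open>0\<close> and \<open>S\<^sub>x\<close> at \<open>R\<close> turns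
  this positive amount into strict inwardness.
\<close>

lemma function_from_gap:
  fixes D :: "(complex ^ 'n) set"
  assumes D: "open D" "bounded D" and q: "q \<in> D" and x: "x \<in> D" and R: "0 < R" "R < 1" and Q0: "0 < Q0"
    and gap: "\<And>n c \<zeta> z. circle_measure D n c \<zeta> z \<Longrightarrow>
      Q0 \<le> (\<Sum>k\<le>N. (norm (moments n c \<zeta> z k - moment_target q x R k))\<^sup>2)"
  obtains G where "holomorphic_fun_on G D" "G ` D \<subseteq> ball 0 1" "G q = 0" "G x = of_real R"
proof -
  define \<C> where "\<C> = {moments n c \<zeta> z | n c \<zeta> z. circle_measure D n c \<zeta> z}"
  define \<E> where "\<E> = {moment_atom \<zeta> z | \<zeta> z. norm \<zeta> = 1 \<and> z \<in> D}"
  define \<delta> where "\<delta> = Q0 / 4"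
  obtain b where b: "0 < b" "\<And>z. z \<in> D \<Longrightarrow> norm z \<le> b" using D(2) bounded_pos by metis
  obtain r where r: "\<And>e. e \<in> \<E> \<Longrightarrow> - \<delta> \<le> (\<Sum>k\<le>N. r k \<bullet> e k)"
    "(\<Sum>k\<le>N. r k \<bullet> moment_target q x R k) \<le> - Q0 + \<delta>"
  proof (rule cone_near_projection[of \<C> \<E> N "of_nat (Suc N) * (b + 1)\<^sup>2" Q0 "moment_target q x R" \<delta>])
    have "circle_measure D 0 (\<lambda>_. 0) (\<lambda>_. 0) (\<lambda>_. 0)" by (simp add: circle_measure_def)
    then show "\<C> \<noteq> {}" unfolding \<C>_def by blast
    show "(\<lambda>k. A k + \<tau> *\<^sub>R e k) \<in> \<C>" if A: "A \<in> \<C>" and e: "e \<in> \<E>" and \<tau>: "0 \<le> \<tau>" for A e \<tau>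
    proof -
      obtain n c \<zeta> z where A': "A = moments n c \<zeta> z" "circle_measure D n c \<zeta> z" using A by (auto simp: \<C>_def)
      obtain \<xi> y where e': "e = moment_atom \<xi> y" "norm \<xi> = 1" "y \<in> D" using e by (auto simp: \<E>_def)
      have "circle_measure D (Suc n) (c(n := \<tau>)) (\<zeta>(n := \<xi>)) (z(n := y))"
        using A' e' \<tau> by (auto simp: circle_measure_def less_Suc_eq)
      moreover have "(\<lambda>k. A k + \<tau> *\<^sub>R e k) = moments (Suc n) (c(n := \<tau>)) (\<zeta>(n := \<xi>)) (z(n := y))"
        by (simp add: fun_eq_iff moments_def A' e')
      ultimately show ?thesis unfolding \<C>_def by blast
    qed
    show "(\<lambda>k. s *\<^sub>R A k) \<in> \<C>" if A: "A \<in> \<C>" and s: "0 \<le> s" for A s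
    proof -
      obtain n c \<zeta> z where A': "A = moments n c \<zeta> z" "circle_measure D n c \<zeta> z" using A by (auto simp: \<C>_def)
      have "circle_measure D n (\<lambda>i. s * c i) \<zeta> z" using A' s by (auto simp: circle_measure_def)
      moreover have "(\<lambda>k. s *\<^sub>R A k) = moments n (\<lambda>i. s * c i) \<zeta> z"
        by (simp add: fun_eq_iff moments_def A' scaleR_sum_right)
      ultimately show ?thesis unfolding \<C>_def by blast
    qed
    show "(\<Sum>k\<le>N. (norm (e k))\<^sup>2) \<le> of_nat (Suc N) * (b + 1)\<^sup>2" if e: "e \<in> \<E>" for e
    proof -
      obtain \<xi> y where e': "e = moment_atom \<xi> y" "norm \<xi> = 1" "y \<in> D" using e by (auto simp: \<E>_def)
      have "norm (e k) \<le> b + 1" for k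
        using norm_Pair_le[of "(cnj \<xi> * \<xi> ^ k) *s y" "cnj \<xi> * \<xi> ^ k"] b(2)[OF e'(3)] e'(2)
        by (simp add: e'(1) moment_atom_def norm_cmult_vec norm_mult norm_power)
      then have "(\<Sum>k\<le>N. (norm (e k))\<^sup>2) \<le> (\<Sum>k\<le>N. (b + 1)\<^sup>2)" by (intro sum_mono power_mono) auto
      then show ?thesis by simp
    qed
    show "\<And>A. A \<in> \<C> \<Longrightarrow> Q0 \<le> (\<Sum>k\<le>N. (norm (A k - moment_target q x R k))\<^sup>2)"
      using gap by (auto simp: \<C>_def)
  qed (use Q0 in \<open>auto simp: \<delta>_def\<close>)
  define w where "w \<zeta> = (\<chi> i. - (\<Sum>k\<le>N. \<zeta> ^ k * cnj (fst (r k) $ i)))" for \<zeta>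
  define \<kappa> where "\<kappa> \<zeta> = (\<Sum>k\<le>N. \<zeta> ^ k * cnj (snd (r k)))" for \<zeta>
  have zw: "z \<odot> w \<zeta> = - (\<Sum>k\<le>N. \<zeta> ^ k * (z \<odot> cnj_vec (fst (r k))))" for z \<zeta>
    by (simp add: w_def scalar_product_def cnj_vec_def sum_distrib_left sum_negf mult_ac)
       (rule sum.swap)
  have inner_r: "r k \<bullet> (v, s) = Re (v \<odot> cnj_vec (fst (r k)) + s * cnj (snd (r k)))" for k v s
    using inner_cnj_vec[of "cnj_vec (fst (r k))" v]
    by (cases "r k") (simp add: inner_complex_def)
  have pairing: "(\<Sum>k\<le>N. r k \<bullet> moment_atom \<zeta> z k) = - Re (cnj \<zeta> * (z \<odot> w \<zeta> - \<kappa> \<zeta>))" for \<zeta> z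
    unfolding moment_atom_def inner_r zw \<kappa>_def Re_sum[symmetric]
    by (simp add: scalar_product_cmult_left sum.distrib sum_distrib_left algebra_simps)
  have target: "(\<Sum>k\<le>N. r k \<bullet> moment_target q x R k)
      = - Re ((x \<odot> w (of_real R) - \<kappa> (of_real R)) - of_real (1 - R\<^sup>2) * (q \<odot> w 0 - \<kappa> 0))"
  proof -
    define g where "g k = q \<odot> cnj_vec (fst (r k)) + cnj (snd (r k))" for k
    have q0: "q \<odot> w 0 - \<kappa> 0 = - g 0"
      unfolding zw \<kappa>_def g_def power_0_left by (simp add: sum_delta_0)
    have "(\<Sum>k\<le>N. r k \<bullet> moment_target q x R k)
       = Re (\<Sum>k\<le>N. of_real R ^ k * (x \<odot> cnj_vec (fst (r k))) + of_real R ^ k * cnj (snd (r k))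
            - (if k = 0 then of_real (1 - R\<^sup>2) else 0) * g k)"
      unfolding moment_target_def inner_r Re_sum
      by (intro sum.cong refl arg_cong[of _ _ Re]) (simp add: g_def scalar_product_left_simps algebra_simps)
    also have "\<dots> = Re (- (x \<odot> w (of_real R)) + \<kappa> (of_real R) - of_real (1 - R\<^sup>2) * g 0)"
      unfolding sum_subtractf sum.distrib sum_delta_0 zw \<kappa>_def by simp
    finally show ?thesis unfolding q0 by simp
  qed
  \<comment> \<open>The correction \<open>a - cnj a * \<zeta>\<^sup>2\<close> removes the value \<open>a\<close> of \<open>S\<^sub>q\<close> at \<open>0\<close> and is tangential on
    the circle, since \<open>cnj \<zeta> * a - cnj a * \<zeta>\<close> is imaginary there. The coefficient \<open>\<beta>\<close> is chosen
    to make \<open>S\<^sub>x\<close> vanish at \<open>R\<close>; its real part is the gain in inwardness.\<close>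
  define a where "a = q \<odot> w 0 - \<kappa> 0"
  define \<beta> where "\<beta> = (x \<odot> w (of_real R) - \<kappa> (of_real R) - a + cnj a * of_real (R\<^sup>2)) / of_real R"
  define \<kappa>' where "\<kappa>' \<zeta> = \<kappa> \<zeta> + a - cnj a * \<zeta>\<^sup>2 + \<beta> * \<zeta>" for \<zeta>
  have "of_real R * \<beta> = x \<odot> w (of_real R) - \<kappa> (of_real R) - a + cnj a * of_real (R\<^sup>2)"
    using R by (simp add: \<beta>_def)
  then have "Re (of_real R * \<beta>) = Re (x \<odot> w (of_real R) - \<kappa> (of_real R) - a + cnj a * of_real (R\<^sup>2))"
    by (rule arg_cong)
  then have "R * Re \<beta> = Re (x \<odot> w (of_real R) - \<kappa> (of_real R) - of_real (1 - R\<^sup>2) * a)"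
    by (simp add: algebra_simps)
  then have R\<beta>: "R * Re \<beta> \<ge> 3 * \<delta>" using r(2) unfolding target a_def \<delta>_def by simp
  have "0 < R * Re \<beta>" using R\<beta> Q0 by (simp add: \<delta>_def)
  then have "0 < Re \<beta>" using R(1) by (simp add: zero_less_mult_iff)
  then have "R * Re \<beta> \<le> 1 * Re \<beta>" using R by (intro mult_right_mono) auto
  then have Re\<beta>: "3 * \<delta> \<le> Re \<beta>" using R\<beta> by simp
  obtain G where G: "holomorphic_fun_on G D" "G ` D \<subseteq> ball 0 1"
    "\<And>z \<zeta>. z \<in> D \<Longrightarrow> norm \<zeta> < 1 \<Longrightarrow> z \<odot> w \<zeta> = \<kappa>' \<zeta> \<Longrightarrow> G z = \<zeta>"
  proof (rule zero_of_inward_family[OF D, of w \<kappa>' \<delta>])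
    show "(\<lambda>\<zeta>. w \<zeta> $ i) holomorphic_on UNIV" for i
      unfolding w_def vec_lambda_beta by (intro holomorphic_intros)
    show "\<kappa>' holomorphic_on UNIV" unfolding \<kappa>'_def \<kappa>_def by (intro holomorphic_intros)
    show "0 < \<delta>" using Q0 by (simp add: \<delta>_def)
    fix z and \<zeta> :: complex assume z: "z \<in> D" and \<zeta>: "norm \<zeta> = 1"
    have \<zeta>1: "cnj \<zeta> * \<zeta> = 1" using \<zeta> by (simp add: complex_norm_square[symmetric] mult.commute)
    have "cnj \<zeta> * (z \<odot> w \<zeta> - \<kappa>' \<zeta>)
        = cnj \<zeta> * (z \<odot> w \<zeta> - \<kappa> \<zeta>) - cnj \<zeta> * a + cnj a * (cnj \<zeta> * \<zeta>) * \<zeta> - \<beta> * (cnj \<zeta> * \<zeta>)"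
      by (simp add: \<kappa>'_def power2_eq_square algebra_simps)
    also have "Re \<dots> = Re (cnj \<zeta> * (z \<odot> w \<zeta> - \<kappa> \<zeta>)) - Re \<beta>"
      unfolding \<zeta>1 by simp
    finally have "Re (cnj \<zeta> * (z \<odot> w \<zeta> - \<kappa>' \<zeta>)) = Re (cnj \<zeta> * (z \<odot> w \<zeta> - \<kappa> \<zeta>)) - Re \<beta>" .
    moreover have "Re (cnj \<zeta> * (z \<odot> w \<zeta> - \<kappa> \<zeta>)) \<le> \<delta>"
      using r(1)[of "moment_atom \<zeta> z"] pairing[of \<zeta> z] z \<zeta> by (force simp: \<E>_def)
    ultimately show "Re (cnj \<zeta> * (z \<odot> w \<zeta> - \<kappa>' \<zeta>)) \<le> - \<delta>" using Re\<beta> Q0 by (simp add: \<delta>_def)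
  qed blast
  have "G q = 0" by (rule G(3)[OF q]) (auto simp: \<kappa>'_def a_def)
  moreover have "G x = of_real R"
    by (rule G(3)[OF x]) (use R in \<open>auto simp: \<kappa>'_def \<beta>_def power2_eq_square\<close>)
  ultimately show thesis using that G by blast
qed

section \<open>Discs from near-solutions of the moment problem\<close>

lemma unit_cnj_mult: "norm (\<zeta> :: complex) = 1 \<Longrightarrow> cnj \<zeta> * \<zeta> = 1"
  using complex_norm_square[of \<zeta>] by (simp add: mult.commute)

text \<open>
  One coordinate \<open>y\<close> of the atoms of a measure whose moments up to \<open>N\<close> are \<open>\<epsilon>\<close>-close to the
  target. The constant coordinate one is the case \<open>x = q = 1\<close>.
\<close>

locale near_poisson =
  fixes n :: nat and c :: "nat \<Rightarrow> real" and \<zeta> y :: "nat \<Rightarrow> complex"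
    and R Y \<epsilon> :: real and x q :: complex and N :: nat
  assumes c: "\<And>i. i < n \<Longrightarrow> 0 \<le> c i" and \<zeta>: "\<And>i. i < n \<Longrightarrow> norm (\<zeta> i) = 1"
    and y: "\<And>i. i < n \<Longrightarrow> norm (y i) \<le> Y" and Y: "0 \<le> Y"
    and mass: "(\<Sum>i<n. c i) \<le> 2" and R: "0 < R" "R < 1" and \<epsilon>: "0 \<le> \<epsilon>" and N: "2 \<le> N"
    and mom: "\<And>k. k \<le> N \<Longrightarrow> norm ((\<Sum>i<n. of_real (c i) * (cnj (\<zeta> i) * \<zeta> i ^ k) * y i)
       - (of_real (R ^ k) * x - of_real (if k = 0 then 1 - R\<^sup>2 else 0) * q)) \<le> \<epsilon>"
begin

definition m :: "nat \<Rightarrow> complex" where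
  "m k = (\<Sum>i<n. of_real (c i) * (cnj (\<zeta> i) * \<zeta> i ^ k) * y i)"

text \<open>
  Harmonic measure at \<open>R\<close> has density \<open>(1 - R\<^sup>2) / norm (\<zeta> - R) ^ 2\<close>, so these weights imitate a
  multiple, of total mass \<open>R * (1 - R\<^sup>2)\<close>, of normalized arc length.
\<close>

definition p :: "nat \<Rightarrow> real" where "p i = c i * (norm (\<zeta> i - of_real R))\<^sup>2"

lemma p_nonneg: "i < n \<Longrightarrow> 0 \<le> p i"
  using c by (simp add: p_def)

lemma p_le: "i < n \<Longrightarrow> p i \<le> 4 * c i"
proof -
  assume i: "i < n"
  have "norm (\<zeta> i - of_real R) \<le> 2"
    using norm_triangle_ineq4[of "\<zeta> i" "of_real R"] \<zeta>[OF i] R by simp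
  then have "(norm (\<zeta> i - of_real R))\<^sup>2 \<le> 2\<^sup>2" by (intro power_mono) auto
  then show ?thesis using mult_left_mono[OF _ c[OF i]] by (simp add: p_def mult.commute[of 4])
qed

lemma p_sum: "(\<Sum>i<n. p i) \<le> 8"
proof -
  have "(\<Sum>i<n. p i) \<le> (\<Sum>i<n. 4 * c i)" by (intro sum_mono) (use p_le in auto)
  then show ?thesis using mass by (simp flip: sum_distrib_left)
qed

lemma p_cnj: "i < n \<Longrightarrow> of_real (p i) = of_real (c i) * (cnj (\<zeta> i) - of_real R) * (\<zeta> i - of_real R)"
  unfolding p_def of_real_mult complex_norm_square by (simp add: mult_ac)

text \<open>
  On the circle \<open>norm (\<zeta> - R) ^ 2 = 1 + R\<^sup>2 - R \<zeta> - R cnj \<zeta>\<close>, so moments of \<open>p\<close> are combinations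
  of three consecutive moments of \<open>c\<close>.
\<close>

lemma p_power: "i < n \<Longrightarrow> of_real (p i) * \<zeta> i ^ k = of_real (1 + R\<^sup>2) * (of_real (c i) * (cnj (\<zeta> i) * \<zeta> i ^ Suc k))
    - of_real R * (of_real (c i) * (cnj (\<zeta> i) * \<zeta> i ^ Suc (Suc k))) - of_real R * (of_real (c i) * (cnj (\<zeta> i) * \<zeta> i ^ k))"
proof -
  assume i: "i < n"
  have u: "cnj (\<zeta> i) * \<zeta> i = 1" by (rule unit_cnj_mult[OF \<zeta>[OF i]])
  have "of_real (p i) * \<zeta> i ^ k = of_real (c i) * \<zeta> i ^ k * ((cnj (\<zeta> i) * \<zeta> i) + of_real (R\<^sup>2) - of_real R * \<zeta> i - of_real R * cnj (\<zeta> i))"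
    unfolding p_cnj[OF i] by (simp add: power2_eq_square algebra_simps)
  also have "\<dots> = of_real (c i) * \<zeta> i ^ k * (of_real (1 + R\<^sup>2) * (cnj (\<zeta> i) * \<zeta> i) - of_real R * \<zeta> i * (cnj (\<zeta> i) * \<zeta> i) - of_real R * cnj (\<zeta> i))"
    unfolding u by simp
  finally show ?thesis by (simp add: algebra_simps)
qed

lemma p_moment: "(\<Sum>i<n. of_real (p i) * \<zeta> i ^ k * y i)
    = of_real (1 + R\<^sup>2) * m (Suc k) - of_real R * m (Suc (Suc k)) - of_real R * m k"
proof -
  have "(\<Sum>i<n. of_real (p i) * \<zeta> i ^ k * y i) = (\<Sum>i<n. of_real (1 + R\<^sup>2) * (of_real (c i) * (cnj (\<zeta> i) * \<zeta> i ^ Suc k) * y i)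
    - of_real R * (of_real (c i) * (cnj (\<zeta> i) * \<zeta> i ^ Suc (Suc k)) * y i) - of_real R * (of_real (c i) * (cnj (\<zeta> i) * \<zeta> i ^ k) * y i))"
    by (intro sum.cong refl) (simp only: p_power lessThan_iff left_diff_distrib mult.assoc)
  then show ?thesis by (simp only: m_def sum_subtractf sum_distrib_left)
qed

lemma combo_bound:
  fixes a a' b b' d d' :: complex
  assumes "norm (a - a') \<le> \<epsilon>" "norm (b - b') \<le> \<epsilon>" "norm (d - d') \<le> \<epsilon>"
  shows "norm ((of_real (1 + R\<^sup>2) * a - of_real R * b - of_real R * d)
     - (of_real (1 + R\<^sup>2) * a' - of_real R * b' - of_real R * d')) \<le> 4 * \<epsilon>"
proof -
  have "(of_real (1 + R\<^sup>2) * a - of_real R * b - of_real R * d)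
     - (of_real (1 + R\<^sup>2) * a' - of_real R * b' - of_real R * d')
     = of_real (1 + R\<^sup>2) * (a - a') - of_real R * (b - b') - of_real R * (d - d')"
    by (simp add: algebra_simps)
  also have "norm \<dots> \<le> norm (of_real (1 + R\<^sup>2) * (a - a')) + norm (of_real R * (b - b')) + norm (of_real R * (d - d'))"
    by norm
  also have "\<dots> = (1 + R\<^sup>2) * norm (a - a') + R * norm (b - b') + R * norm (d - d')"
    using R abs_of_pos[of "1 + R\<^sup>2"] by (simp only: norm_mult norm_of_real) (simp add: add_pos_nonneg)
  also have "\<dots> \<le> (1 + R\<^sup>2) * \<epsilon> + R * \<epsilon> + R * \<epsilon>"
    using assms R by (intro add_mono mult_left_mono) auto
  also have "\<dots> = (1 + R)\<^sup>2 * \<epsilon>" by (simp add: power2_eq_square algebra_simps)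
  also have "\<dots> \<le> 2\<^sup>2 * \<epsilon>" using R \<epsilon> by (intro mult_right_mono power_mono) auto
  finally show ?thesis by simp
qed

text \<open>
  The recursion of \<open>p_power\<close> annihilates the geometric sequence \<open>R ^ k\<close>, so the moments of
  positive order consist of errors.
\<close>

lemma p_moment_pos:
  assumes k: "0 < k" "k + 2 \<le> N"
  shows "norm (\<Sum>i<n. of_real (p i) * \<zeta> i ^ k * y i) \<le> 4 * \<epsilon>"
proof -
  have "norm (m j - of_real (R ^ j) * x) \<le> \<epsilon>" if "0 < j" "j \<le> N" for j
    using mom[OF that(2)] that(1) by (simp add: m_def)
  from combo_bound[OF this[of "Suc k"] this[of "Suc (Suc k)"] this[of k]] k
  show ?thesis unfolding p_moment by (simp add: power2_eq_square algebra_simps)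
qed

lemma p_moment_0: "norm ((\<Sum>i<n. of_real (p i) * y i) - of_real (R * (1 - R\<^sup>2)) * q) \<le> 4 * \<epsilon>"
proof -
  have "norm (m (Suc 0) - of_real R * x) \<le> \<epsilon>" "norm (m (Suc (Suc 0)) - of_real (R\<^sup>2) * x) \<le> \<epsilon>"
    "norm (m 0 - (x - of_real (1 - R\<^sup>2) * q)) \<le> \<epsilon>"
    using mom[of "Suc 0"] mom[of "Suc (Suc 0)"] mom[of 0] N by (auto simp: m_def power2_eq_square)
  note bound = combo_bound[OF this]
  have "(\<Sum>i<n. of_real (p i) * y i) = of_real (1 + R\<^sup>2) * m (Suc 0) - of_real R * m (Suc (Suc 0)) - of_real R * m 0"
    using p_moment[of 0] by simp
  with bound show ?thesis by (simp only:) (simp add: power2_eq_square algebra_simps)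
qed

text \<open>
  At \<open>R\<close> the Cauchy kernel cancels one factor of \<open>norm (\<zeta> - R) ^ 2\<close>, which leaves two moments of
  \<open>c\<close>.
\<close>

lemma analytic_part_R:
  "norm ((\<Sum>i<n. of_real (p i) / (1 - of_real R * cnj (\<zeta> i)) * y i) - of_real (R * (1 - R\<^sup>2)) * x) \<le> 2 * \<epsilon>"
proof -
  have "of_real (p i) / (1 - of_real R * cnj (\<zeta> i)) = of_real (c i) * (cnj (\<zeta> i) * \<zeta> i ^ 1) - of_real R * (of_real (c i) * (cnj (\<zeta> i) * \<zeta> i ^ 2))"
    if i: "i < n" for i
  proof -
    have u: "cnj (\<zeta> i) * \<zeta> i = 1" by (rule unit_cnj_mult[OF \<zeta>[OF i]])
    have "norm (of_real R * cnj (\<zeta> i)) < 1" using R \<zeta>[OF i] by (simp add: norm_mult)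
    then have nz: "1 - of_real R * cnj (\<zeta> i) \<noteq> 0" by fastforce
    have "(1 - of_real R * cnj (\<zeta> i)) * \<zeta> i = \<zeta> i - of_real R * (cnj (\<zeta> i) * \<zeta> i)"
      by (simp add: algebra_simps)
    then have fac: "\<zeta> i - of_real R = (1 - of_real R * cnj (\<zeta> i)) * \<zeta> i" by (simp add: u)
    have "of_real (p i) / (1 - of_real R * cnj (\<zeta> i)) = of_real (c i) * ((cnj (\<zeta> i) - of_real R) * \<zeta> i)"
      unfolding p_cnj[OF i] fac using nz by simp
    also have "(cnj (\<zeta> i) - of_real R) * \<zeta> i = cnj (\<zeta> i) * \<zeta> i - of_real R * ((cnj (\<zeta> i) * \<zeta> i) * \<zeta> i)"
      unfolding u using u by (simp add: left_diff_distrib)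
    finally show ?thesis by (simp add: power2_eq_square algebra_simps)
  qed
  then have "(\<Sum>i<n. of_real (p i) / (1 - of_real R * cnj (\<zeta> i)) * y i) = (\<Sum>i<n. of_real (c i) * (cnj (\<zeta> i) * \<zeta> i ^ 1) * y i
     - of_real R * (of_real (c i) * (cnj (\<zeta> i) * \<zeta> i ^ 2) * y i))"
    by (intro sum.cong refl) (simp only: lessThan_iff left_diff_distrib mult.assoc)
  also have "\<dots> = m 1 - of_real R * m 2" by (simp only: m_def sum_subtractf sum_distrib_left)
  finally have eq: "(\<Sum>i<n. of_real (p i) / (1 - of_real R * cnj (\<zeta> i)) * y i) - of_real (R * (1 - R\<^sup>2)) * x
     = (m 1 - of_real R * x) - of_real R * (m 2 - of_real (R\<^sup>2) * x)"
    by (simp add: power2_eq_square algebra_simps)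
  have "norm (m 1 - of_real R * x) \<le> \<epsilon>" "norm (m 2 - of_real (R\<^sup>2) * x) \<le> \<epsilon>"
    using mom[of 1] mom[of 2] N by (auto simp: m_def)
  moreover have "R * norm (m 2 - of_real (R\<^sup>2) * x) \<le> 1 * \<epsilon>"
    by (rule mult_mono) (use R \<open>norm (m 2 - of_real (R\<^sup>2) * x) \<le> \<epsilon>\<close> in auto)
  moreover have "norm ((m 1 - of_real R * x) - of_real R * (m 2 - of_real (R\<^sup>2) * x))
     \<le> norm (m 1 - of_real R * x) + R * norm (m 2 - of_real (R\<^sup>2) * x)"
    using norm_triangle_ineq4[of "m 1 - of_real R * x" "of_real R * (m 2 - of_real (R\<^sup>2) * x)"] R
    by (simp add: norm_mult del: of_real_power)
  ultimately show ?thesis unfolding eq by linarith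
qed

text \<open>
  The expansion in powers of \<open>cnj l\<close> involves the moments of positive order, which are small up
  to order \<open>N - 2\<close>; the tail is geometric. This is the reason why the limit of the measures is
  carried by a holomorphic disc and not merely by a harmonic one.
\<close>

lemma antianalytic_part:
  assumes l: "norm l < 1"
  shows "norm (\<Sum>i<n. of_real (p i) * (cnj l * \<zeta> i / (1 - cnj l * \<zeta> i)) * y i)
    \<le> (4 * \<epsilon> + 8 * Y * norm l ^ (N - 1)) / (1 - norm l)"
proof -
  define v where "v i = cnj l * \<zeta> i" for i
  have nv: "norm (v i) = norm l" if "i < n" for i using \<zeta>[OF that] by (simp add: v_def norm_mult)
  have one: "1 - norm l \<le> norm (1 - v i)" "1 - v i \<noteq> 0" if "i < n" for i
  proof -
    show "1 - norm l \<le> norm (1 - v i)" using norm_triangle_ineq2[of 1 "v i"] nv[OF that] by simp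
    then show "1 - v i \<noteq> 0" using l by auto
  qed
  define K where "K = N - 2"
  have geo: "v i / (1 - v i) = (\<Sum>k=1..K. v i ^ k) + v i ^ Suc K / (1 - v i)" if "i < n" for i
  proof -
    have "(\<Sum>k=1..K. v i ^ k) * (1 - v i) = v i - v i ^ Suc K"
    proof (induction K)
      case (Suc K)
      have "(\<Sum>k=1..Suc K. v i ^ k) * (1 - v i) = (\<Sum>k=1..K. v i ^ k) * (1 - v i) + v i ^ Suc K * (1 - v i)"
        by (simp add: distrib_right)
      also have "\<dots> = v i - v i ^ Suc (Suc K)" unfolding Suc by (simp add: algebra_simps)
      finally show ?case .
    qed simp
    then show ?thesis using one(2)[OF that] by (simp add: field_simps)
  qed
  have "(\<Sum>i<n. of_real (p i) * (v i / (1 - v i)) * y i)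
     = (\<Sum>i<n. (\<Sum>k=1..K. cnj l ^ k * (of_real (p i) * \<zeta> i ^ k * y i)) + of_real (p i) * (v i ^ Suc K / (1 - v i)) * y i)"
  proof (intro sum.cong refl)
    fix i assume "i \<in> {..<n}"
    then have "of_real (p i) * (v i / (1 - v i)) * y i
      = of_real (p i) * (\<Sum>k=1..K. v i ^ k) * y i + of_real (p i) * (v i ^ Suc K / (1 - v i)) * y i"
      by (subst geo) (auto simp: algebra_simps)
    also have "of_real (p i) * (\<Sum>k=1..K. v i ^ k) * y i = (\<Sum>k=1..K. cnj l ^ k * (of_real (p i) * \<zeta> i ^ k * y i))"
      unfolding sum_distrib_left sum_distrib_right by (simp add: v_def power_mult_distrib mult_ac)
    finally show "of_real (p i) * (v i / (1 - v i)) * y i = (\<Sum>k=1..K. cnj l ^ k * (of_real (p i) * \<zeta> i ^ k * y i)) + of_real (p i) * (v i ^ Suc K / (1 - v i)) * y i" .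
  qed
  also have "\<dots> = (\<Sum>k=1..K. cnj l ^ k * (\<Sum>i<n. of_real (p i) * \<zeta> i ^ k * y i)) + (\<Sum>i<n. of_real (p i) * (v i ^ Suc K / (1 - v i)) * y i)"
    unfolding sum.distrib sum_distrib_left by (subst sum.swap) simp
  finally have split: "(\<Sum>i<n. of_real (p i) * (v i / (1 - v i)) * y i) = \<dots>" .
  have a: "norm (\<Sum>k=1..K. cnj l ^ k * (\<Sum>i<n. of_real (p i) * \<zeta> i ^ k * y i)) \<le> 4 * \<epsilon> / (1 - norm l)"
  proof -
    have "norm (\<Sum>k=1..K. cnj l ^ k * (\<Sum>i<n. of_real (p i) * \<zeta> i ^ k * y i)) \<le> (\<Sum>k=1..K. norm l ^ k * (4 * \<epsilon>))"
    proof (rule sum_norm_le)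
      fix k assume k: "k \<in> {1..K}"
      then have "norm (\<Sum>i<n. of_real (p i) * \<zeta> i ^ k * y i) \<le> 4 * \<epsilon>"
        using N by (intro p_moment_pos) (auto simp: K_def)
      then show "norm (cnj l ^ k * (\<Sum>i<n. of_real (p i) * \<zeta> i ^ k * y i)) \<le> norm l ^ k * (4 * \<epsilon>)"
        unfolding norm_mult norm_power complex_mod_cnj by (intro mult_left_mono) auto
    qed
    also have "\<dots> \<le> (\<Sum>k<Suc K. norm l ^ k * (4 * \<epsilon>))"
      by (intro sum_mono2) (auto simp: \<epsilon>)
    also have "\<dots> = (\<Sum>k<Suc K. norm l ^ k) * (4 * \<epsilon>)" by (simp only: sum_distrib_right)
    also have "\<dots> \<le> (\<Sum>k. norm l ^ k) * (4 * \<epsilon>)"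
      using l \<epsilon> by (intro mult_right_mono sum_le_suminf summable_geometric) auto
    also have "\<dots> = 4 * \<epsilon> / (1 - norm l)" using suminf_geometric[of "norm l"] l by simp
    finally show ?thesis .
  qed
  have b: "norm (\<Sum>i<n. of_real (p i) * (v i ^ Suc K / (1 - v i)) * y i) \<le> 8 * Y * norm l ^ (N - 1) / (1 - norm l)"
  proof -
    have "norm (\<Sum>i<n. of_real (p i) * (v i ^ Suc K / (1 - v i)) * y i) \<le> (\<Sum>i<n. p i * (norm l ^ Suc K / (1 - norm l) * Y))"
    proof (rule sum_norm_le)
      fix i assume "i \<in> {..<n}"
      then have i: "i < n" by simp
      have "norm (v i ^ Suc K / (1 - v i)) \<le> norm l ^ Suc K / (1 - norm l)"
        unfolding norm_divide norm_power nv[OF i] using one[OF i] l by (intro divide_left_mono) (auto intro!: mult_pos_pos)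
      then have "norm (v i ^ Suc K / (1 - v i)) * norm (y i) \<le> norm l ^ Suc K / (1 - norm l) * Y"
        using y[OF i] l by (intro mult_mono) auto
      from mult_left_mono[OF this p_nonneg[OF i]]
      show "norm (of_real (p i) * (v i ^ Suc K / (1 - v i)) * y i) \<le> p i * (norm l ^ Suc K / (1 - norm l) * Y)"
        using p_nonneg[OF i] by (simp only: norm_mult norm_of_real abs_of_nonneg mult.assoc)
    qed
    also have "\<dots> = (\<Sum>i<n. p i) * (norm l ^ Suc K / (1 - norm l) * Y)" by (simp only: sum_distrib_right)
    also have "\<dots> \<le> 8 * (norm l ^ Suc K / (1 - norm l) * Y)" using p_sum l Y by (intro mult_right_mono) auto
    also have "8 * (norm l ^ Suc K / (1 - norm l) * Y) = 8 * Y * norm l ^ (N - 1) / (1 - norm l)"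
      using N by (simp add: K_def Suc_diff_le numeral_2_eq_2 Suc_diff_Suc)
    finally show ?thesis .
  qed
  have "norm (\<Sum>i<n. of_real (p i) * (v i / (1 - v i)) * y i) \<le> 4 * \<epsilon> / (1 - norm l) + 8 * Y * norm l ^ (N - 1) / (1 - norm l)"
    unfolding split by (rule norm_triangle_mono[OF a b])
  then show ?thesis by (simp add: v_def add_divide_distrib)
qed

lemma analytic_part_bound:
  assumes l: "norm l < 1"
  shows "norm (\<Sum>i<n. of_real (p i) / (1 - l * cnj (\<zeta> i)) * y i) \<le> 8 * Y / (1 - norm l)"
proof -
  have "norm (\<Sum>i<n. of_real (p i) / (1 - l * cnj (\<zeta> i)) * y i) \<le> (\<Sum>i<n. p i * (Y / (1 - norm l)))"
  proof (rule sum_norm_le)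
    fix i assume "i \<in> {..<n}"
    then have i: "i < n" by simp
    have "1 - norm l \<le> norm (1 - l * cnj (\<zeta> i))"
      using norm_triangle_ineq2[of 1 "l * cnj (\<zeta> i)"] \<zeta>[OF i] by (simp add: norm_mult)
    then have "norm (y i) / norm (1 - l * cnj (\<zeta> i)) \<le> Y / (1 - norm l)"
      using y[OF i] l Y by (intro frac_le) auto
    from mult_left_mono[OF this p_nonneg[OF i]]
    show "norm (of_real (p i) / (1 - l * cnj (\<zeta> i)) * y i) \<le> p i * (Y / (1 - norm l))"
      using p_nonneg[OF i] by (simp add: norm_mult norm_divide)
  qed
  also have "\<dots> = (\<Sum>i<n. p i) * (Y / (1 - norm l))" by (simp only: sum_distrib_right)
  also have "\<dots> \<le> 8 * (Y / (1 - norm l))" using p_sum l Y by (intro mult_right_mono) auto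
  finally show ?thesis by simp
qed

end

text \<open>
  The Poisson kernel as a Cauchy kernel plus an antianalytic kernel.
\<close>

lemma poisson_split:
  assumes "norm (u :: complex) < 1"
  shows "of_real ((1 - (norm u)\<^sup>2) / (norm (1 - u))\<^sup>2) = 1 / (1 - u) + cnj u / (1 - cnj u)"
proof -
  have "u \<noteq> 1" using assms by auto
  moreover from this have "cnj u \<noteq> 1" by (metis complex_cnj_cnj complex_cnj_one)
  ultimately have nz: "1 - u \<noteq> 0" "1 - cnj u \<noteq> 0" by auto
  have e1: "of_real ((norm (1 - u))\<^sup>2) = (1 - u) * (1 - cnj u)" by (simp only: complex_norm_square) simp
  have e2: "of_real (1 - (norm u)\<^sup>2) = 1 - u * cnj u"
    by (simp only: of_real_diff complex_norm_square of_real_1)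
  show ?thesis unfolding of_real_divide e1 e2 using nz by (simp add: divide_simps) (simp add: algebra_simps)
qed

text \<open>
  A disc that touches the boundary of a convex domain stays in a supporting hyperplane, by the
  maximum principle for the exponential of the supporting functional.
\<close>

lemma disc_in_closure_stays:
  fixes D :: "(complex ^ 'n) set"
  assumes D: "open D" "convex D" and hol: "\<And>i. (\<lambda>\<zeta>. \<phi> \<zeta> $ i) holomorphic_on ball 0 1"
    and cl: "\<And>\<zeta>. norm \<zeta> < 1 \<Longrightarrow> \<phi> \<zeta> \<in> closure D" and 0: "\<phi> 0 \<in> D"
  shows "holomorphic_disc \<phi> D"
  unfolding holomorphic_disc_def
proof (intro conjI allI hol subsetI)
  fix y assume "y \<in> \<phi> ` ball 0 1"
  then obtain l where l: "norm l < 1" "y = \<phi> l" by auto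
  show "y \<in> D"
  proof (rule ccontr)
    assume "y \<notin> D"
    then have yf: "y \<in> closure D - D" using cl[OF l(1)] l(2) by simp
    have ri: "rel_interior (closure D) = D"
      using convex_rel_interior_closure[OF D(2)] rel_interior_open[OF D(1)] by simp
    obtain a where a: "\<And>x. x \<in> closure D \<Longrightarrow> a \<bullet> y \<le> a \<bullet> x" "\<And>x. x \<in> rel_interior (closure D) \<Longrightarrow> a \<bullet> y < a \<bullet> x"
      using supporting_hyperplane_rel_boundary[of "closure D" y] yf D(2) ri by (metis DiffD1 DiffD2 convex_closure)
    define g where "g \<zeta> = exp (- (\<phi> \<zeta> \<odot> cnj_vec a))" for \<zeta>
    have ng: "norm (g \<zeta>) = exp (- (a \<bullet> \<phi> \<zeta>))" for \<zeta>
      using inner_cnj_vec[of "cnj_vec a" "\<phi> \<zeta>"] by (simp add: g_def norm_exp_eq_Re)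
    have "g constant_on ball 0 1"
    proof (rule maximum_modulus_principle[of g "ball 0 1" "ball 0 1" l])
      show "g holomorphic_on ball 0 1" unfolding g_def scalar_product_def by (intro holomorphic_intros hol)
      show "norm (g z) \<le> norm (g l)" if "z \<in> ball 0 1" for z
        using a(1)[OF cl, of z] that l(2) by (simp add: ng)
    qed (use l in auto)
    then have "g 0 = g l" using l(1) by (metis constant_on_def centre_in_ball dist_0_norm mem_ball zero_less_one)
    then have "norm (g 0) = norm (g l)" by simp
    then have "a \<bullet> \<phi> 0 = a \<bullet> y" by (simp add: ng l(2))
    then show False using a(2)[of "\<phi> 0"] 0 by (simp add: ri)
  qed
qed

text \<open>
  The Cauchy transforms \<open>F N l\<close> of the reweighted measures are bounded on compact subsets of the
  disc and converge pointwise along a filter to a holomorphic \<open>\<Phi>\<close>. Up to an antianalytic part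
  that tends to zero they are Poisson averages of points of \<open>D\<close>, so \<open>\<Phi>\<close> divided by the limiting
  mass \<open>T\<close> has values in the closure of \<open>D\<close>. The values at \<open>0\<close> and \<open>R\<close> are prescribed by the
  moments.
\<close>

lemma disc_from_moments:
  fixes D :: "(complex ^ 'n) set"
  assumes D: "open D" "bounded D" "convex D" and q: "q \<in> D" and R: "0 < R" "R < 1"
    and approx: "\<And>N \<epsilon>. 0 < \<epsilon> \<Longrightarrow> \<exists>n c \<zeta> z. circle_measure D n c \<zeta> z \<and>
      (\<Sum>k\<le>N. (norm (moments n c \<zeta> z k - moment_target q x R k))\<^sup>2) < \<epsilon>"
  obtains \<phi> where "holomorphic_disc \<phi> D" "\<phi> 0 = q" "\<phi> (of_real R) = x"
proof -
  obtain b where b: "0 < b" "\<And>z. z \<in> D \<Longrightarrow> norm z \<le> b" using D(2) bounded_pos by metis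
  define e where "e N = 1 / real (Suc N)" for N
  have e: "0 < e N" "e N \<le> 1" for N by (auto simp: e_def)
  have "\<forall>N. \<exists>n c \<zeta> z. circle_measure D n c \<zeta> z \<and>
      (\<Sum>k\<le>N. (norm (moments n c \<zeta> z k - moment_target q x R k))\<^sup>2) < (e N)\<^sup>2"
    by (intro allI approx zero_less_power e)
  then obtain n c \<zeta> z where *: "\<forall>N. circle_measure D (n N) (c N) (\<zeta> N) (z N) \<and>
      (\<Sum>k\<le>N. (norm (moments (n N) (c N) (\<zeta> N) (z N) k - moment_target q x R k))\<^sup>2) < (e N)\<^sup>2"
    unfolding choice_iff by (elim exE)
  then have meas: "\<And>N. circle_measure D (n N) (c N) (\<zeta> N) (z N)"
    and sq: "\<And>N. (\<Sum>k\<le>N. (norm (moments (n N) (c N) (\<zeta> N) (z N) k - moment_target q x R k))\<^sup>2) < (e N)\<^sup>2"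
    by blast+
  have close: "norm (moments (n N) (c N) (\<zeta> N) (z N) k - moment_target q x R k) \<le> e N" if "k \<le> N" for N k
  proof (rule power2_le_imp_le)
    have "(norm (moments (n N) (c N) (\<zeta> N) (z N) k - moment_target q x R k))\<^sup>2
      \<le> (\<Sum>k\<le>N. (norm (moments (n N) (c N) (\<zeta> N) (z N) k - moment_target q x R k))\<^sup>2)"
      by (rule member_le_sum) (use that in auto)
    then show "(norm (moments (n N) (c N) (\<zeta> N) (z N) k - moment_target q x R k))\<^sup>2 \<le> (e N)\<^sup>2" using sq[of N] by simp
  qed (use e less_imp_le in auto)
  have cn: "0 \<le> c N i" and \<zeta>n: "norm (\<zeta> N i) = 1" and zn: "z N i \<in> D" if "i < n N" for N i
    using meas[of N] that by (auto simp: circle_measure_def)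
  have norm_fst_le': "norm (fst a) \<le> norm a" and norm_snd_le': "norm (snd a) \<le> norm a" for a :: "(complex ^ 'n) \<times> complex"
    using norm_fst_le[of "fst a" "snd a"] norm_snd_le[of "snd a" "fst a"] by simp_all
  have vec_close: "norm ((\<Sum>i<n N. of_real (c N i) * (cnj (\<zeta> N i) * \<zeta> N i ^ k) * (z N i $ j))
       - (of_real (R ^ k) * (x $ j) - of_real (if k = 0 then 1 - R\<^sup>2 else 0) * (q $ j))) \<le> e N" if "k \<le> N" for N k j
  proof -
    have "fst (moments (n N) (c N) (\<zeta> N) (z N) k) $ j = (\<Sum>i<n N. of_real (c N i) * (cnj (\<zeta> N i) * \<zeta> N i ^ k) * (z N i $ j))"
      by (simp add: moments_def moment_atom_def fst_sum scaleR_conv_of_real[where 'a = complex] mult.assoc)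
    then have "(\<Sum>i<n N. of_real (c N i) * (cnj (\<zeta> N i) * \<zeta> N i ^ k) * (z N i $ j))
       - (of_real (R ^ k) * (x $ j) - of_real (if k = 0 then 1 - R\<^sup>2 else 0) * (q $ j))
       = fst (moments (n N) (c N) (\<zeta> N) (z N) k - moment_target q x R k) $ j"
      by (simp add: moment_target_def)
    then show ?thesis
      by (simp only:) (rule order_trans[OF Finite_Cartesian_Product.norm_nth_le order_trans[OF norm_fst_le' close[OF that]]])
  qed
  have sc_close: "norm ((\<Sum>i<n N. of_real (c N i) * (cnj (\<zeta> N i) * \<zeta> N i ^ k) * 1)
       - (of_real (R ^ k) * 1 - of_real (if k = 0 then 1 - R\<^sup>2 else 0) * 1)) \<le> e N" if "k \<le> N" for N k
  proof -
    have "snd (moments (n N) (c N) (\<zeta> N) (z N) k) = (\<Sum>i<n N. of_real (c N i) * (cnj (\<zeta> N i) * \<zeta> N i ^ k) * 1)"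
      by (simp add: moments_def moment_atom_def snd_sum scaleR_conv_of_real mult.assoc)
    then have "(\<Sum>i<n N. of_real (c N i) * (cnj (\<zeta> N i) * \<zeta> N i ^ k) * 1)
       - (of_real (R ^ k) * 1 - of_real (if k = 0 then 1 - R\<^sup>2 else 0) * 1)
       = snd (moments (n N) (c N) (\<zeta> N) (z N) k - moment_target q x R k)"
      by (simp add: moment_target_def)
    then show ?thesis
      by (simp only:) (rule order_trans[OF norm_snd_le' close[OF that]])
  qed
  have mass: "(\<Sum>i<n N. c N i) \<le> 2" if "2 \<le> N" for N
  proof -
    have "(\<Sum>i<n N. of_real (c N i) * (cnj (\<zeta> N i) * \<zeta> N i ^ 1) * 1) = complex_of_real (\<Sum>i<n N. c N i)"
      unfolding of_real_sum by (intro sum.cong refl) (use unit_cnj_mult[OF \<zeta>n] in simp)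
    then have "norm (complex_of_real (\<Sum>i<n N. c N i) - of_real R) \<le> e N" using sc_close[of 1 N] that by simp
    then have "\<bar>(\<Sum>i<n N. c N i) - R\<bar> \<le> e N" by (metis norm_of_real of_real_diff)
    then show ?thesis using e(2)[of N] R by simp
  qed
  have npz: "near_poisson (n N) (c N) (\<zeta> N) (\<lambda>i. z N i $ j) R b (e N) (x $ j) (q $ j) N" if "2 \<le> N" for N j
    using cn \<zeta>n b R e(1)[of N] that mass[OF that] vec_close[of _ N j] order_trans[OF Finite_Cartesian_Product.norm_nth_le b(2)[OF zn]]
    by unfold_locales (auto intro: less_imp_le)
  have np1: "near_poisson (n N) (c N) (\<zeta> N) (\<lambda>i. 1) R 1 (e N) 1 1 N" if "2 \<le> N" for N
    using cn \<zeta>n R e(1)[of N] that mass[OF that] sc_close[of _ N]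
    by unfold_locales (auto intro: less_imp_le)
  define p where "p N = near_poisson.p (c N) (\<zeta> N) R" for N
  \<comment> \<open>The index shift by two provides the three consecutive moments that one moment of \<open>p\<close>
    needs.\<close>
  define F where "F N l = (\<Sum>i<n (N + 2). (of_real (p (N + 2) i) / (1 - l * cnj (\<zeta> (N + 2) i))) *s z (N + 2) i)" for N l
  have p_def': "p N i = near_poisson.p (c N) (\<zeta> N) R i" for N i by (simp add: p_def)
  have Fj: "F N l $ j = (\<Sum>i<n (N + 2). of_real (p (N + 2) i) / (1 - l * cnj (\<zeta> (N + 2) i)) * (z (N + 2) i $ j))" for N l j
    by (simp add: F_def)
  have Fj_le: "norm (F N l $ j) \<le> 8 * b / (1 - norm l)" if "norm l < 1" for N l j
    unfolding Fj p_def' using near_poisson.analytic_part_bound[OF npz[of "N + 2" j] that] by simp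
  have F_le: "norm (F N l) \<le> (\<Sum>j\<in>(UNIV :: 'n set). 8 * b / (1 - norm l))" if "l \<in> ball 0 1" for N l
    unfolding norm_vec_def by (rule order_trans[OF L2_set_le_sum]) (use that Fj_le in \<open>auto intro!: sum_mono simp del: sum_constant\<close>)
  obtain \<F> \<Phi> where \<F>: "\<F> \<le> sequentially" "\<F> \<noteq> bot" and \<Phi>: "\<And>l. l \<in> ball 0 1 \<Longrightarrow> ((\<lambda>N. F N l) \<longlongrightarrow> \<Phi> l) \<F>"
    using pointwise_cluster[OF sequentially_bot, of "ball 0 1" F "\<lambda>l. \<Sum>j\<in>(UNIV :: 'n set). 8 * b / (1 - norm l)"] F_le by metis
  have eF: "((\<lambda>N. e (N + 2)) \<longlongrightarrow> 0) \<F>"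
    by (rule tendsto_mono[OF \<F>(1)], rule LIMSEQ_ignore_initial_segment) (simp only: e_def LIMSEQ_Suc[OF lim_1_over_n])
  have to_lim: "(f \<longlongrightarrow> a) \<F>" if "\<And>N. norm (f N - a) \<le> C * e (N + 2)" for f :: "nat \<Rightarrow> complex" and a C
  proof -
    have "((\<lambda>N. f N - a) \<longlongrightarrow> 0) \<F>"
      by (rule Lim_null_comparison[where g = "\<lambda>N. C * e (N + 2)"]) (use that eF in \<open>auto intro!: tendsto_eq_intros\<close>)
    then show ?thesis by (simp add: LIM_zero_iff)
  qed
  define T where "T = R * (1 - R\<^sup>2)"
  have T: "0 < T" using R by (auto simp: T_def power2_eq_square intro!: mult_pos_pos) (smt (verit) mult_less_cancel_left1 mult_less_cancel_right1)
  have \<Phi>0: "\<Phi> 0 = T *\<^sub>R q"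
  proof -
    have "((\<lambda>N. F N 0 $ j) \<longlongrightarrow> of_real T * q $ j) \<F>" for j
      by (rule to_lim[where C = 4], unfold Fj p_def' T_def)
         (use near_poisson.p_moment_0[OF npz[of "_ + 2" j]] in simp)
    then have "\<Phi> 0 $ j = of_real T * q $ j" for j
      using tendsto_unique[OF \<F>(2) tendsto_vec_nth[OF \<Phi>[of 0]]] by simp
    then show ?thesis by (simp add: vec_eq_iff scaleR_conv_of_real[where 'a = complex])
  qed
  have \<Phi>R: "\<Phi> (of_real R) = T *\<^sub>R x"
  proof -
    have "((\<lambda>N. F N (of_real R) $ j) \<longlongrightarrow> of_real T * x $ j) \<F>" for j
      by (rule to_lim[where C = 2], unfold Fj p_def' T_def)
         (use near_poisson.analytic_part_R[OF npz[of "_ + 2" j]] in simp)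
    then have "\<Phi> (of_real R) $ j = of_real T * x $ j" for j
      using tendsto_unique[OF \<F>(2) tendsto_vec_nth[OF \<Phi>[of "of_real R"]]] R by simp
    then show ?thesis by (simp add: vec_eq_iff scaleR_conv_of_real[where 'a = complex])
  qed
  have \<Phi>hol: "(\<lambda>l. \<Phi> l $ j) holomorphic_on ball 0 1" for j
  proof (rule holomorphic_on_limit[OF \<F>(2) open_ball, where h = "\<lambda>N l. F N l $ j"])
    fix l :: complex assume l: "l \<in> ball 0 1"
    define r where "r = (1 - norm l) / 2"
    have r: "0 < r" using l by (simp add: r_def)
    have sub: "norm y \<le> 1 - r" if "y \<in> ball l r" for y
    proof -
      have "norm (l - y) < r" using that by (simp add: dist_norm)
      then show ?thesis using norm_triangle_ineq2[of y l] unfolding norm_minus_commute[of y l] r_def by argo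
    qed
    have bl: "ball l r \<subseteq> ball 0 1" using sub r by fastforce
    have "(\<lambda>l. F N l $ j) holomorphic_on ball l r" for N
      unfolding Fj
    proof (intro holomorphic_intros)
      fix i y assume i: "i \<in> {..<n (N + 2)}" and y: "y \<in> ball l r"
      have "norm (y * cnj (\<zeta> (N + 2) i)) < 1" using sub[OF y] r \<zeta>n[of i "N + 2"] i by (simp add: norm_mult)
      then show "1 - y * cnj (\<zeta> (N + 2) i) \<noteq> 0" by fastforce
    qed
    moreover have "norm (F N y $ j) \<le> 8 * b / r" if y: "y \<in> ball l r" for N y
    proof -
      have "norm (F N y $ j) \<le> 8 * b / (1 - norm y)" using sub[OF y] r by (intro Fj_le) auto
      also have "\<dots> \<le> 8 * b / r" using sub[OF y] r b(1) by (intro divide_left_mono) (auto intro!: mult_pos_pos)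
      finally show ?thesis .
    qed
    ultimately show "\<exists>r>0. \<exists>M. ball l r \<subseteq> ball 0 1 \<and> eventually (\<lambda>N. (\<lambda>l. F N l $ j) holomorphic_on ball l r \<and> (\<forall>y\<in>ball l r. norm (F N y $ j) \<le> M)) \<F>"
      using r bl by (intro exI[of _ r] exI[of _ "8 * b / r"] conjI always_eventually allI ballI) auto
  qed (use tendsto_vec_nth[OF \<Phi>] in auto)
  have \<Phi>cl: "(1 / T) *\<^sub>R \<Phi> l \<in> closure D" if l: "norm l < 1" for l
  proof -
    define P where "P N i = (1 - (norm l)\<^sup>2) / (norm (1 - l * cnj (\<zeta> (N + 2) i)))\<^sup>2" for N i
    define X where "X N i = cnj l * \<zeta> (N + 2) i / (1 - cnj l * \<zeta> (N + 2) i)" for N i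
    define U where "U N = (\<Sum>i<n (N + 2). (p (N + 2) i * P N i) *\<^sub>R z (N + 2) i)" for N
    define u where "u N = (\<Sum>i<n (N + 2). p (N + 2) i * P N i)" for N
    have P: "complex_of_real (P N i) = 1 / (1 - l * cnj (\<zeta> (N + 2) i)) + X N i" if "i < n (N + 2)" for N i
      using poisson_split[of "l * cnj (\<zeta> (N + 2) i)"] \<zeta>n[OF that] l by (simp add: P_def X_def norm_mult)
    have PX: "1 / (1 - l * cnj (\<zeta> (N + 2) i)) = 1 + cnj (X N i)" if "i < n (N + 2)" for N i
    proof -
      have "norm (l * cnj (\<zeta> (N + 2) i)) < 1" using \<zeta>n[OF that] l by (simp add: norm_mult)
      then have "1 - l * cnj (\<zeta> (N + 2) i) \<noteq> 0" by fastforce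
      then show ?thesis by (simp add: X_def field_simps)
    qed
    have pP: "0 \<le> p (N + 2) i * P N i" if "i < n (N + 2)" for N i
      using near_poisson.p_nonneg[OF np1[of "N + 2"] that] l by (auto simp: p_def P_def power_le_one intro!: mult_nonneg_nonneg divide_nonneg_nonneg)
    define \<eta> where "\<eta> Y N = (4 * e (N + 2) + 8 * Y * norm l ^ (N + 1)) / (1 - norm l)" for Y N
    have "(\<lambda>N. norm l ^ (N + 1)) \<longlonglongrightarrow> 0"
      using LIMSEQ_ignore_initial_segment[OF LIMSEQ_power_zero[of "norm l"], of 1] l by simp
    then have lF: "((\<lambda>N. norm l ^ (N + 1)) \<longlongrightarrow> 0) \<F>" by (rule tendsto_mono[OF \<F>(1)])
    have \<eta>: "(\<eta> Y \<longlongrightarrow> 0) \<F>" for Y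
    proof -
      have "((\<lambda>N. (4 * e (N + 2) + 8 * Y * norm l ^ (N + 1)) / (1 - norm l)) \<longlongrightarrow> (4 * 0 + 8 * Y * 0) / (1 - norm l)) \<F>"
        by (intro tendsto_divide tendsto_add tendsto_mult tendsto_const eF lF) (use l in auto)
      then show ?thesis by (simp add: \<eta>_def[abs_def])
    qed
    have Xz: "((\<lambda>N. \<Sum>i<n (N + 2). of_real (p (N + 2) i) * X N i * (z (N + 2) i $ j)) \<longlongrightarrow> 0) \<F>" for j
      by (rule Lim_null_comparison[OF always_eventually \<eta>[of b]])
         (use near_poisson.antianalytic_part[OF npz[of "_ + 2" j] l] in \<open>simp add: X_def p_def' \<eta>_def\<close>)
    have X1: "((\<lambda>N. \<Sum>i<n (N + 2). of_real (p (N + 2) i) * X N i) \<longlongrightarrow> 0) \<F>"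
      by (rule Lim_null_comparison[OF always_eventually \<eta>[of 1]])
         (use near_poisson.antianalytic_part[OF np1[of "_ + 2"] l] in \<open>simp add: X_def p_def' \<eta>_def\<close>)
    have U: "(U \<longlongrightarrow> \<Phi> l) \<F>"
    proof (rule vec_tendstoI)
      fix j
      have "U N $ j = F N l $ j + (\<Sum>i<n (N + 2). of_real (p (N + 2) i) * X N i * (z (N + 2) i $ j))" for N
      proof -
        have "U N $ j = (\<Sum>i<n (N + 2). of_real (p (N + 2) i) * of_real (P N i) * (z (N + 2) i $ j))"
          by (simp add: U_def scaleR_conv_of_real[where 'a = complex])
        also have "\<dots> = (\<Sum>i<n (N + 2). of_real (p (N + 2) i) / (1 - l * cnj (\<zeta> (N + 2) i)) * (z (N + 2) i $ j)
            + of_real (p (N + 2) i) * X N i * (z (N + 2) i $ j))"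
          by (intro sum.cong refl) (simp add: P algebra_simps)
        finally show ?thesis by (simp only: Fj sum.distrib)
      qed
      then show "((\<lambda>N. U N $ j) \<longlongrightarrow> \<Phi> l $ j) \<F>"
        using tendsto_add[OF tendsto_vec_nth[OF \<Phi>, of l j] Xz[of j]] l by simp
    qed
    have u: "(u \<longlongrightarrow> T) \<F>"
    proof -
      have p0: "((\<lambda>N. \<Sum>i<n (N + 2). complex_of_real (p (N + 2) i)) \<longlongrightarrow> of_real T) \<F>"
        by (rule to_lim[where C = 4], unfold p_def' T_def)
           (use near_poisson.p_moment_0[OF np1[of "_ + 2"]] in simp)
      have "complex_of_real (u N) = (\<Sum>i<n (N + 2). of_real (p (N + 2) i)) + cnj (\<Sum>i<n (N + 2). of_real (p (N + 2) i) * X N i)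
          + (\<Sum>i<n (N + 2). of_real (p (N + 2) i) * X N i)" for N
      proof -
        have "complex_of_real (u N) = (\<Sum>i<n (N + 2). of_real (p (N + 2) i) * of_real (P N i))" by (simp add: u_def)
        also have "\<dots> = (\<Sum>i<n (N + 2). of_real (p (N + 2) i) + of_real (p (N + 2) i) * cnj (X N i) + of_real (p (N + 2) i) * X N i)"
          by (intro sum.cong refl) (simp only: lessThan_iff P PX distrib_left mult_1_right)
        finally show ?thesis by (simp add: sum.distrib)
      qed
      moreover have "((\<lambda>N. (\<Sum>i<n (N + 2). of_real (p (N + 2) i)) + cnj (\<Sum>i<n (N + 2). of_real (p (N + 2) i) * X N i)
          + (\<Sum>i<n (N + 2). of_real (p (N + 2) i) * X N i)) \<longlongrightarrow> of_real T + cnj 0 + 0) \<F>"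
        by (intro tendsto_add tendsto_cnj p0 X1)
      ultimately have "((\<lambda>N. complex_of_real (u N)) \<longlongrightarrow> of_real T) \<F>" by simp
      from tendsto_Re[OF this] show ?thesis by simp
    qed
    have "((\<lambda>N. (1 / u N) *\<^sub>R U N) \<longlongrightarrow> (1 / T) *\<^sub>R \<Phi> l) \<F>"
      using u U T by (intro tendsto_intros) auto
    moreover have "eventually (\<lambda>N. (1 / u N) *\<^sub>R U N \<in> closure D) \<F>"
      using order_tendstoD(1)[OF u T]
    proof eventually_elim
      case (elim N)
      have "(\<Sum>i<n (N + 2). (p (N + 2) i * P N i / u N) *\<^sub>R z (N + 2) i) \<in> D"
      proof (rule convex_sum[OF _ D(3)])
        show "(\<Sum>i<n (N + 2). p (N + 2) i * P N i / u N) = 1"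
          unfolding sum_divide_distrib[symmetric] u_def[symmetric] using elim by simp
      qed (use pP zn elim in auto)
      then show ?case using closure_subset by (auto simp: U_def scaleR_sum_right)
    qed
    ultimately show ?thesis by (intro Lim_in_closed_set[OF closed_closure _ \<F>(2)])
  qed
  define \<phi> where "\<phi> l = (1 / T) *\<^sub>R \<Phi> l" for l
  have "holomorphic_disc \<phi> D"
  proof (rule disc_in_closure_stays[OF D(1,3)])
    show "(\<lambda>\<zeta>. \<phi> \<zeta> $ i) holomorphic_on ball 0 1" for i
      unfolding \<phi>_def vector_scaleR_component scaleR_conv_of_real[where 'a = complex] by (intro holomorphic_intros \<Phi>hol)
  qed (use \<Phi>cl \<Phi>0 T q in \<open>auto simp: \<phi>_def\<close>)
  moreover have "\<phi> 0 = q" "\<phi> (of_real R) = x" using \<Phi>0 \<Phi>R T by (auto simp: \<phi>_def)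
  ultimately show thesis using that by blast
qed

section \<open>Geodesics through two points\<close>

text \<open>
  Schwarz-Pick for the function divided by \<open>2 * B\<close>.
\<close>

lemma disc_lipschitz:
  assumes g: "g holomorphic_on ball 0 1" and B: "0 < B" "\<And>z. norm z < 1 \<Longrightarrow> norm (g z) \<le> B"
    and a: "norm a < 1" and b: "norm b < 1"
  shows "norm (g a - g b) \<le> 4 * B / (1 - norm a) * norm (a - b)"
proof -
  define k where "k z = g z / of_real (2 * B)" for z
  have k1: "norm (k z) < 1" if "norm z < 1" for z
    using B(2)[OF that] B(1) by (simp add: k_def norm_divide)
  have "k holomorphic_on ball 0 1" unfolding k_def using B by (intro holomorphic_intros g) auto
  from Schwarz_Pick[OF this k1 a b] have pd: "pseudo_dist (k a) (k b) \<le> pseudo_dist a b" .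
  have nz: "1 - cnj (k a) * k b \<noteq> 0" by (rule one_minus_cnj_mult_nonzero[OF k1[OF a] k1[OF b]])
  have "norm (k a) * norm (k b) \<le> 1 * 1" using k1[OF a] k1[OF b] by (intro mult_mono) auto
  then have "norm (1 - cnj (k a) * k b) \<le> 2"
    using norm_triangle_ineq4[of 1 "cnj (k a) * k b"] by (simp add: norm_mult)
  then have "pseudo_dist (k a) (k b) * norm (1 - cnj (k a) * k b) \<le> pseudo_dist (k a) (k b) * 2"
    by (rule mult_left_mono) (rule pseudo_dist_nonneg)
  moreover have "pseudo_dist (k a) (k b) * norm (1 - cnj (k a) * k b) = norm (k a - k b)"
    using nz by (simp add: pseudo_dist_def)
  ultimately have "norm (k a - k b) \<le> pseudo_dist (k a) (k b) * 2" by simp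
  also have "\<dots> \<le> pseudo_dist a b * 2" using pd by simp
  also have "pseudo_dist a b \<le> norm (a - b) / (1 - norm a)"
  proof -
    have "norm a * norm b \<le> norm a * 1" using b by (intro mult_left_mono) auto
    then have "1 - norm a \<le> norm (1 - cnj a * b)"
      using norm_triangle_ineq2[of 1 "cnj a * b"] by (simp add: norm_mult)
    then show ?thesis unfolding pseudo_dist_def using a by (intro divide_left_mono) (auto intro!: mult_pos_pos)
  qed
  finally have "norm (k a - k b) \<le> norm (a - b) / (1 - norm a) * 2" by simp
  moreover have "norm (g a - g b) = 2 * B * norm (k a - k b)"
    using B(1) by (simp add: k_def norm_divide flip: diff_divide_distrib)
  ultimately show ?thesis using mult_left_mono[of _ _ "2 * B"] B(1) by fastforce
qed

text \<open>
  Either the target moments are approximable to every order and accuracy, or there is a gap at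
  some order.
\<close>

lemma disc_or_function:
  fixes D :: "(complex ^ 'n) set"
  assumes D: "open D" "bounded D" "convex D" and q: "q \<in> D" and x: "x \<in> D" and R: "0 < R" "R < 1"
  shows "(\<exists>\<phi>. holomorphic_disc \<phi> D \<and> \<phi> 0 = q \<and> \<phi> (of_real R) = x) \<or>
    (\<exists>G. holomorphic_fun_on G D \<and> G ` D \<subseteq> ball 0 1 \<and> G q = 0 \<and> G x = of_real R)"
proof (cases "\<exists>N Q0. 0 < Q0 \<and> (\<forall>n c \<zeta> z. circle_measure D n c \<zeta> z \<longrightarrow>
      Q0 \<le> (\<Sum>k\<le>N. (norm (moments n c \<zeta> z k - moment_target q x R k))\<^sup>2))")
  case True
  then obtain N Q0 where "0 < Q0" "\<And>n c \<zeta> z. circle_measure D n c \<zeta> z \<Longrightarrow>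
      Q0 \<le> (\<Sum>k\<le>N. (norm (moments n c \<zeta> z k - moment_target q x R k))\<^sup>2)" by blast
  from function_from_gap[OF D(1,2) q x R this] show ?thesis by metis
next
  case False
  then have "\<And>N \<epsilon>. 0 < \<epsilon> \<Longrightarrow> \<exists>n c \<zeta> z. circle_measure D n c \<zeta> z \<and>
      (\<Sum>k\<le>N. (norm (moments n c \<zeta> z k - moment_target q x R k))\<^sup>2) < \<epsilon>"
    by (simp add: not_le)
  from disc_from_moments[OF D q R this] show ?thesis by metis
qed

lemma function_limit:
  fixes D :: "(complex ^ 'n) set"
  assumes D: "open D" "convex D" and q: "q \<in> D" and x: "x \<in> D" and R: "R \<longlonglongrightarrow> \<rho>"
    and ex: "\<And>n :: nat. \<exists>G. holomorphic_fun_on G D \<and> G ` D \<subseteq> ball 0 1 \<and> G q = 0 \<and> G x = complex_of_real (R n)"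
  obtains G where "holomorphic_fun_on G D" "G ` D \<subseteq> ball 0 1" "G q = 0" "G x = of_real \<rho>"
proof -
  from ex obtain g where g: "\<forall>n. holomorphic_fun_on (g n) D \<and> g n ` D \<subseteq> ball 0 1 \<and> g n q = 0 \<and> g n x = complex_of_real (R n)"
    unfolding choice_iff by metis
  have g1: "norm (g n z) \<le> 1" if "z \<in> D" for n z
  proof -
    have "g n z \<in> ball 0 1" using g that by blast
    then show ?thesis by simp
  qed
  have g_hol: "\<And>n. holomorphic_fun_on (g n) D" using g by blast
  obtain F G where F: "F \<le> sequentially" "F \<noteq> bot" and G: "\<And>z. z \<in> D \<Longrightarrow> ((\<lambda>n. g n z) \<longlongrightarrow> G z) F"
    and Ghol: "holomorphic_fun_on G D" and G_le: "\<And>z. z \<in> D \<Longrightarrow> norm (G z) \<le> 1"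
    by (rule bounded_sequence_cluster[OF D(1), where h = g and B = 1]) (use g_hol g1 in blast)+
  have Gq: "G q = 0" using G[OF q] F(2) g by (simp add: tendsto_const_iff)
  have "((\<lambda>n. g n x) \<longlongrightarrow> of_real \<rho>) F"
    using g tendsto_mono[OF F(1) tendsto_of_real[OF R]] by simp
  then have Gx: "G x = of_real \<rho>" using tendsto_unique[OF F(2) G[OF x]] by blast
  have "norm (G z) < 1" if "z \<in> D" for z
    using holomorphic_fun_strict_max[OF Ghol D, of 1 q] G_le that q Gq by simp
  then have "G ` D \<subseteq> ball 0 1" by auto
  then show thesis using that Ghol Gq Gx by blast
qed

text \<open>
  The Lipschitz bound makes the evaluation points \<open>R n\<close> move along with the discs. The parameter
  \<open>\<rho> = 0\<close> is excluded because it would force \<open>q = x\<close>.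
\<close>

lemma disc_limit:
  fixes D :: "(complex ^ 'n) set"
  assumes D: "open D" "bounded D" "convex D" and q: "q \<in> D" and qx: "q \<noteq> x"
    and R: "R \<longlonglongrightarrow> \<rho>" "\<And>n. 0 < R n" "\<And>n. R n < 1" and \<rho>: "0 \<le> \<rho>" "\<rho> < 1"
    and ex: "\<And>n :: nat. \<exists>\<phi>. holomorphic_disc \<phi> D \<and> \<phi> 0 = q \<and> \<phi> (complex_of_real (R n)) = x"
  obtains \<phi> where "holomorphic_disc \<phi> D" "\<phi> 0 = q" "\<phi> (of_real \<rho>) = x" "0 < \<rho>"
proof -
  from ex obtain g where g: "\<forall>n. holomorphic_disc (g n) D \<and> g n 0 = q \<and> g n (complex_of_real (R n)) = x"
    unfolding choice_iff by metis
  obtain b where b: "0 < b" "\<And>z. z \<in> D \<Longrightarrow> norm z \<le> b" using D(2) bounded_pos by metis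
  have gD: "g n \<zeta> \<in> D" if "norm \<zeta> < 1" for n \<zeta>
  proof -
    have "g n ` ball 0 1 \<subseteq> D" using g by (simp add: holomorphic_disc_def)
    then show ?thesis using that by (auto simp: image_subset_iff)
  qed
  have ghol: "(\<lambda>\<zeta>. g n \<zeta> $ j) holomorphic_on ball 0 1" for n j using g by (auto simp: holomorphic_disc_def)
  have gb: "norm (g n \<zeta> $ j) \<le> b" if "norm \<zeta> < 1" for n \<zeta> j
    by (rule order_trans[OF Finite_Cartesian_Product.norm_nth_le b(2)[OF gD[OF that]]])
  obtain F \<phi> where F: "F \<le> sequentially" "F \<noteq> bot" and \<phi>: "\<And>\<zeta>. \<zeta> \<in> ball 0 1 \<Longrightarrow> ((\<lambda>n. g n \<zeta>) \<longlongrightarrow> \<phi> \<zeta>) F"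
    using pointwise_cluster[OF sequentially_bot, of "ball 0 1" g "\<lambda>_. b"] b(2)[OF gD] by (metis dist_0_norm mem_ball)
  have \<phi>hol: "(\<lambda>\<zeta>. \<phi> \<zeta> $ j) holomorphic_on ball 0 1" for j
  proof (rule holomorphic_on_limit[OF F(2) open_ball, where h = "\<lambda>n \<zeta>. g n \<zeta> $ j"])
    fix z :: complex assume z: "z \<in> ball 0 1"
    then obtain r where r: "0 < r" "ball z r \<subseteq> ball 0 1" by (meson open_ball open_contains_ball)
    have "norm (g k y $ j) \<le> b" if "y \<in> ball z r" for k y
      using gb[of y] r(2) that by auto
    moreover have "(\<lambda>\<zeta>. g k \<zeta> $ j) holomorphic_on ball z r" for k
      by (rule holomorphic_on_subset[OF ghol r(2)])
    ultimately have "eventually (\<lambda>k. (\<lambda>\<zeta>. g k \<zeta> $ j) holomorphic_on ball z r \<and> (\<forall>y\<in>ball z r. norm (g k y $ j) \<le> b)) F"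
      by (intro always_eventually allI conjI ballI)
    then show "\<exists>r>0. \<exists>M. ball z r \<subseteq> ball 0 1 \<and> eventually (\<lambda>k. (\<lambda>\<zeta>. g k \<zeta> $ j) holomorphic_on ball z r \<and> (\<forall>y\<in>ball z r. norm (g k y $ j) \<le> M)) F"
      using r by blast
  qed (use tendsto_vec_nth[OF \<phi>] in auto)
  have \<phi>0: "\<phi> 0 = q" using \<phi>[of 0] F(2) g by (simp add: tendsto_const_iff)
  have disc: "holomorphic_disc \<phi> D"
  proof (rule disc_in_closure_stays[OF D(1,3) \<phi>hol])
    show "\<phi> \<zeta> \<in> closure D" if "norm \<zeta> < 1" for \<zeta>
    proof (rule Lim_in_closed_set[OF closed_closure _ F(2)])
      show "((\<lambda>n. g n \<zeta>) \<longlongrightarrow> \<phi> \<zeta>) F" using \<phi> that by simp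
      show "eventually (\<lambda>n. g n \<zeta> \<in> closure D) F"
        using gD[OF that] closure_subset by (intro always_eventually) blast
    qed
  qed (use \<phi>0 q in simp)
  have "((\<lambda>n. g n (of_real \<rho>)) \<longlongrightarrow> x) F"
  proof (rule vec_tendstoI)
    fix j
    have "((\<lambda>n. g n (of_real \<rho>) $ j - x $ j) \<longlongrightarrow> 0) F"
    proof (rule Lim_null_comparison)
      have "norm (g n (of_real \<rho>) $ j - g n (of_real (R n)) $ j) \<le> 4 * b / (1 - norm (complex_of_real \<rho>)) * norm (complex_of_real \<rho> - of_real (R n))" for n
        by (rule disc_lipschitz[OF ghol b(1) gb]) (use \<rho> R(2,3)[of n] in auto)
      then have "norm (g n (of_real \<rho>) $ j - x $ j) \<le> 4 * b / (1 - norm (complex_of_real \<rho>)) * norm (complex_of_real \<rho> - of_real (R n))" for n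
        using g by simp
      then show "eventually (\<lambda>n. norm (g n (of_real \<rho>) $ j - x $ j) \<le> 4 * b / (1 - norm (complex_of_real \<rho>)) * norm (complex_of_real \<rho> - of_real (R n))) F"
        by simp
      have "((\<lambda>n. 4 * b / (1 - norm (complex_of_real \<rho>)) * norm (complex_of_real \<rho> - of_real (R n))) \<longlongrightarrow> 4 * b / (1 - norm (complex_of_real \<rho>)) * norm (complex_of_real \<rho> - of_real \<rho>)) F"
        by (intro tendsto_intros tendsto_mono[OF F(1) R(1)])
      then show "((\<lambda>n. 4 * b / (1 - norm (complex_of_real \<rho>)) * norm (complex_of_real \<rho> - of_real (R n))) \<longlongrightarrow> 0) F" by simp
    qed
    then show "((\<lambda>n. g n (of_real \<rho>) $ j) \<longlongrightarrow> x $ j) F" by (simp add: LIM_zero_iff)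
  qed
  then have \<phi>x: "\<phi> (of_real \<rho>) = x" using tendsto_unique[OF F(2) \<phi>[of "of_real \<rho>"]] \<rho> by simp
  then have "0 < \<rho>" using \<rho>(1) \<phi>0 qx by (cases "\<rho> = 0") auto
  then show thesis using that disc \<phi>0 \<phi>x by blast
qed

text \<open>
  Lempert's theorem for bounded convex domains. Let \<open>\<rho>\<close> be the infimum of the parameters \<open>R\<close> for
  which some disc maps \<open>0\<close> to \<open>q\<close> and \<open>R\<close> to \<open>x\<close>; such parameters exist, as otherwise functions
  with values tending to one at \<open>x\<close> would have a limit that violates the maximum principle. A
  limit of discs attains \<open>\<rho>\<close>. Below \<open>\<rho>\<close> there are functions with \<open>G q = 0\<close> and \<open>G x = R\<close>, and a
  limit of these attains \<open>\<rho>\<close> too. The composition fixes \<open>0\<close> and \<open>\<rho>\<close>, so it is the identity by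
  the Schwarz lemma.
\<close>

theorem geodesic_through_two_points:
  fixes D :: "(complex ^ 'n) set"
  assumes D: "open D" "bounded D" "convex D" and q: "q \<in> D" and x: "x \<in> D" and qx: "q \<noteq> x"
  obtains \<phi> G \<sigma> where "holomorphic_disc \<phi> D" "\<phi> 0 = q" "0 < \<sigma>" "\<sigma> < 1" "\<phi> (of_real \<sigma>) = x"
    "left_inverse D \<phi> G"
proof -
  define S where "S = {R. 0 < R \<and> R < 1 \<and> (\<exists>\<phi>. holomorphic_disc \<phi> D \<and> \<phi> 0 = q \<and> \<phi> (complex_of_real R) = x)}"
  have alt: "\<exists>G. holomorphic_fun_on G D \<and> G ` D \<subseteq> ball 0 1 \<and> G q = 0 \<and> G x = complex_of_real R"
    if "0 < R" "R < 1" "R \<notin> S" for R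
    using disc_or_function[OF D q x that(1,2)] that by (auto simp: S_def)
  define t where "t n = 1 - 1 / real (n + 2)" for n :: nat
  have t: "0 < t n" "t n < 1" for n by (auto simp: t_def)
  have "(\<lambda>n. 1 / real (n + 2)) \<longlonglongrightarrow> 0" using LIMSEQ_ignore_initial_segment[OF lim_1_over_n, of 2] by simp
  then have tl: "t \<longlonglongrightarrow> 1" unfolding t_def using tendsto_diff[OF tendsto_const, of _ 0 _ 1] by fastforce
  have "S \<noteq> {}"
  proof
    assume S0: "S = {}"
    have ex: "\<exists>G. holomorphic_fun_on G D \<and> G ` D \<subseteq> ball 0 1 \<and> G q = 0 \<and> G x = complex_of_real (t n)" for n
      using alt[of "t n"] t[of n] S0 by simp
    obtain G where "G ` D \<subseteq> ball 0 1" "G x = complex_of_real 1"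
      by (rule function_limit[OF D(1,3) q x tl ex])
    then show False using x by auto
  qed
  define \<rho> where "\<rho> = Inf S"
  have bdd: "bdd_below S" by (rule bdd_belowI[of _ 0]) (auto simp: S_def)
  obtain R0 where "R0 \<in> S" using \<open>S \<noteq> {}\<close> by blast
  then have \<rho>: "0 \<le> \<rho>" "\<rho> < 1"
    unfolding \<rho>_def using cInf_lower[OF _ bdd, of R0] cInf_greatest[OF \<open>S \<noteq> {}\<close>, of 0] by (auto simp: S_def)
  have "\<exists>R. R \<in> S \<and> R < \<rho> + 1 / real (Suc n)" for n
    using cInf_lessD[OF \<open>S \<noteq> {}\<close>, of "\<rho> + 1 / real (Suc n)"] unfolding \<rho>_def by auto
  then obtain R where R: "\<And>n. R n \<in> S" "\<And>n. R n < \<rho> + 1 / real (Suc n)" by metis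
  have "R \<longlonglongrightarrow> \<rho>"
  proof (rule tendsto_sandwich[where f = "\<lambda>_. \<rho>" and h = "\<lambda>n. \<rho> + 1 / real (Suc n)"])
    show "(\<lambda>n. \<rho> + 1 / real (Suc n)) \<longlonglongrightarrow> \<rho>"
      using tendsto_add[OF tendsto_const LIMSEQ_Suc[OF lim_1_over_n], of \<rho>] by simp
    show "eventually (\<lambda>n. \<rho> \<le> R n) sequentially"
      unfolding \<rho>_def using cInf_lower[OF R(1) bdd] by (intro always_eventually allI)
    show "eventually (\<lambda>n. R n \<le> \<rho> + 1 / real (Suc n)) sequentially"
      by (intro always_eventually allI less_imp_le R(2))
  qed simp
  then obtain \<phi> where \<phi>: "holomorphic_disc \<phi> D" "\<phi> 0 = q" "\<phi> (of_real \<rho>) = x" "0 < \<rho>"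
    using disc_limit[OF D q qx, of R \<rho>] R(1) \<rho> by (auto simp: S_def)
  have "(\<lambda>n. \<rho> * t n) \<longlonglongrightarrow> \<rho>" using tendsto_mult[OF tendsto_const tl, of \<rho>] by simp
  moreover have "\<rho> * t n \<notin> S" "0 < \<rho> * t n" "\<rho> * t n < 1" for n
  proof -
    have lt: "\<rho> * t n < \<rho>" using t[of n] \<phi>(4) by simp
    then show "\<rho> * t n \<notin> S" unfolding \<rho>_def using cInf_lower[OF _ bdd] by fastforce
    show "\<rho> * t n < 1" using lt \<rho>(2) by simp
    show "0 < \<rho> * t n" using t[of n] \<phi>(4) by simp
  qed
  ultimately obtain G where G: "holomorphic_fun_on G D" "G ` D \<subseteq> ball 0 1" "G q = 0" "G x = of_real \<rho>"
    using function_limit[OF D(1,3) q x, of "\<lambda>n. \<rho> * t n" \<rho>] alt by metis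
  define g where "g \<zeta> = G (\<phi> \<zeta>)" for \<zeta>
  have \<phi>D: "\<phi> \<zeta> \<in> D" if "norm \<zeta> < 1" for \<zeta> using \<phi>(1) that by (auto simp: holomorphic_disc_def)
  have "g holomorphic_on ball 0 1" unfolding g_def
    by (rule compose_disc_holomorphic[OF G(1) D(1)]) (use \<phi>(1) in \<open>auto simp: holomorphic_disc_def\<close>)
  moreover have "norm (g \<zeta>) < 1" if "norm \<zeta> < 1" for \<zeta>
    using G(2) \<phi>D[OF that] by (auto simp: g_def)
  moreover have "\<exists>z. norm z < 1 \<and> z \<noteq> 0 \<and> norm (g z) = norm z"
    using \<phi> \<rho> G by (intro exI[of _ "of_real \<rho>"]) (auto simp: g_def)
  ultimately obtain \<alpha> where \<alpha>: "\<And>\<zeta>. norm \<zeta> < 1 \<Longrightarrow> g \<zeta> = \<alpha> * \<zeta>"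
    using Schwarz_Lemma(3)[of g 0] \<phi>(2) G(3) by (auto simp: g_def)
  have "\<alpha> = 1" using \<alpha>[of "of_real \<rho>"] \<phi>(3,4) \<rho> G(4) by (simp add: g_def)
  then have "left_inverse D \<phi> G" using G(1,2) \<alpha> by (simp add: left_inverse_def g_def)
  then show thesis using that \<phi> \<rho> by blast
qed

section \<open>Kobayashi distance and Kobayashi balls\<close>

lemma tanh_artanh_real:
  assumes "\<bar>x\<bar> < (1 :: real)"
  shows "tanh (artanh x) = x"
proof -
  have "exp (- 2 * artanh x) = (1 - x) / (1 + x)"
    using assms by (simp add: artanh_def exp_minus)
  then have "tanh (artanh x) = (1 - (1 - x) / (1 + x)) / (1 + (1 - x) / (1 + x))"
    by (simp add: tanh_real_altdef)
  also have "\<dots> = x" using assms by (simp add: field_simps)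
  finally show ?thesis .
qed

lemma artanh_le_iff: "\<bar>x\<bar> < 1 \<Longrightarrow> \<bar>y\<bar> < 1 \<Longrightarrow> artanh x \<le> artanh y \<longleftrightarrow> x \<le> (y :: real)"
  by (metis tanh_artanh_real tanh_real_le_iff)

text \<open>
  Rotating two points to a common ray does not increase their pseudo-hyperbolic distance.
\<close>

lemma norm_diff_le_pseudo_dist:
  assumes a: "norm a < 1" and b: "norm b < 1"
  shows "norm b - norm a \<le> pseudo_dist a b * (1 - norm a * norm b)"
proof -
  define A B X where "A = norm a" and "B = norm b" and "X = (norm (1 - cnj a * b))\<^sup>2"
  have AB: "0 \<le> A" "A < 1" "0 \<le> B" "B < 1" using a b by (auto simp: A_def B_def)
  then have "A * B < 1 * 1" by (intro mult_strict_mono') auto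
  then have AB1: "0 < 1 - A * B" by simp
  have n1: "1 - A * B \<le> norm (1 - cnj a * b)"
    using norm_triangle_ineq2[of 1 "cnj a * b"] by (simp add: norm_mult A_def B_def)
  then have X: "(1 - A * B)\<^sup>2 \<le> X" "0 < X" unfolding X_def using AB1 by (auto intro!: power_mono)
  have sq: "(norm (a - b))\<^sup>2 = X - (1 - A\<^sup>2) * (1 - B\<^sup>2)"
    unfolding X_def A_def B_def cmod_power2 by (simp add: power2_eq_square algebra_simps)
  have "(1 - A\<^sup>2) * (1 - B\<^sup>2) / X \<le> (1 - A\<^sup>2) * (1 - B\<^sup>2) / (1 - A * B)\<^sup>2"
    using X AB AB1 by (intro divide_left_mono mult_nonneg_nonneg mult_pos_pos) (auto simp: power_le_one)
  moreover have "(pseudo_dist a b)\<^sup>2 = 1 - (1 - A\<^sup>2) * (1 - B\<^sup>2) / X"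
    using X(2) by (simp add: pseudo_dist_def power_divide sq X_def[symmetric] diff_divide_distrib)
  moreover have "((B - A) / (1 - A * B))\<^sup>2 = 1 - (1 - A\<^sup>2) * (1 - B\<^sup>2) / (1 - A * B)\<^sup>2"
  proof -
    have "(B - A)\<^sup>2 = (1 - A * B)\<^sup>2 - (1 - A\<^sup>2) * (1 - B\<^sup>2)" by (simp add: power2_eq_square algebra_simps)
    then show ?thesis unfolding power_divide using AB1 by (simp only:) (simp add: diff_divide_distrib)
  qed
  ultimately have "((B - A) / (1 - A * B))\<^sup>2 \<le> (pseudo_dist a b)\<^sup>2" by simp
  then have "(B - A) / (1 - A * B) \<le> pseudo_dist a b" by (rule power2_le_imp_le) (rule pseudo_dist_nonneg)
  then show ?thesis using AB1 by (simp add: A_def B_def pos_divide_le_eq)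
qed

lemma norm_le_of_pseudo_dist:
  assumes a: "norm a < 1" and b: "norm b < 1" and \<rho>: "pseudo_dist a b \<le> \<rho>"
  shows "norm b \<le> (norm a + \<rho>) / (1 + norm a * \<rho>)"
proof -
  have "norm a * norm b \<le> 1 * 1" using a b by (intro mult_mono) auto
  then have "pseudo_dist a b * (1 - norm a * norm b) \<le> \<rho> * (1 - norm a * norm b)"
    using \<rho> by (intro mult_right_mono) auto
  then have "norm b * (1 + norm a * \<rho>) \<le> norm a + \<rho>"
    using norm_diff_le_pseudo_dist[OF a b] by (simp add: algebra_simps)
  moreover have "0 \<le> \<rho>" using \<rho> pseudo_dist_nonneg[of a b] by linarith
  then have "0 < 1 + norm a * \<rho>" by (simp add: add_pos_nonneg)
  ultimately show ?thesis by (simp add: pos_le_divide_eq)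
qed

lemma poincare_dist_eq: "poincare_dist a b = artanh (pseudo_dist a b)"
  by (simp add: poincare_dist_def pseudo_dist_def norm_divide)

lemma artanh_nonneg: "0 \<le> x \<Longrightarrow> x < 1 \<Longrightarrow> 0 \<le> artanh (x :: real)"
  using artanh_le_iff[of 0 x] by simp

lemma poincare_dist_nonneg: "norm a < 1 \<Longrightarrow> norm b < 1 \<Longrightarrow> 0 \<le> poincare_dist a b"
  by (simp add: poincare_dist_eq artanh_nonneg pseudo_dist_nonneg pseudo_dist_less_1)

text \<open>
  The triangle inequality for the Poincare distance in the case where one of the points is the
  origin, which is all that telescoping along a chain requires.
\<close>

lemma artanh_norm_triangle:
  assumes a: "norm a < 1" and b: "norm b < 1" and \<rho>: "pseudo_dist a b \<le> \<rho>" "\<rho> < 1"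
  shows "artanh (norm b) \<le> artanh (norm a) + artanh \<rho>"
proof -
  have \<rho>0: "0 \<le> \<rho>" using \<rho> pseudo_dist_nonneg[of a b] by linarith
  have "tanh (artanh (norm a) + artanh \<rho>) = (norm a + \<rho>) / (1 + norm a * \<rho>)"
    using a \<rho> \<rho>0 by (subst tanh_add) (auto simp: tanh_artanh_real)
  then have "norm b \<le> tanh (artanh (norm a) + artanh \<rho>)"
    using norm_le_of_pseudo_dist[OF a b \<rho>(1)] by simp
  then have "tanh (artanh (norm b)) \<le> tanh (artanh (norm a) + artanh \<rho>)"
    using b by (simp add: tanh_artanh_real)
  then show ?thesis by simp
qed

definition chain_lengths :: "(complex ^ 'n) set \<Rightarrow> complex ^ 'n \<Rightarrow> complex ^ 'n \<Rightarrow> real set" where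
  "chain_lengths D z w = {\<Sum>j<N. poincare_dist (a j) (b j) | (N::nat) a b.
            \<exists>p \<phi>. p 0 = z \<and> p N = w \<and>
              (\<forall>j<N. a j \<in> unit_disc \<and> b j \<in> unit_disc \<and> holomorphic_disc (\<phi> j) D \<and>
                     \<phi> j (a j) = p j \<and> \<phi> j (b j) = p (Suc j))}"

lemma one_disc_chain:
  assumes "holomorphic_disc \<phi> D" "\<phi> 0 = q" "\<phi> \<sigma> = z" "norm \<sigma> < 1"
  shows "artanh (norm \<sigma>) \<in> chain_lengths D q z"
  unfolding chain_lengths_def
proof (rule CollectI, intro exI conjI)
  show "artanh (norm \<sigma>) = (\<Sum>j<1. poincare_dist ((\<lambda>_::nat. 0) j) ((\<lambda>_. \<sigma>) j))"
    by (simp add: poincare_dist_eq pseudo_dist_def)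
  show "(\<lambda>j::nat. if j = 0 then q else z) 0 = q" "(\<lambda>j::nat. if j = 0 then q else z) 1 = z" by auto
  show "\<forall>j<1. (\<lambda>_::nat. 0) j \<in> unit_disc \<and> (\<lambda>_. \<sigma>) j \<in> unit_disc \<and> holomorphic_disc ((\<lambda>_::nat. \<phi>) j) D \<and>
       (\<lambda>_::nat. \<phi>) j ((\<lambda>_. 0) j) = (\<lambda>j::nat. if j = 0 then q else z) j \<and>
       (\<lambda>_::nat. \<phi>) j ((\<lambda>_. \<sigma>) j) = (\<lambda>j::nat. if j = 0 then q else z) (Suc j)"
    using assms by auto
qed

lemma kobayashi_dist_chain: "kobayashi_dist D z w = Inf (chain_lengths D z w)"
  unfolding kobayashi_dist_def chain_lengths_def ..

text \<open>
  A function into the disc that vanishes at \<open>q\<close> shortens each link of a chain, by Schwarz-Pick.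
\<close>

lemma chain_length_ge:
  fixes D :: "(complex ^ 'n) set"
  assumes D: "open D" and G: "holomorphic_fun_on G D" "G ` D \<subseteq> ball 0 1" and q: "G q = 0" "q \<in> D"
    and s: "s \<in> chain_lengths D q z"
  shows "artanh (norm (G z)) \<le> s"
proof -
  obtain N a b p \<phi> where s': "s = (\<Sum>j<N. poincare_dist (a j) (b j))" and p: "p 0 = q" "p N = z"
    and ch: "\<And>j. j < N \<Longrightarrow> a j \<in> unit_disc \<and> b j \<in> unit_disc \<and> holomorphic_disc (\<phi> j) D \<and>
                     \<phi> j (a j) = p j \<and> \<phi> j (b j) = p (Suc j)"
    using s unfolding chain_lengths_def by blast
  have "k \<le> N \<Longrightarrow> p k \<in> D \<and> artanh (norm (G (p k))) \<le> (\<Sum>j<k. poincare_dist (a j) (b j))" for k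
  proof (induction k)
    case 0 then show ?case using p q by simp
  next
    case (Suc k)
    then have IH: "p k \<in> D" "artanh (norm (G (p k))) \<le> (\<Sum>j<k. poincare_dist (a j) (b j))" and k: "k < N" by auto
    note c = ch[OF k]
    have pS: "p (Suc k) \<in> D" using c unfolding holomorphic_disc_def by (metis imageI subsetD)
    have "(\<lambda>\<zeta>. G (\<phi> k \<zeta>)) holomorphic_on ball 0 1"
      by (rule compose_disc_holomorphic[OF G(1) D]) (use c in \<open>auto simp: holomorphic_disc_def\<close>)
    moreover have "norm (G (\<phi> k \<zeta>)) < 1" if "norm \<zeta> < 1" for \<zeta>
    proof -
      have "\<phi> k \<zeta> \<in> D" using c that unfolding holomorphic_disc_def by auto
      then show ?thesis using G(2) by auto
    qed
    ultimately have "pseudo_dist (G (p k)) (G (p (Suc k))) \<le> pseudo_dist (a k) (b k)"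
      using Schwarz_Pick[of "\<lambda>\<zeta>. G (\<phi> k \<zeta>)" "a k" "b k"] c by simp
    then have "artanh (norm (G (p (Suc k)))) \<le> artanh (norm (G (p k))) + poincare_dist (a k) (b k)"
      unfolding poincare_dist_eq using G(2) IH(1) pS c pseudo_dist_less_1
      by (intro artanh_norm_triangle) auto
    then show ?case using IH pS by simp
  qed
  from this[of N] show ?thesis using p s' by simp
qed

text \<open>
  The geodesic through the two points is a chain with a single link, and its left inverse bounds
  all chains from below.
\<close>

lemma kobayashi_dist_eq:
  fixes D :: "(complex ^ 'n) set"
  assumes D: "open D" "bounded D" "convex D" and q: "q \<in> D" and z: "z \<in> D"
  obtains \<phi> \<sigma> where "holomorphic_disc \<phi> D" "\<phi> 0 = q" "0 \<le> \<sigma>" "\<sigma> < 1" "\<phi> (of_real \<sigma>) = z"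
    "tanh (kobayashi_dist D q z) = \<sigma>"
proof -
  have "\<exists>\<phi> G \<sigma>. holomorphic_disc \<phi> D \<and> \<phi> 0 = q \<and> 0 \<le> \<sigma> \<and> \<sigma> < 1 \<and> \<phi> (complex_of_real \<sigma>) = z \<and>
     holomorphic_fun_on G D \<and> G ` D \<subseteq> ball 0 1 \<and> G q = 0 \<and> G z = of_real \<sigma>"
  proof (cases "q = z")
    case True
    have "holomorphic_disc (\<lambda>_. q) D" using q by (auto simp: holomorphic_disc_def)
    moreover have "holomorphic_fun_on (\<lambda>_ :: complex ^ 'n. 0) D"
      by (rule holomorphic_fun_onI) (auto intro!: exI[of _ 0])
    ultimately show ?thesis using True
      by (intro exI[of _ "\<lambda>_. q"] exI[of _ "\<lambda>_ :: complex ^ 'n. 0"] exI[of _ "0::real"]) auto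
  next
    case False
    obtain \<phi> G \<sigma> where g: "holomorphic_disc \<phi> D" "\<phi> 0 = q" "0 < \<sigma>" "\<sigma> < 1" "\<phi> (of_real \<sigma>) = z" "left_inverse D \<phi> G"
      using geodesic_through_two_points[OF D q z False] by metis
    have "\<forall>\<zeta>\<in>unit_disc. G (\<phi> \<zeta>) = \<zeta>" using g(6) by (simp add: left_inverse_def)
    then have "G q = 0" "G z = of_real \<sigma>" using g(2-5) by (metis centre_in_ball zero_less_one, auto)
    then show ?thesis using g unfolding left_inverse_def
      by (intro exI[of _ \<phi>] exI[of _ G] exI[of _ \<sigma>]) auto
  qed
  then obtain \<phi> G \<sigma> where \<phi>: "holomorphic_disc \<phi> D" "\<phi> 0 = q" "0 \<le> \<sigma>" "\<sigma> < 1" "\<phi> (complex_of_real \<sigma>) = z"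
    and G: "holomorphic_fun_on G D" "G ` D \<subseteq> ball 0 1" "G q = 0" "G z = of_real \<sigma>" by blast
  have mem: "artanh \<sigma> \<in> chain_lengths D q z"
    using one_disc_chain[OF \<phi>(1,2,5)] \<phi>(3,4) by simp
  have lower: "artanh \<sigma> \<le> s" if "s \<in> chain_lengths D q z" for s
    using chain_length_ge[OF D(1) G(1,2,3) q that] G(4) \<phi>(3) by simp
  have "kobayashi_dist D q z = Inf (chain_lengths D q z)" by (rule kobayashi_dist_chain)
  also have "\<dots> = artanh \<sigma>" using mem lower by (intro cInf_eq_minimum) auto
  finally have "tanh (kobayashi_dist D q z) = \<sigma>" using \<phi> by (simp add: tanh_artanh_real)
  then show thesis using that \<phi> by blast
qed

text \<open>
  Kobayashi balls are described by single discs from the centre, evaluated at arbitrary complex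
  parameters.
\<close>

lemma mem_kobayashi_ball_iff:
  fixes D :: "(complex ^ 'n) set"
  assumes D: "open D" "bounded D" "convex D" and q: "q \<in> D"
  shows "z \<in> kobayashi_ball D q R \<longleftrightarrow>
    (\<exists>\<phi> \<sigma>. holomorphic_disc \<phi> D \<and> \<phi> 0 = q \<and> norm \<sigma> < 1 \<and> norm \<sigma> < R \<and> \<phi> \<sigma> = z)" (is "_ \<longleftrightarrow> ?r")
proof
  assume "z \<in> kobayashi_ball D q R"
  then have z: "z \<in> D" "tanh (kobayashi_dist D q z) < R" by (auto simp: kobayashi_ball_def)
  obtain \<phi> \<sigma> where *: "holomorphic_disc \<phi> D" "\<phi> 0 = q" "0 \<le> \<sigma>" "\<sigma> < 1" "\<phi> (of_real \<sigma>) = z"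
    "tanh (kobayashi_dist D q z) = \<sigma>" using kobayashi_dist_eq[OF D q z(1)] by metis
  then show ?r using z by (intro exI[of _ \<phi>] exI[of _ "of_real \<sigma>"]) auto
next
  assume ?r
  then obtain \<phi> \<sigma> where \<phi>: "holomorphic_disc \<phi> D" "\<phi> 0 = q" "norm \<sigma> < 1" "norm \<sigma> < R" "\<phi> \<sigma> = z" by blast
  have z: "z \<in> D" using \<phi> by (auto simp: holomorphic_disc_def)
  obtain \<psi> \<tau> where \<psi>: "holomorphic_disc \<psi> D" "\<psi> 0 = q" "0 \<le> \<tau>" "\<tau> < 1" "\<psi> (of_real \<tau>) = z"
    "tanh (kobayashi_dist D q z) = \<tau>" using kobayashi_dist_eq[OF D q z] by metis
  have mem: "artanh (norm \<sigma>) \<in> chain_lengths D q z"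
    by (rule one_disc_chain[OF \<phi>(1,2,5,3)])
  have "0 \<le> s" if "s \<in> chain_lengths D q z" for s
    using that poincare_dist_nonneg unfolding chain_lengths_def by (auto intro!: sum_nonneg)
  then have "bdd_below (chain_lengths D q z)" by (rule bdd_belowI)
  then have "kobayashi_dist D q z \<le> artanh (norm \<sigma>)"
    unfolding kobayashi_dist_chain using mem by (intro cInf_lower)
  then have "tanh (kobayashi_dist D q z) \<le> tanh (artanh (norm \<sigma>))" by simp
  then have "tanh (kobayashi_dist D q z) < R" using \<phi> by (simp add: tanh_artanh_real)
  then show "z \<in> kobayashi_ball D q R" using z by (simp add: kobayashi_ball_def)
qed

lemma kobayashi_ball_function_less:
  fixes D :: "(complex ^ 'n) set"
  assumes D: "open D" "bounded D" "convex D" and q: "q \<in> D" and z: "z \<in> kobayashi_ball D q R"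
    and G: "holomorphic_fun_on G D" "G ` D \<subseteq> ball 0 1" "G q = 0"
  shows "norm (G z) < R"
proof -
  obtain \<phi> \<sigma> where \<phi>: "holomorphic_disc \<phi> D" "\<phi> 0 = q" "norm \<sigma> < 1" "norm \<sigma> < R" "\<phi> \<sigma> = z"
    using z mem_kobayashi_ball_iff[OF D q] by blast
  have "(\<lambda>\<zeta>. G (\<phi> \<zeta>)) holomorphic_on ball 0 1"
    by (rule compose_disc_holomorphic[OF G(1) D(1)]) (use \<phi> in \<open>auto simp: holomorphic_disc_def\<close>)
  moreover have "norm (G (\<phi> \<zeta>)) < 1" if "norm \<zeta> < 1" for \<zeta>
  proof -
    have "\<phi> \<zeta> \<in> D" using \<phi>(1) that unfolding holomorphic_disc_def by auto
    then show ?thesis using G(2) by auto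
  qed
  ultimately have "norm (G (\<phi> \<sigma>)) \<le> norm \<sigma>"
    using Schwarz_Lemma(1)[of "\<lambda>\<zeta>. G (\<phi> \<zeta>)" \<sigma>] \<phi> G(3) by simp
  then show ?thesis using \<phi> by simp
qed

text \<open>
  Points near \<open>z\<close> are reached by the disc through \<open>z\<close>, dilated so that its image is relatively
  compact and then tilted by a small linear term.
\<close>

lemma kobayashi_ball_open:
  fixes D :: "(complex ^ 'n) set"
  assumes D: "open D" "bounded D" "convex D" and q: "q \<in> D"
  shows "open (kobayashi_ball D q R)"
  unfolding open_contains_ball
proof
  fix z assume "z \<in> kobayashi_ball D q R"
  then obtain \<phi> \<sigma> where \<phi>: "holomorphic_disc \<phi> D" "\<phi> 0 = q" "norm \<sigma> < 1" "norm \<sigma> < R" "\<phi> \<sigma> = z"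
    using mem_kobayashi_ball_iff[OF D q] by blast
  \<comment> \<open>A parameter strictly between \<open>norm \<sigma>\<close> and both bounds leaves room for the dilation.\<close>
  define s where "s = (norm \<sigma> + min 1 R) / 2"
  have s: "norm \<sigma> < s" "s < 1" "s < R" using \<phi> by (auto simp: s_def min_def)
  have s0: "0 < s" using s(1) norm_ge_zero[of \<sigma>] by linarith
  define \<kappa> where "\<kappa> = \<sigma> / of_real s"
  have \<kappa>: "norm \<kappa> < 1" using s s0 by (simp add: \<kappa>_def norm_divide)
  have \<phi>hol: "(\<lambda>\<zeta>. \<phi> \<zeta> $ i) holomorphic_on ball 0 1" for i using \<phi>(1) by (simp add: holomorphic_disc_def)
  define K where "K = \<phi> ` cball 0 (norm \<kappa>)"
  have "compact K" unfolding K_def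
    using holomorphic_on_vec_imp_continuous_on[OF \<phi>hol] \<kappa>
    by (intro compact_continuous_image) (auto intro: continuous_on_subset)
  moreover have "K \<subseteq> D" using \<phi>(1) \<kappa> by (force simp: K_def holomorphic_disc_def)
  ultimately obtain e where e: "0 < e" "(\<Union>x\<in>K. ball x e) \<subseteq> D"
    using compact_subset_open_imp_ball_epsilon_subset[OF _ D(1)] by blast
  have "ball z (e * s) \<subseteq> kobayashi_ball D q R"
  proof
    fix y assume "y \<in> ball z (e * s)"
    then have y: "norm (y - z) < e * s" by (simp add: dist_norm norm_minus_commute)
    define \<psi> where "\<psi> \<zeta> = \<phi> (\<kappa> * \<zeta>) + \<zeta> *s ((1 / s) *\<^sub>R (y - z))" for \<zeta>
    have \<kappa>\<zeta>: "norm (\<kappa> * \<zeta>) \<le> norm \<kappa>" if "norm \<zeta> < 1" for \<zeta>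
      using mult_left_mono[of "norm \<zeta>" 1 "norm \<kappa>"] that by (simp add: norm_mult)
    have "holomorphic_disc \<psi> D" unfolding holomorphic_disc_def
    proof (intro conjI allI)
      fix i
      have "(\<lambda>\<zeta>. \<phi> (\<kappa> * \<zeta>) $ i) holomorphic_on ball 0 1"
      proof (rule holomorphic_on_compose_gen[OF _ \<phi>hol, of "\<lambda>\<zeta>. \<kappa> * \<zeta>" "ball 0 1" i, unfolded o_def])
        show "(\<lambda>\<zeta>. \<kappa> * \<zeta>) ` ball 0 1 \<subseteq> ball 0 1" using \<kappa>\<zeta> \<kappa> by (force simp: image_subset_iff)
      qed (intro holomorphic_intros)
      then show "(\<lambda>\<zeta>. \<psi> \<zeta> $ i) holomorphic_on ball 0 1"
        by (auto simp: \<psi>_def intro!: holomorphic_intros)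
      show "\<psi> ` ball 0 1 \<subseteq> D"
      proof (clarsimp)
        fix \<zeta> :: complex assume \<zeta>: "norm \<zeta> < 1"
        have "norm (\<psi> \<zeta> - \<phi> (\<kappa> * \<zeta>)) = norm \<zeta> * (norm (y - z) / s)"
          using s0 by (simp add: \<psi>_def norm_cmult_vec)
        also have "\<dots> \<le> 1 * (norm (y - z) / s)" using \<zeta> s0 by (intro mult_right_mono) auto
        also have "\<dots> < e" using y s0 by (simp add: divide_less_eq)
        finally have "\<psi> \<zeta> \<in> ball (\<phi> (\<kappa> * \<zeta>)) e" by (simp add: dist_norm norm_minus_commute)
        moreover have "\<phi> (\<kappa> * \<zeta>) \<in> K" using \<kappa>\<zeta>[OF \<zeta>] by (auto simp: K_def)
        ultimately show "\<psi> \<zeta> \<in> D" using e(2) by blast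
      qed
    qed
    moreover have "\<psi> 0 = q" by (simp add: \<psi>_def \<phi>)
    moreover have "\<psi> (of_real s) = y"
    proof -
      have "\<kappa> * of_real s = \<sigma>" using s0 by (simp add: \<kappa>_def)
      moreover have "of_real s *s ((1 / s) *\<^sub>R (y - z)) = y - z"
        using s0 by (simp add: vec_eq_iff) (simp add: scaleR_conv_of_real)
      ultimately show ?thesis by (simp add: \<psi>_def \<phi>)
    qed
    ultimately show "y \<in> kobayashi_ball D q R"
      using s s0 unfolding mem_kobayashi_ball_iff[OF D q]
      by (intro exI[of _ \<psi>] exI[of _ "of_real s"]) simp
  qed
  then show "\<exists>e>0. ball z e \<subseteq> kobayashi_ball D q R" using e(1) s0 by (intro exI[of _ "e * s"]) auto
qed

section \<open>Supporting hyperplanes of Kobayashi balls along a geodesic\<close>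

text \<open>
  One-sided differentiation at \<open>0\<close> of \<open>(norm (h t))^2 \<le> (m t)^2\<close>, with equality at \<open>0\<close>. The
  lemma turns Schwarz-type bounds along segments into bounds for the pairing of \<open>w\<close> with
  directions.
\<close>

lemma norm_growth_derivative:
  fixes h :: "real \<Rightarrow> complex"
  assumes h: "(h has_vector_derivative d) (at 0)" and m: "(m has_real_derivative m') (at 0)"
    and le: "\<And>t. 0 < t \<Longrightarrow> t \<le> 1 \<Longrightarrow> norm (h t) \<le> m t" and m0: "m 0 = norm (h 0)"
  shows "Re (cnj (h 0) * d) \<le> norm (h 0) * m'"
proof (rule ccontr)
  assume neg: "\<not> ?thesis"
  define k where "k t = (m t)\<^sup>2 - h t \<bullet> h t" for t
  have "((\<lambda>t. h t \<bullet> h t) has_derivative (\<lambda>s. h 0 \<bullet> (s *\<^sub>R d) + (s *\<^sub>R d) \<bullet> h 0)) (at 0)"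
    using h unfolding has_vector_derivative_def by (rule has_derivative_inner[OF _ h[unfolded has_vector_derivative_def]])
  then have "((\<lambda>t. h t \<bullet> h t) has_real_derivative 2 * (h 0 \<bullet> d)) (at 0)"
    unfolding has_field_derivative_def by (rule has_derivative_eq_rhs) (auto simp: inner_commute algebra_simps)
  moreover have "((\<lambda>t. (m t)\<^sup>2) has_real_derivative 2 * m 0 * m') (at 0)"
    by (rule DERIV_cong, rule DERIV_power[OF m]) simp
  ultimately have "(k has_real_derivative 2 * m 0 * m' - 2 * (h 0 \<bullet> d)) (at 0)"
    unfolding k_def by (rule DERIV_diff[rotated])
  moreover have "h 0 \<bullet> d = Re (cnj (h 0) * d)" by (simp add: inner_complex_def)
  then have "2 * m 0 * m' - 2 * (h 0 \<bullet> d) < 0" using neg m0 by simp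
  ultimately obtain e where e: "0 < e" "\<And>t. 0 < t \<Longrightarrow> t < e \<Longrightarrow> k (0 + t) < k 0"
    using DERIV_neg_dec_right by blast
  define t where "t = min (e / 2) 1"
  have t: "0 < t" "t < e" "t \<le> 1" using e by (auto simp: t_def min_def)
  have "k 0 = 0" by (simp add: k_def m0 power2_norm_eq_inner)
  then have "(m t)\<^sup>2 < (norm (h t))\<^sup>2" using e(2)[OF t(1,2)] by (simp add: k_def power2_norm_eq_inner)
  then show False using le[OF t(1,3)] power_mono[of "norm (h t)" "m t" 2] by simp
qed

lemma radial_approach:
  obtains \<kappa> :: "nat \<Rightarrow> complex" where "\<And>n. norm (\<kappa> n) < 1" "(\<lambda>n. \<kappa> n * \<zeta>) \<longlonglongrightarrow> \<zeta>"
proof -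
  define \<kappa> where "\<kappa> n = complex_of_real (1 - 1 / real (n + 2))" for n
  have "(\<lambda>n. 1 / real (n + 2)) \<longlonglongrightarrow> 0" using LIMSEQ_ignore_initial_segment[OF lim_1_over_n, of 2] by simp
  then have "(\<lambda>n. complex_of_real (1 - 1 / real (n + 2))) \<longlonglongrightarrow> complex_of_real (1 - 0)"
    by (intro tendsto_of_real tendsto_diff tendsto_const)
  then have "(\<lambda>n. \<kappa> n * \<zeta>) \<longlonglongrightarrow> \<zeta>" unfolding \<kappa>_def using tendsto_mult[OF _ tendsto_const[of \<zeta>]] by fastforce
  moreover have "norm (\<kappa> n) < 1" for n by (simp add: \<kappa>_def del: of_real_diff of_real_divide)
  ultimately show thesis using that by blast
qed

lemma parallel_of_same_hyperplane:
  fixes u v :: "'a :: real_inner"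
  assumes eq: "{y. u \<bullet> y = u \<bullet> x} = {y. v \<bullet> y = v \<bullet> x}" and u: "u \<noteq> 0"
  obtains k where "v = k *\<^sub>R u"
proof -
  define k where "k = (v \<bullet> u) / (u \<bullet> u)"
  define y where "y = v - k *\<^sub>R u"
  have uy: "u \<bullet> y = 0" using u by (simp add: y_def k_def inner_diff_right inner_commute)
  then have "x + y \<in> {y. u \<bullet> y = u \<bullet> x}" by (simp add: inner_add_right)
  then have "v \<bullet> y = 0" unfolding eq by (simp add: inner_add_right)
  moreover have "y \<bullet> y = v \<bullet> y - k * (u \<bullet> y)"
    by (subst (1) y_def) (simp add: inner_diff_left)
  ultimately have "y = 0" using uy by simp
  then show thesis using that[of k] by (simp add: y_def)
qed

context geodesic
begin

lemma real_line_deriv: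
  assumes K: "holomorphic_fun_on K D" and x: "x \<in> D"
  shows "((\<lambda>t. K (x + t *\<^sub>R v)) has_vector_derivative (v \<odot> cgrad K x)) (at 0)"
proof -
  have 1: "((\<lambda>t. x + t *\<^sub>R v) has_derivative (\<lambda>s. s *\<^sub>R v)) (at 0)"
    by (auto intro!: derivative_eq_intros)
  have 2: "(K has_derivative (\<lambda>v. v \<odot> cgrad K x)) (at (x + 0 *\<^sub>R v))"
    using has_derivative_cgrad[OF K D_open x] by simp
  show ?thesis unfolding has_vector_derivative_def
    using has_derivative_compose[OF 1 2] by (simp add: scalar_product_scaleR_left)
qed

text \<open>
  Scale the parameters of \<open>f\<close> and of a disc through \<open>z\<close> so that both points are reached at the
  parameter \<open>R = norm \<zeta>\<close>. Convexity provides the disc of convex combinations, and \<open>G\<close> along it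
  obeys the Schwarz lemma.
\<close>

lemma norm_on_segment:
  assumes \<zeta>: "norm \<zeta> < 1" and z: "z \<in> kobayashi_ball D (f 0) (norm \<zeta>)" and t: "0 \<le> t" "t \<le> 1"
  shows "norm (G (f \<zeta> + t *\<^sub>R (z - f \<zeta>))) \<le> norm \<zeta>"
proof -
  define R where "R = norm \<zeta>"
  have f0: "f 0 \<in> D" using f_in by simp
  obtain \<phi> \<sigma> where \<phi>: "holomorphic_disc \<phi> D" "\<phi> 0 = f 0" "norm \<sigma> < R" "\<phi> \<sigma> = z"
    using z mem_kobayashi_ball_iff[OF D_open D_bounded D_convex f0] unfolding R_def by blast
  have R: "0 < R" "R < 1" using \<phi>(3) \<zeta> norm_ge_zero[of \<sigma>] unfolding R_def by linarith+
  define a b where "a = \<zeta> / of_real R" and "b = \<sigma> / of_real R"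
  have ab: "norm a \<le> 1" "norm b \<le> 1" using \<phi>(3) R by (auto simp: a_def b_def norm_divide R_def)
  have scal: "norm (c * x) < 1" if "norm c \<le> 1" "norm x < 1" for c x :: complex
    using mult_right_mono[OF that(1), of "norm x"] that(2) by (simp add: norm_mult)
  have dil: "holomorphic_disc (\<lambda>x. \<psi> (c * x)) D" if \<psi>: "holomorphic_disc \<psi> D" and c: "norm c \<le> 1" for \<psi> c
    unfolding holomorphic_disc_def
  proof (intro conjI allI)
    show "(\<lambda>x. \<psi> (c * x) $ i) holomorphic_on ball 0 1" for i
    proof (rule holomorphic_on_compose_gen[of "\<lambda>x. c * x" "ball 0 1" "\<lambda>x. \<psi> x $ i" "ball 0 1", unfolded o_def])
      show "(\<lambda>x. \<psi> x $ i) holomorphic_on ball 0 1" using \<psi> by (simp add: holomorphic_disc_def)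
      show "(\<lambda>x. c * x) ` ball 0 1 \<subseteq> ball 0 1" using scal[OF c] by auto
    qed (intro holomorphic_intros)
    show "(\<lambda>x. \<psi> (c * x)) ` ball 0 1 \<subseteq> D" using \<psi> scal[OF c] by (auto simp: holomorphic_disc_def)
  qed
  define F where "F x = f (a * x) + t *\<^sub>R (\<phi> (b * x) - f (a * x))" for x
  have FD: "F x \<in> D" if "norm x < 1" for x
    unfolding F_def using dil[OF f_disc ab(1)] dil[OF \<phi>(1) ab(2)] that t
    by (intro convex_step) (auto simp: holomorphic_disc_def)
  have "(\<lambda>x. G (F x)) holomorphic_on ball 0 1"
  proof (rule compose_disc_holomorphic[OF G_hol D_open])
    have "(\<lambda>x. f (a * x) $ i) holomorphic_on ball 0 1" "(\<lambda>x. \<phi> (b * x) $ i) holomorphic_on ball 0 1" for i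
      using dil[OF f_disc ab(1)] dil[OF \<phi>(1) ab(2)] by (auto simp: holomorphic_disc_def)
    then show "(\<lambda>x. F x $ i) holomorphic_on ball 0 1" for i
      unfolding F_def vector_add_component vector_scaleR_component vector_minus_component scaleR_conv_of_real[where 'a = complex]
      by (intro holomorphic_intros)
  qed (use FD in auto)
  moreover have "G (F 0) = 0" using G_f[of 0] by (simp add: F_def \<phi>)
  ultimately have "norm (G (F (of_real R))) \<le> norm (complex_of_real R)"
    using Schwarz_Lemma(1)[of "\<lambda>x. G (F x)" "of_real R"] G_less[OF FD] R by simp
  moreover have "F (of_real R) = f \<zeta> + t *\<^sub>R (z - f \<zeta>)" using R \<phi>(4) by (simp add: F_def a_def b_def)
  ultimately show ?thesis using R by (simp add: R_def)
qed

lemma support_inequality: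
  assumes \<zeta>: "norm \<zeta> < 1" and z: "z \<in> kobayashi_ball D (f 0) (norm \<zeta>)"
  shows "Re (cnj \<zeta> * ((z - f \<zeta>) \<odot> w \<zeta>)) \<le> 0"
proof -
  have "Re (cnj (G (f \<zeta> + 0 *\<^sub>R (z - f \<zeta>))) * ((z - f \<zeta>) \<odot> w \<zeta>)) \<le> norm (G (f \<zeta> + 0 *\<^sub>R (z - f \<zeta>))) * 0"
    by (rule norm_growth_derivative[where m = "\<lambda>_. norm \<zeta>", OF real_line_deriv[OF G_hol f_in[OF \<zeta>]]])
       (use norm_on_segment[OF \<zeta> z] G_f[OF \<zeta>] in auto)
  then show ?thesis using G_f[OF \<zeta>] by simp
qed

text \<open>
  The real normal vector of the hyperplane that supports the Kobayashi ball at \<open>f \<zeta>\<close>.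
\<close>

definition normal :: "complex \<Rightarrow> complex ^ 'n" where
  "normal \<zeta> = cnj_vec (cnj \<zeta> *s w \<zeta>)"

lemma inner_normal: "normal \<zeta> \<bullet> v = Re (cnj \<zeta> * (v \<odot> w \<zeta>))"
  by (simp add: normal_def inner_cnj_vec scalar_product_cmult_right)

lemma normal_nonzero: "norm \<zeta> < 1 \<Longrightarrow> \<zeta> \<noteq> 0 \<Longrightarrow> normal \<zeta> \<noteq> 0"
  using w_nonzero by (simp add: normal_def vector_mul_eq_0)

lemma normal_supports:
  assumes "norm \<zeta> < 1" "\<zeta> \<noteq> 0"
  shows "supporting_hyperplane (kobayashi_ball D (f 0) (norm \<zeta>)) (f \<zeta>) {y. normal \<zeta> \<bullet> y = normal \<zeta> \<bullet> f \<zeta>}"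
  unfolding supporting_hyperplane_def
  using normal_nonzero[OF assms] support_inequality[OF assms(1)]
  by (intro exI[of _ "normal \<zeta>"]) (auto simp: inner_normal scalar_product_diff_left algebra_simps)

text \<open>
  The left inverse keeps \<open>f \<zeta>\<close> out of the open ball, and the points \<open>f (s \<zeta>)\<close> with \<open>s < 1\<close>
  approach it from inside.
\<close>

lemma geodesic_point_in_frontier:
  assumes \<zeta>: "norm \<zeta> < 1" "\<zeta> \<noteq> 0"
  shows "f \<zeta> \<in> frontier (kobayashi_ball D (f 0) (norm \<zeta>))"
proof -
  let ?B = "kobayashi_ball D (f 0) (norm \<zeta>)"
  have f0: "f 0 \<in> D" using f_in by simp
  have op: "open ?B" by (rule kobayashi_ball_open[OF D_open D_bounded D_convex f0])
  have out: "f \<zeta> \<notin> ?B"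
    using kobayashi_ball_function_less[OF D_open D_bounded D_convex f0 _ G_hol, of "f \<zeta>" "norm \<zeta>"]
      G_left G_f[OF \<zeta>(1)] G_f[of 0] by (auto simp: left_inverse_def)
  obtain s :: "nat \<Rightarrow> complex" where ns: "\<And>n. norm (s n) < 1" and s: "(\<lambda>n. s n * \<zeta>) \<longlonglongrightarrow> \<zeta>"
    using radial_approach by blast
  have "f \<zeta> \<in> closure ?B"
  proof (rule Lim_in_closed_set[OF closed_closure _ sequentially_bot])
    show "(\<lambda>n. f (s n * \<zeta>)) \<longlonglongrightarrow> f \<zeta>" by (rule isCont_tendsto_compose[OF f_isCont[OF \<zeta>(1)] s])
    have "f (s n * \<zeta>) \<in> ?B" for n
    proof -
      have "norm (s n * \<zeta>) < norm \<zeta>" using mult_strict_right_mono[OF ns[of n], of "norm \<zeta>"] \<zeta> by (simp add: norm_mult)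
      then show ?thesis unfolding mem_kobayashi_ball_iff[OF D_open D_bounded D_convex f0]
        using f_disc \<zeta> by (intro exI[of _ f] exI[of _ "s n * \<zeta>"]) auto
    qed
    then show "eventually (\<lambda>n. f (s n * \<zeta>) \<in> closure ?B) sequentially"
      using closure_subset by (intro always_eventually) blast
  qed
  then show ?thesis using out op by (simp add: frontier_def interior_open)
qed

text \<open>
  Both gradients give supports at \<open>f \<zeta>\<close>, so they are real multiples of each other, and both pair
  to one with the derivative of \<open>f\<close>.
\<close>

lemma unique_normal_imp_same_cgrad:
  assumes L: "left_inverse D f L" and \<zeta>: "norm \<zeta> < 1" "\<zeta> \<noteq> 0"
    and un: "unique_supporting_hyperplanes (kobayashi_ball D (f 0) (norm \<zeta>))"
  shows "cgrad L (f \<zeta>) = w \<zeta>"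
proof -
  interpret L: geodesic D f L using D_open D_bounded D_convex f_disc L by unfold_locales
  have "{y. normal \<zeta> \<bullet> y = normal \<zeta> \<bullet> f \<zeta>} = {y. L.normal \<zeta> \<bullet> y = L.normal \<zeta> \<bullet> f \<zeta>}"
    using un geodesic_point_in_frontier[OF \<zeta>] normal_supports[OF \<zeta>] L.normal_supports[OF \<zeta>]
    unfolding unique_supporting_hyperplanes_def by blast
  then obtain k where "L.normal \<zeta> = k *\<^sub>R normal \<zeta>"
    using parallel_of_same_hyperplane normal_nonzero[OF \<zeta>] by blast
  then have "cnj_vec (L.normal \<zeta>) = cnj_vec (k *\<^sub>R normal \<zeta>)" by simp
  also have "\<dots> = k *\<^sub>R cnj_vec (normal \<zeta>)" by (simp add: cnj_vec_def vec_eq_iff)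
  finally have "cnj \<zeta> *s cgrad L (f \<zeta>) = k *\<^sub>R (cnj \<zeta> *s w \<zeta>)" by (simp add: normal_def L.normal_def)
  then have kk: "cgrad L (f \<zeta>) = k *\<^sub>R w \<zeta>" using \<zeta>(2)
    by (simp add: vec_eq_iff scaleR_conv_of_real[where 'a = complex] mult.left_commute[of "of_real k"])
  then have "vec_deriv f \<zeta> \<odot> cgrad L (f \<zeta>) = k *\<^sub>R (vec_deriv f \<zeta> \<odot> w \<zeta>)" by (simp add: scalar_product_scaleR_right)
  then have "k = 1" using left_inverse_deriv[OF L \<zeta>(1)] left_inverse_deriv[OF G_left \<zeta>(1)]
    by (simp add: scaleR_conv_of_real)
  then show ?thesis using kk by simp
qed

text \<open>
  There is no Kobayashi ball of radius zero, so the gradients are compared away from \<open>\<zeta> = 0\<close>.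
  This suffices: when one of the two values is nonzero, it is a zero of both equations, and
  otherwise both values are \<open>0\<close>.
\<close>

lemma unique_lempert_left_inverse:
  assumes un: "\<And>R. 0 < R \<Longrightarrow> R < 1 \<Longrightarrow> unique_supporting_hyperplanes (kobayashi_ball D (f 0) R)"
    and L: "lempert_left_inverse D f L" and z: "z \<in> D"
  shows "L z = H z"
proof -
  have Ll: "left_inverse D f L" using L by (simp add: lempert_left_inverse_def)
  interpret L: geodesic D f L using D_open D_bounded D_convex f_disc Ll by unfold_locales
  have same: "cgrad L (f \<zeta>) = w \<zeta>" if "norm \<zeta> < 1" "\<zeta> \<noteq> 0" for \<zeta>
    using unique_normal_imp_same_cgrad[OF Ll that un] that by simp
  have LH: "L.H z = L z" by (rule L.lempert_eq_H[OF L z])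
  show ?thesis
  proof (cases "L z = 0 \<and> H z = 0")
    case False
    show ?thesis
    proof (cases "L z = 0")
      case True
      then have "H z \<noteq> 0" using False by simp
      then have "L.H z = H z" using H_zero[OF z] H_in[OF z] same by (intro L.H_eqI[OF z]) auto
      then show ?thesis using LH by simp
    next
      case nz: False
      have "(z - f (L z)) \<odot> w (L z) = 0"
        using L.H_zero[OF z] same[OF L.G_less[OF z] nz] by (simp add: LH)
      then show ?thesis using H_eqI[OF z L.G_less[OF z]] by simp
    qed
  qed simp
qed

end

section \<open>Interior balls of strongly convex domains\<close>

text \<open>
  A vector that is nonpositive on an open half space is a nonpositive multiple of its normal;
  tested on the tangential part of \<open>a\<close>, tilted into the half space by a small \<open>\<epsilon>\<close>.
\<close>

lemma vector_eq_neg_normal: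
  fixes a n :: "'a :: real_inner"
  assumes n: "norm n = 1" and h: "\<And>v. 0 < v \<bullet> n \<Longrightarrow> a \<bullet> v \<le> 0"
  shows "a = - norm a *\<^sub>R n"
proof -
  have nn: "n \<bullet> n = 1" using n by (simp add: norm_eq_1)
  have an: "a \<bullet> n \<le> 0" using h[of n] nn by simp
  have "a \<bullet> a \<le> (a \<bullet> n)\<^sup>2"
  proof (rule field_le_epsilon)
    fix e :: real assume e: "0 < e"
    define \<epsilon> where "\<epsilon> = e / (\<bar>a \<bullet> n\<bar> + 1)"
    have \<epsilon>: "0 < \<epsilon>" "\<epsilon> * \<bar>a \<bullet> n\<bar> \<le> e"
      using e by (auto simp: \<epsilon>_def divide_le_eq mult_left_mono add_nonneg_pos)
    define v where "v = a - (a \<bullet> n) *\<^sub>R n + \<epsilon> *\<^sub>R n"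
    have "v \<bullet> n = \<epsilon>" by (simp add: v_def inner_left_distrib inner_diff_left nn)
    then have "a \<bullet> v \<le> 0" using h \<epsilon> by simp
    moreover have "a \<bullet> v = a \<bullet> a - (a \<bullet> n)\<^sup>2 + \<epsilon> * (a \<bullet> n)"
      by (simp add: v_def inner_right_distrib inner_diff_right power2_eq_square)
    moreover have "- e \<le> \<epsilon> * (a \<bullet> n)" using \<epsilon> an by simp
    ultimately show "a \<bullet> a \<le> (a \<bullet> n)\<^sup>2 + e" by simp
  qed
  then have "(norm a)\<^sup>2 \<le> (- (a \<bullet> n))\<^sup>2" by (simp add: power2_norm_eq_inner)
  then have le: "norm a \<le> - (a \<bullet> n)" by (rule power2_le_imp_le) (use an in simp)
  have aa: "a \<bullet> a = norm a * norm a" by (simp add: dot_square_norm power2_eq_square)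
  have "(norm (a + norm a *\<^sub>R n))\<^sup>2 = 2 * norm a * (norm a + a \<bullet> n)"
    unfolding power2_norm_eq_inner
    by (simp add: inner_left_distrib inner_right_distrib nn inner_commute[of n a] aa algebra_simps)
  also have "\<dots> \<le> 0" using le by (intro mult_nonneg_nonpos) auto
  finally have "a + norm a *\<^sub>R n = 0" by simp
  then show ?thesis by (simp add: eq_neg_iff_add_eq_0)
qed

lemma ball_touching_frontier_subset:
  fixes D :: "'a :: euclidean_space set"
  assumes "open D" "y \<in> D" "b \<in> frontier D" "\<And>x. x \<in> frontier D \<Longrightarrow> dist y b \<le> dist y x"
  shows "ball y (dist y b) \<subseteq> D"
proof (rule ccontr)
  assume "\<not> ball y (dist y b) \<subseteq> D"
  moreover have "b \<notin> D" using assms by (auto simp: frontier_def interior_open)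
  then have "0 < dist y b" using assms(2) by auto
  then have "y \<in> ball y (dist y b) \<inter> D" using assms(2) by simp
  then have "ball y (dist y b) \<inter> D \<noteq> {}" by blast
  ultimately have "ball y (dist y b) \<inter> frontier D \<noteq> {}"
    using connected_Int_frontier[of "ball y (dist y b)" D] by blast
  then show False using assms(4) by fastforce
qed

text \<open>
  The uniform interior ball condition in a form that speaks of points of \<open>D\<close>: every ball of
  radius at most \<open>\<rho>\<close> inside \<open>D\<close> is contained in a ball of radius \<open>\<rho>\<close> inside \<open>D\<close>.
\<close>

definition interior_balls :: "'a :: metric_space set \<Rightarrow> real \<Rightarrow> bool" where
  "interior_balls D \<rho> \<longleftrightarrow> 0 < \<rho> \<and>
     (\<forall>y\<in>D. \<forall>s. 0 < s \<and> s \<le> \<rho> \<and> ball y s \<subseteq> D \<longrightarrow> (\<exists>c. ball c \<rho> \<subseteq> D \<and> dist y c \<le> \<rho> - s))"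

text \<open>
  The inner ball touching the boundary at the point \<open>b\<close> nearest to \<open>y\<close> shows that the gradient
  of the defining function at \<open>b\<close> is normal to it. A common bound for the Hessian near the
  compact boundary and a lower bound for the gradient on it make the defining function negative
  on the tangent ball of a fixed radius \<open>\<rho>\<close> at \<open>b\<close>, and this ball contains the given one.
\<close>

lemma strongly_convex_interior_balls:
  fixes D :: "'a :: euclidean_space set"
  assumes sc: "strongly_convex D" and D: "open D" "D \<noteq> {}"
  obtains \<rho> where "interior_balls D \<rho>"
proof -
  obtain U and r :: "'a \<Rightarrow> real" and g :: "'a \<Rightarrow> 'a" and h :: "'a \<Rightarrow> 'a \<Rightarrow>\<^sub>L 'a" where
    *: "open U \<and> D \<inter> U = {x \<in> U. r x < 0} \<and> frontier D = {x \<in> U. r x = 0} \<and>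
        (\<forall>x\<in>U. (r has_derivative (\<lambda>v. g x \<bullet> v)) (at x)) \<and>
        (\<forall>x\<in>U. (g has_derivative blinfun_apply (h x)) (at x)) \<and>
        continuous_on U h \<and>
        (\<forall>x\<in>frontier D. g x \<noteq> 0 \<and>
           (\<forall>v. v \<noteq> 0 \<and> g x \<bullet> v = 0 \<longrightarrow> blinfun_apply (h x) v \<bullet> v > 0))"
    using sc unfolding strongly_convex_def by (elim conjE exE) (rule that, intro conjI)
  have U: "open U" "D \<inter> U = {x \<in> U. r x < 0}" "frontier D = {x \<in> U. r x = 0}"
    and r: "\<And>x. x \<in> U \<Longrightarrow> (r has_derivative (\<lambda>v. g x \<bullet> v)) (at x)"
    and g: "\<And>x. x \<in> U \<Longrightarrow> (g has_derivative blinfun_apply (h x)) (at x)"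
    and h: "continuous_on U h" using * by blast+
  have nz: "\<And>x. x \<in> frontier D \<Longrightarrow> g x \<noteq> 0" using * by blast
  have bd: "bounded D" using sc by (simp add: strongly_convex_def)
  have fr: "compact (frontier D)" using bd by (simp add: compact_frontier_bounded)
  have frU: "frontier D \<subseteq> U" using U(3) by auto
  have frn: "frontier D \<noteq> {}"
    using frontier_eq_empty[of D] bd D(2) not_bounded_UNIV by auto
  obtain e where e: "0 < e" "(\<Union>x\<in>frontier D. cball x e) \<subseteq> U"
    using compact_subset_open_imp_cball_epsilon_subset[OF fr U(1) frU] by blast
  define K where "K = {x + y | x y. x \<in> frontier D \<and> y \<in> cball 0 e}"
  have "compact K" unfolding K_def by (rule compact_sums[OF fr compact_cball])
  have KU: "K \<subseteq> U"
  proof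
    fix k assume "k \<in> K"
    then obtain x y where "x \<in> frontier D" "norm y \<le> e" "k = x + y" by (auto simp: K_def)
    then have "k \<in> cball x e" "x \<in> frontier D" by (auto simp: dist_norm)
    then show "k \<in> U" using e(2) by blast
  qed
  have "compact (h ` K)" using \<open>compact K\<close> KU h by (meson compact_continuous_image continuous_on_subset)
  then obtain M where M: "0 < M" "\<And>x. x \<in> K \<Longrightarrow> norm (h x) \<le> M"
    using compact_imp_bounded bounded_pos by (metis imageI)
  have gc: "continuous_on (frontier D) (\<lambda>x. norm (g x))"
    using g frU by (intro continuous_on_norm continuous_at_imp_continuous_on ballI) (blast intro: has_derivative_continuous)
  obtain x0 where x0: "x0 \<in> frontier D" "\<And>x. x \<in> frontier D \<Longrightarrow> norm (g x0) \<le> norm (g x)"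
    using continuous_attains_inf[OF fr frn gc] by blast
  define m where "m = norm (g x0)"
  have m: "0 < m" "\<And>x. x \<in> frontier D \<Longrightarrow> m \<le> norm (g x)" using nz[OF x0(1)] x0(2) by (auto simp: m_def)
  \<comment> \<open>The tangent ball at a boundary point has diameter at most \<open>e\<close>, so it lies in \<open>K\<close>, and the
    first order decrease \<open>m * (v \<bullet> n)\<close> dominates the second order term \<open>M * (norm v)^2\<close>.\<close>
  define \<rho> where "\<rho> = min (e / 2) (m / (2 * M))"
  have \<rho>: "0 < \<rho>" "2 * \<rho> \<le> e" "2 * \<rho> * M \<le> m"
    using e m M by (auto simp: \<rho>_def min_def field_simps)
  have tangent: "ball (b + \<rho> *\<^sub>R n) \<rho> \<subseteq> D"
    if b: "b \<in> frontier D" and d: "0 < d" and n: "norm n = 1" and bl: "ball (b + d *\<^sub>R n) d \<subseteq> D" for b n d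
  proof -
    have bU: "b \<in> U" and rb: "r b = 0" using b U(3) by auto
    have "g b \<bullet> v \<le> 0" if v: "0 < v \<bullet> n" for v
    proof (rule ccontr)
      assume "\<not> g b \<bullet> v \<le> 0"
      have 1: "((\<lambda>t. b + t *\<^sub>R v) has_derivative (\<lambda>s. s *\<^sub>R v)) (at 0)" by (auto intro!: derivative_eq_intros)
      have 2: "(r has_derivative (\<lambda>v. g b \<bullet> v)) (at (b + 0 *\<^sub>R v))" using r[OF bU] by simp
      have "((\<lambda>t. r (b + t *\<^sub>R v)) has_derivative (\<lambda>s. g b \<bullet> (s *\<^sub>R v))) (at 0)"
        by (rule has_derivative_compose[OF 1 2])
      then have "((\<lambda>t. r (b + t *\<^sub>R v)) has_real_derivative g b \<bullet> v) (at 0)"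
        unfolding has_field_derivative_def by (rule has_derivative_eq_rhs) (auto simp: mult.commute)
      then obtain e1 where e1: "0 < e1" "\<And>t. 0 < t \<Longrightarrow> t < e1 \<Longrightarrow> r (b + 0 *\<^sub>R v) < r (b + (0 + t) *\<^sub>R v)"
        using DERIV_pos_inc_right \<open>\<not> g b \<bullet> v \<le> 0\<close> by (metis not_le)
      have "open {t. b + t *\<^sub>R v \<in> U}"
        using open_vimage[OF U(1), of "\<lambda>t. b + t *\<^sub>R v"] by (simp add: vimage_def continuous_intros)
      then obtain e2 where e2: "0 < e2" "ball 0 e2 \<subseteq> {t. b + t *\<^sub>R v \<in> U}"
        using bU open_contains_ball by (metis (no_types, lifting) add.right_neutral mem_Collect_eq scaleR_zero_left)
      define t where "t = min (min e1 e2 / 2) (d * (v \<bullet> n) / (norm v)\<^sup>2)"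
      have "v \<noteq> 0" using v by auto
      have t12: "t \<le> min e1 e2 / 2" "t \<le> d * (v \<bullet> n) / (norm v)\<^sup>2"
        unfolding t_def by (rule min.cobounded1, rule min.cobounded2)
      have "0 < t" using e1(1) e2(1) d v \<open>v \<noteq> 0\<close> by (simp add: t_def)
      moreover have "t < e1" "t < e2" using t12(1) e1(1) e2(1) by (auto simp: min_def split: if_splits)
      moreover have "t * (norm v)\<^sup>2 \<le> d * (v \<bullet> n)" using t12(2) \<open>v \<noteq> 0\<close> by (simp add: pos_le_divide_eq)
      ultimately have t: "0 < t" "t < e1" "t < e2" "t * (norm v)\<^sup>2 \<le> d * (v \<bullet> n)" by auto
      have "(norm (t *\<^sub>R v - d *\<^sub>R n))\<^sup>2 = t * (t * (norm v)\<^sup>2) - 2 * t * (d * (v \<bullet> n)) + d\<^sup>2"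
        unfolding power2_norm_eq_inner using n
        by (simp add: inner_diff_left inner_diff_right inner_commute norm_eq_1 power2_eq_square algebra_simps)
      also have "\<dots> \<le> t * (d * (v \<bullet> n)) - 2 * t * (d * (v \<bullet> n)) + d\<^sup>2"
        using t by (intro add_right_mono diff_right_mono mult_left_mono) auto
      also have "\<dots> = d\<^sup>2 - t * (d * (v \<bullet> n))" by (simp add: algebra_simps)
      also have "\<dots> < d\<^sup>2" using t(1) d v by simp
      finally have "norm (t *\<^sub>R v - d *\<^sub>R n) < d" using d by (metis less_imp_le power_less_imp_less_base)
      moreover have "dist (b + d *\<^sub>R n) (b + t *\<^sub>R v) = norm (t *\<^sub>R v - d *\<^sub>R n)"
        by (simp add: dist_norm norm_minus_commute)
      ultimately have "b + t *\<^sub>R v \<in> D" using bl by (metis mem_ball subsetD)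
      moreover have "b + t *\<^sub>R v \<in> U" using e2(2) t by (auto simp: subset_iff)
      ultimately have "r (b + t *\<^sub>R v) < 0" using U(2) by blast
      then show False using e1(2)[OF t(1,2)] rb by simp
    qed
    then have gb: "g b = - norm (g b) *\<^sub>R n" by (rule vector_eq_neg_normal[OF n])
    show ?thesis
    proof
      fix y assume y: "y \<in> ball (b + \<rho> *\<^sub>R n) \<rho>"
      define v where "v = y - b"
      have "norm (v - \<rho> *\<^sub>R n) < \<rho>" using y by (simp add: v_def dist_norm norm_minus_commute algebra_simps)
      then have "(norm (v - \<rho> *\<^sub>R n))\<^sup>2 < \<rho>\<^sup>2" by (intro power_strict_mono) auto
      moreover have "(norm (v - \<rho> *\<^sub>R n))\<^sup>2 = (norm v)\<^sup>2 - 2 * \<rho> * (v \<bullet> n) + \<rho>\<^sup>2"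
        unfolding power2_norm_eq_inner using n
        by (simp add: inner_diff_left inner_diff_right inner_commute norm_eq_1 power2_eq_square algebra_simps)
      ultimately have vn: "(norm v)\<^sup>2 < 2 * \<rho> * (v \<bullet> n)" by simp
      have "norm v \<le> norm (v - \<rho> *\<^sub>R n) + norm (\<rho> *\<^sub>R n)" by (rule order_trans[OF _ norm_triangle_ineq]) simp
      then have nv: "norm v \<le> e" using \<open>norm (v - \<rho> *\<^sub>R n) < \<rho>\<close> n \<rho> by simp
      have seg: "b + t *\<^sub>R v \<in> K" if "0 \<le> t" "t \<le> 1" for t
      proof -
        have "t * norm v \<le> 1 * e" using that nv by (intro mult_mono) auto
        then show ?thesis using b that unfolding K_def
          by (intro CollectI exI[of _ b] exI[of _ "t *\<^sub>R v"]) simp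
      qed
      have "\<exists>x\<in>{0<..<1}. r (b + 1 *\<^sub>R v) - r (b + 0 *\<^sub>R v) = (\<lambda>s. g (b + x *\<^sub>R v) \<bullet> (s *\<^sub>R v)) (1 - 0)"
      proof (rule mvt)
        have dr: "((\<lambda>t. r (b + t *\<^sub>R v)) has_derivative (\<lambda>s. g (b + t *\<^sub>R v) \<bullet> (s *\<^sub>R v))) (at t)" if "0 \<le> t" "t \<le> 1" for t
        proof -
          have "((\<lambda>t. b + t *\<^sub>R v) has_derivative (\<lambda>s. s *\<^sub>R v)) (at t)" by (auto intro!: derivative_eq_intros)
          from has_derivative_compose[OF this r] show ?thesis using seg[OF that] KU by blast
        qed
        show "continuous_on {0..1} (\<lambda>t. r (b + t *\<^sub>R v))"
          using dr by (intro continuous_at_imp_continuous_on ballI) (auto intro: has_derivative_continuous)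
        show "((\<lambda>t. r (b + t *\<^sub>R v)) has_derivative (\<lambda>s. g (b + t *\<^sub>R v) \<bullet> (s *\<^sub>R v))) (at t)" if "0 < t" "t < 1" for t
          using dr that by simp
      qed (auto intro!: bexI)
      then obtain x where x: "0 < x" "x < 1" "r y = g (b + x *\<^sub>R v) \<bullet> v" using rb by (auto simp: v_def)
      have "norm (g (b + x *\<^sub>R v) - g b) \<le> M * norm (b + x *\<^sub>R v - b)"
      proof (rule differentiable_bound[where S = "(\<lambda>t. b + t *\<^sub>R v) ` {0..1}" and f' = "\<lambda>y. blinfun_apply (h y)"])
        have "(\<lambda>t. b + t *\<^sub>R v) ` {0..1} = (+) b ` ((\<lambda>t. t *\<^sub>R v) ` {0..1})" by (simp add: image_image)
        then show "convex ((\<lambda>t. b + t *\<^sub>R v) ` {0..1})"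
          by (metis convex_real_interval(5) convex_translation convex_linear_image linear_scaleR_left)
        fix z assume "z \<in> (\<lambda>t. b + t *\<^sub>R v) ` {0..1}"
        then have z: "z \<in> K" using seg by auto
        then show "(g has_derivative blinfun_apply (h z)) (at z within (\<lambda>t. b + t *\<^sub>R v) ` {0..1})"
          using g KU has_derivative_at_withinI by blast
        show "onorm (blinfun_apply (h z)) \<le> M" using M(2)[OF z] by (simp add: norm_blinfun.rep_eq)
      qed (use x in \<open>auto intro: image_eqI[of _ _ 0] image_eqI[of _ _ x]\<close>)
      then have "norm (g (b + x *\<^sub>R v) - g b) \<le> M * (x * norm v)" using x by simp
      also have "\<dots> \<le> M * (1 * norm v)" using x M by (intro mult_left_mono mult_right_mono) auto
      finally have "norm (g (b + x *\<^sub>R v) - g b) * norm v \<le> M * norm v * norm v" by (simp add: mult_right_mono)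
      moreover have "(g (b + x *\<^sub>R v) - g b) \<bullet> v \<le> norm (g (b + x *\<^sub>R v) - g b) * norm v"
        by (rule norm_cauchy_schwarz)
      ultimately have "(g (b + x *\<^sub>R v) - g b) \<bullet> v \<le> M * (norm v)\<^sup>2" by (simp add: power2_eq_square)
      moreover have "g b \<bullet> v = - norm (g b) * (v \<bullet> n)" by (subst gb) (simp add: inner_commute)
      moreover have "0 < v \<bullet> n" using vn \<rho>(1) zero_le_power2[of "norm v"] by (metis le_less_trans mult_pos_pos zero_less_mult_pos zero_less_numeral)
      moreover have "m * (v \<bullet> n) \<le> norm (g b) * (v \<bullet> n)" using m(2)[OF b] \<open>0 < v \<bullet> n\<close> by (intro mult_right_mono) auto
      moreover have "M * (2 * \<rho> * (v \<bullet> n)) \<le> m * (v \<bullet> n)"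
        using mult_right_mono[OF \<rho>(3), of "v \<bullet> n"] \<open>0 < v \<bullet> n\<close> by (simp add: mult_ac)
      moreover have "M * (norm v)\<^sup>2 < M * (2 * \<rho> * (v \<bullet> n))" using vn M(1) by (intro mult_strict_left_mono)
      ultimately have "r y < 0" unfolding x(3) inner_diff_left by linarith
      moreover have "y \<in> K" using seg[of 1] by (simp add: v_def)
      ultimately show "y \<in> D" using KU U(2) by blast
    qed
  qed
  have "\<exists>c. ball c \<rho> \<subseteq> D \<and> dist y c \<le> \<rho> - s" if y: "y \<in> D" and s: "0 < s" "s \<le> \<rho>" "ball y s \<subseteq> D" for y s
  proof (cases "ball y \<rho> \<subseteq> D")
    case True then show ?thesis using s by (intro exI[of _ y]) auto
  next
    case False
    obtain b where b: "b \<in> frontier D" "\<And>x. x \<in> frontier D \<Longrightarrow> dist y b \<le> dist y x"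
      using distance_attains_inf[of "frontier D" y] frn by (auto simp: dist_commute)
    define d where "d = dist y b"
    have bD: "b \<notin> D" using b D by (auto simp: frontier_def interior_open)
    have d: "0 < d" using bD y by (auto simp: d_def)
    have bl: "ball y d \<subseteq> D" unfolding d_def by (rule ball_touching_frontier_subset[OF D(1) y b])
    have "d < \<rho>" using False bl by (metis not_le order_trans subset_ball)
    have "s \<le> d"
    proof (rule ccontr)
      assume "\<not> s \<le> d"
      then have "b \<in> ball y s" by (simp add: d_def)
      then show False using s(3) bD by blast
    qed
    define n where "n = (1 / d) *\<^sub>R (y - b)"
    have n: "norm n = 1" using d by (simp add: n_def d_def dist_norm)
    have yb: "y = b + d *\<^sub>R n" using d by (simp add: n_def)
    have "ball (b + \<rho> *\<^sub>R n) \<rho> \<subseteq> D" using tangent[OF b(1) d n] bl yb by simp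
    moreover have "dist y (b + \<rho> *\<^sub>R n) \<le> \<rho> - s"
    proof -
      have "y - (b + \<rho> *\<^sub>R n) = (d - \<rho>) *\<^sub>R n" by (subst yb) (simp add: algebra_simps)
      then have "dist y (b + \<rho> *\<^sub>R n) = \<bar>d - \<rho>\<bar>" using n by (simp add: dist_norm)
      then show ?thesis using \<open>d < \<rho>\<close> \<open>s \<le> d\<close> by simp
    qed
    ultimately show ?thesis by blast
  qed
  then show thesis using that[of \<rho>] \<rho>(1) by (auto simp: interior_balls_def)
qed

section \<open>Boundary behaviour of a geodesic and its left inverse\<close>

text \<open>
  The lower Harnack inequality, from the Schwarz lemma for the Cayley transform of \<open>F\<close>. It
  measures how fast a disc in a convex domain can approach a supporting hyperplane.
\<close>

lemma Harnack_disc: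
  assumes F: "F holomorphic_on ball 0 1" and pos: "\<And>z. norm z < 1 \<Longrightarrow> 0 < Re (F z)" and l: "norm l < 1"
  shows "(1 - norm l) / (1 + norm l) * Re (F 0) \<le> Re (F l)"
proof -
  define k where "k z = (F z - F 0) / (F z + cnj (F 0))" for z
  have nz: "F z + cnj (F 0) \<noteq> 0" if "norm z < 1" for z
    using pos[OF that] pos[of 0] by (auto simp: complex_eq_iff)
  have "k holomorphic_on ball 0 1" unfolding k_def using nz by (intro holomorphic_intros F) auto
  moreover have lt: "norm (F z - F 0) < norm (F z + cnj (F 0))" if "norm z < 1" for z
  proof (rule power2_less_imp_less)
    have "(norm (F z + cnj (F 0)))\<^sup>2 - (norm (F z - F 0))\<^sup>2 = 4 * (Re (F z) * Re (F 0))"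
      unfolding cmod_power2 by (simp add: power2_eq_square algebra_simps)
    moreover have "0 < Re (F z) * Re (F 0)" using pos[OF that] pos[of 0] by simp
    ultimately show "(norm (F z - F 0))\<^sup>2 < (norm (F z + cnj (F 0)))\<^sup>2" by linarith
  qed simp
  then have "norm (k z) < 1" if "norm z < 1" for z
    using nz[OF that] lt[OF that] by (simp add: k_def norm_divide divide_less_eq)
  ultimately have "norm (k l) \<le> norm l" using Schwarz_Lemma(1)[of k l] l by (simp add: k_def)
  then have le: "norm (F l - F 0) \<le> norm l * norm (F l + cnj (F 0))"
    using nz[OF l] by (simp add: k_def norm_divide divide_le_eq)
  define X X0 Y r where "X = Re (F l)" and "X0 = Re (F 0)" and "Y = Im (F l) - Im (F 0)" and "r = norm l"
  have r: "0 \<le> r" "r < 1" using l by (auto simp: r_def)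
  have X: "0 < X" "0 < X0" using pos l by (auto simp: X_def X0_def)
  have "(norm (F l - F 0))\<^sup>2 \<le> (r * norm (F l + cnj (F 0)))\<^sup>2" using le by (intro power_mono) (auto simp: r_def)
  then have "(X - X0)\<^sup>2 + Y\<^sup>2 \<le> r\<^sup>2 * ((X + X0)\<^sup>2 + Y\<^sup>2)"
    unfolding power_mult_distrib cmod_power2 by (simp add: X_def X0_def Y_def)
  moreover have "r\<^sup>2 * Y\<^sup>2 \<le> 1 * Y\<^sup>2" using r by (intro mult_right_mono) (auto simp: power_le_one)
  ultimately have "(X0 - X)\<^sup>2 \<le> (r * (X + X0))\<^sup>2"
    by (simp add: power2_eq_square algebra_simps)
  then have "X0 - X \<le> r * (X + X0)" by (rule power2_le_imp_le) (use r X in simp)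
  then have "(1 - r) * X0 \<le> X * (1 + r)" by (simp add: algebra_simps)
  then have "(1 - r) * X0 / (1 + r) \<le> X" using r by (subst pos_divide_le_eq) auto
  then show ?thesis by (simp add: X_def X0_def r_def)
qed

lemma support_open_convex:
  fixes D :: "'a :: euclidean_space set"
  assumes "open D" "convex D" "y \<notin> D" "D \<noteq> {}"
  obtains u where "norm u = 1" "\<And>z. z \<in> D \<Longrightarrow> u \<bullet> z < u \<bullet> y"
proof -
  obtain a where a: "a \<noteq> 0" "\<And>z. z \<in> D \<Longrightarrow> a \<bullet> y \<le> a \<bullet> z"
    using separating_hyperplane_sets[of "{y}" D] assms by fastforce
  define u where "u = (- 1 / norm a) *\<^sub>R a"
  have nu: "norm u = 1" using a by (simp add: u_def)
  have le: "u \<bullet> z \<le> u \<bullet> y" if "z \<in> D" for z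
    using a(2)[OF that] a(1) by (simp add: u_def divide_right_mono)
  have "u \<bullet> z < u \<bullet> y" if z: "z \<in> D" for z
  proof -
    obtain e where e: "0 < e" "cball z e \<subseteq> D" using assms(1) z open_contains_cball by blast
    then have "z + e *\<^sub>R u \<in> D" using nu by (auto simp: dist_norm subset_iff)
    from le[OF this] have "u \<bullet> z + e * (u \<bullet> u) \<le> u \<bullet> y" by (simp add: inner_right_distrib)
    moreover have "u \<bullet> u = 1" using nu by (simp add: norm_eq_1)
    ultimately show ?thesis using e(1) by simp
  qed
  then show thesis using that nu by blast
qed

lemma Schwarz_bound:
  assumes g: "g holomorphic_on ball 0 1" "g 0 = 0" and B: "0 < B" "\<And>z. norm z < 1 \<Longrightarrow> norm (g z) \<le> B"
    and l: "norm l < 1"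
  shows "norm (g l) \<le> B * norm l"
proof (rule field_le_epsilon)
  fix e :: real assume e: "0 < e"
  define k where "k z = g z / of_real (B + e)" for z
  have "norm (g z) < B + e" if "norm z < 1" for z using B(2)[OF that] e by linarith
  then have "norm (k z) < 1" if "norm z < 1" for z
    using that B(1) e by (simp add: k_def norm_divide divide_less_eq del: of_real_add)
  moreover have "k holomorphic_on ball 0 1"
    unfolding k_def using B(1) e by (intro holomorphic_intros g) (simp del: of_real_add)
  ultimately have "norm (k l) \<le> norm l" using Schwarz_Lemma(1)[of k l] l g(2) by (simp add: k_def)
  then have "norm (g l) \<le> norm l * (B + e)"
    using B(1) e by (simp add: k_def norm_divide pos_divide_le_eq del: of_real_add)
  also have "\<dots> \<le> B * norm l + e" using l e by (simp add: algebra_simps mult_left_le_one_le)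
  finally show "norm (g l) \<le> B * norm l + e" .
qed

lemma Schwarz_Pick_deriv:
  assumes g: "g holomorphic_on ball 0 1" and le: "\<And>z. norm z < 1 \<Longrightarrow> norm (g z) < 1"
  shows "norm (deriv g 0) \<le> 1 - (norm (g 0))\<^sup>2"
proof -
  have "(g has_field_derivative deriv g 0) (at 0)" using g by (auto intro: holomorphic_derivI)
  then have q: "((\<lambda>x. (g x - g 0) / (x - 0)) \<longlongrightarrow> deriv g 0) (at 0)" by (simp add: has_field_derivative_iff)
  have gc: "(g \<longlongrightarrow> g 0) (at 0)"
    using holomorphic_on_imp_continuous_on[OF g] by (simp add: continuous_on_eq_continuous_at isCont_def)
  have lim: "((\<lambda>x. norm (1 - cnj (g 0) * g x)) \<longlongrightarrow> norm (1 - cnj (g 0) * g 0)) (at 0)"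
    by (intro tendsto_intros gc)
  have ev: "eventually (\<lambda>x. norm ((g x - g 0) / (x - 0)) \<le> norm (1 - cnj (g 0) * g x)) (at 0)"
  proof -
    have "eventually (\<lambda>x :: complex. x \<in> ball 0 1 - {0}) (at 0)" by (rule eventually_at_in_open) auto
    then show ?thesis
    proof eventually_elim
      case (elim x)
      then have x: "norm x < 1" "x \<noteq> 0" by auto
      have nz: "1 - cnj (g 0) * g x \<noteq> 0" by (rule one_minus_cnj_mult_nonzero[OF le le]) (use x in auto)
      have "pseudo_dist (g 0) (g x) \<le> norm x"
        using Schwarz_Pick[OF g le, of 0 x] x by (simp add: pseudo_dist_def)
      then have "norm (g x - g 0) \<le> norm x * norm (1 - cnj (g 0) * g x)"
        using nz by (simp add: pseudo_dist_def pos_divide_le_eq norm_minus_commute)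
      then show ?case using x by (simp add: norm_divide pos_divide_le_eq mult.commute)
    qed
  qed
  have "norm (deriv g 0) \<le> norm (1 - cnj (g 0) * g 0)"
    by (rule tendsto_le[OF at_neq_bot lim tendsto_norm[OF q] ev])
  also have "1 - cnj (g 0) * g 0 = of_real (1 - (norm (g 0))\<^sup>2)"
    by (simp only: of_real_diff of_real_1 complex_norm_square mult.commute[of "cnj _"])
  also have "norm \<dots> = 1 - (norm (g 0))\<^sup>2"
    using le[of 0] by (simp only: norm_of_real) (simp add: power_le_one)
  finally show ?thesis .
qed

text \<open>
  Inclusion of half spaces through one point determines the normal up to a positive factor.
\<close>

lemma halfspace_inclusion:
  fixes u \<omega> :: "'a :: real_inner"
  assumes \<omega>: "\<omega> \<noteq> 0" and u: "u \<noteq> 0" and h: "\<And>v. \<omega> \<bullet> v < 0 \<Longrightarrow> u \<bullet> v \<le> 0"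
  obtains k where "0 < k" "u = k *\<^sub>R \<omega>"
proof -
  define n where "n = (- 1 / norm \<omega>) *\<^sub>R \<omega>"
  have "norm n = 1" using \<omega> by (simp add: n_def)
  moreover have "u \<bullet> v \<le> 0" if "0 < v \<bullet> n" for v
    using that \<omega> by (intro h) (simp add: n_def inner_commute zero_less_divide_iff divide_less_0_iff)
  ultimately have "u = - norm u *\<^sub>R n" by (rule vector_eq_neg_normal)
  then have "u = (norm u / norm \<omega>) *\<^sub>R \<omega>" by (simp add: n_def)
  then show thesis using that[of "norm u / norm \<omega>"] u \<omega> by simp
qed

locale smooth_geodesic = geodesic D f G for D :: "(complex ^ 'n) set" and f G +
  fixes \<rho> :: real
  assumes ib: "interior_balls D \<rho>"
begin

lemma rho_pos: "0 < \<rho>"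
  using ib by (simp add: interior_balls_def)

lemma interior_ball: "y \<in> D \<Longrightarrow> 0 < s \<Longrightarrow> s \<le> \<rho> \<Longrightarrow> ball y s \<subseteq> D \<Longrightarrow> \<exists>c. ball c \<rho> \<subseteq> D \<and> dist y c \<le> \<rho> - s"
  using ib by (simp add: interior_balls_def)

text \<open>
  The boundary point lemma for \<open>G\<close>: inside an interior ball of radius \<open>\<rho>\<close>, Schwarz-Pick on the
  complex line through the centre bounds \<open>1 - norm (G y)\<close> from below by the depth of \<open>y\<close>. The
  constant is uniform since the centres of such balls form a compact subset of \<open>D\<close>.
\<close>

lemma Hopf_estimate:
  obtains \<kappa> where "0 < \<kappa>" "\<kappa> * \<rho> \<le> 1 / 2"
    "\<And>y s. y \<in> D \<Longrightarrow> 0 < s \<Longrightarrow> s \<le> \<rho> \<Longrightarrow> ball y s \<subseteq> D \<Longrightarrow> norm (G y) \<le> 1 - \<kappa> * s"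
proof -
  define C where "C = {c. ball c \<rho> \<subseteq> D}"
  have CD: "C \<subseteq> D" using rho_pos by (auto simp: C_def)
  have "closed C"
    unfolding closed_sequential_limits
  proof (intro allI impI)
    fix X c assume X: "(\<forall>n. X n \<in> C) \<and> X \<longlonglongrightarrow> c"
    have "y \<in> D" if y: "y \<in> ball c \<rho>" for y
    proof -
      have "(\<lambda>n. dist (X n) y) \<longlonglongrightarrow> dist c y" using X by (intro tendsto_dist tendsto_const) auto
      then have "eventually (\<lambda>n. dist (X n) y < \<rho>) sequentially" using y by (intro order_tendstoD(2)) auto
      then obtain n where "dist (X n) y < \<rho>" by (meson eventually_happens sequentially_bot)
      then have "y \<in> ball (X n) \<rho>" by simp
      moreover have "ball (X n) \<rho> \<subseteq> D" using X by (simp add: C_def)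
      ultimately show ?thesis by blast
    qed
    then show "c \<in> C" by (auto simp: C_def)
  qed
  then have cC: "compact C" using CD D_bounded bounded_subset compact_eq_bounded_closed by blast
  obtain m where m: "0 \<le> m" "m < 1" "\<And>c. c \<in> C \<Longrightarrow> norm (G c) \<le> m"
  proof (cases "C = {}")
    case True then show ?thesis using that[of 0] by auto
  next
    case False
    have "continuous_on C (\<lambda>c. norm (G c))"
      using holomorphic_fun_on_imp_continuous_on[OF G_hol] CD by (intro continuous_on_norm) (rule continuous_on_subset)
    then obtain x where x: "x \<in> C" "\<And>c. c \<in> C \<Longrightarrow> norm (G c) \<le> norm (G x)"
      using continuous_attains_sup[OF cC False] by blast
    have "norm (G x) < 1" by (rule G_less) (use x(1) CD in blast)
    then show ?thesis by (intro that[of "norm (G x)"] x(2)) auto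
  qed
  define \<kappa> where "\<kappa> = (1 - m) / (2 * \<rho>)"
  show thesis
  proof (rule that[of \<kappa>])
    show "0 < \<kappa>" "\<kappa> * \<rho> \<le> 1 / 2" using m rho_pos by (auto simp: \<kappa>_def)
    fix y s assume y: "y \<in> D" and s: "0 < s" "s \<le> \<rho>" "ball y s \<subseteq> D"
    obtain c where c: "ball c \<rho> \<subseteq> D" "dist y c \<le> \<rho> - s" using interior_ball[OF y s] by blast
    define t where "t = dist y c / \<rho>"
    have t: "0 \<le> t" "t < 1" "t \<le> 1 - s / \<rho>"
      using c(2) s rho_pos by (auto simp: t_def field_simps)
    obtain e where e: "norm e = \<rho>" "y = c + of_real t *s e"
    proof (cases "y = c")
      case True
      obtain e :: "complex ^ 'n" where "norm e = \<rho>" using vector_choose_size[of \<rho>] rho_pos by auto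
      then show ?thesis using that[of e] True by (simp add: t_def)
    next
      case False
      define e where "e = (\<rho> / dist y c) *\<^sub>R (y - c)"
      have "norm e = \<rho>" using False rho_pos by (simp add: e_def dist_norm)
      moreover have "of_real t *s e = t *\<^sub>R e" by (simp add: vec_eq_iff scaleR_conv_of_real[where 'a = complex])
      then have "of_real t *s e = y - c" using False rho_pos by (simp add: e_def t_def)
      ultimately show ?thesis using that[of e] by simp
    qed
    define g where "g \<xi> = G (c + \<xi> *s e)" for \<xi>
    have inD: "c + \<xi> *s e \<in> D" if "norm \<xi> < 1" for \<xi>
    proof -
      have "norm \<xi> * \<rho> < 1 * \<rho>" using that rho_pos by (intro mult_strict_right_mono)
      then have "c + \<xi> *s e \<in> ball c \<rho>" using e(1) by (simp add: dist_norm norm_cmult_vec)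
      then show ?thesis using c(1) by blast
    qed
    have gh: "g holomorphic_on ball 0 1" unfolding g_def
      by (rule holomorphic_fun_on_line(1)[OF G_hol D_open]) (use inD in auto)
    have gl: "norm (g \<xi>) < 1" if "norm \<xi> < 1" for \<xi> using G_less inD[OF that] by (simp add: g_def)
    have "pseudo_dist (g 0) (g (of_real t)) \<le> t"
      using Schwarz_Pick[OF gh gl, of 0 "of_real t"] t by (simp add: pseudo_dist_def)
    then have "norm (g (of_real t)) \<le> (norm (g 0) + t) / (1 + norm (g 0) * t)"
      using gl t by (intro norm_le_of_pseudo_dist) auto
    moreover have "g (of_real t) = G y" "g 0 = G c" by (auto simp: g_def e(2))
    ultimately have Gy: "norm (G y) \<le> (norm (G c) + t) / (1 + norm (G c) * t)" by simp
    define a where "a = norm (G c)"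
    have a: "0 \<le> a" "a \<le> m" using m(3) c(1) by (auto simp: a_def C_def)
    have "a * t \<le> 1 * 1" using a m t by (intro mult_mono) auto
    then have pos: "0 < 1 + a * t" "1 + a * t \<le> 2" using a t by (auto intro: add_pos_nonneg)
    have "(1 - m) * (s / \<rho>) \<le> (1 - a) * (1 - t)" using a m t s rho_pos by (intro mult_mono) auto
    then have "(1 - m) * (s / \<rho>) / 2 \<le> (1 - a) * (1 - t) / (1 + a * t)"
      using pos a m t s rho_pos by (intro frac_le mult_nonneg_nonneg) auto
    moreover have "(a + t) / (1 + a * t) = 1 - (1 - a) * (1 - t) / (1 + a * t)"
      using pos(1) by (simp add: field_simps)
    ultimately have "norm (G y) \<le> 1 - (1 - m) * (s / \<rho>) / 2" using Gy by (simp add: a_def)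
    then show "norm (G y) \<le> 1 - \<kappa> * s" by (simp add: \<kappa>_def)
  qed
qed

lemma ball_toward:
  assumes q: "ball q \<epsilon> \<subseteq> D" "0 < \<epsilon>" and x: "x \<in> D" and t: "0 < t" "t \<le> 1"
  shows "ball (x + t *\<^sub>R (q - x)) (t * \<epsilon>) \<subseteq> D"
proof
  fix y assume "y \<in> ball (x + t *\<^sub>R (q - x)) (t * \<epsilon>)"
  then have y: "norm (y - (x + t *\<^sub>R (q - x))) < t * \<epsilon>" by (simp add: dist_norm norm_minus_commute)
  define q' where "q' = q + (1 / t) *\<^sub>R (y - (x + t *\<^sub>R (q - x)))"
  have "norm (q' - q) < \<epsilon>" using y t by (simp add: q'_def pos_divide_less_eq mult.commute)
  then have "q' \<in> D" using q by (auto simp: dist_norm norm_minus_commute)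
  then have "x + t *\<^sub>R (q' - x) \<in> D" using convex_step x t by simp
  moreover have "x + t *\<^sub>R (q' - x) = y" using t by (simp add: q'_def algebra_simps)
  ultimately show "y \<in> D" by simp
qed

lemma center_ball:
  obtains \<epsilon> where "0 < \<epsilon>" "\<epsilon> \<le> \<rho>" "ball (f 0) \<epsilon> \<subseteq> D"
proof -
  have "f 0 \<in> D" using f_in by simp
  then obtain e where e: "0 < e" "ball (f 0) e \<subseteq> D" using D_open open_contains_ball by blast
  have "ball (f 0) (min e \<rho>) \<subseteq> ball (f 0) e" by (rule subset_ball) simp
  then show thesis using that[of "min e \<rho>"] rho_pos e by (metis min.cobounded2 min_less_iff_conj order_trans)
qed

lemma segment_disc_holomorphic:
  "(\<lambda>\<zeta>. G (f \<zeta> + t *\<^sub>R (z - f \<zeta>))) holomorphic_on ball 0 1" if "z \<in> D" "0 \<le> t" "t \<le> 1"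
proof (rule compose_disc_holomorphic[OF G_hol D_open])
  show "(\<lambda>\<zeta>. (f \<zeta> + t *\<^sub>R (z - f \<zeta>)) $ i) holomorphic_on ball 0 1" for i
    unfolding vector_add_component vector_scaleR_component vector_minus_component scaleR_conv_of_real[where 'a = complex]
    by (intro holomorphic_intros f_hol)
qed (use that convex_step f_in in auto)

text \<open>
  For fixed \<open>t\<close> the function \<open>\<zeta> \<mapsto> G (f \<zeta> + t (f 0 - f \<zeta>))\<close> vanishes at \<open>0\<close>, and its argument has
  depth at least \<open>t * \<epsilon>\<close>, so the Hopf estimate and the Schwarz lemma bound it by
  \<open>(1 - \<kappa> t \<epsilon>) * norm \<zeta>\<close>. Differentiate at \<open>t = 0\<close>.
\<close>

lemma radial_lower_bound:
  obtains c where "0 < c" "\<And>\<zeta>. norm \<zeta> < 1 \<Longrightarrow> c * (norm \<zeta>)\<^sup>2 \<le> Re (cnj \<zeta> * ((f \<zeta> - f 0) \<odot> w \<zeta>))"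
proof -
  obtain \<kappa> where \<kappa>: "0 < \<kappa>" "\<kappa> * \<rho> \<le> 1 / 2"
    "\<And>y s. y \<in> D \<Longrightarrow> 0 < s \<Longrightarrow> s \<le> \<rho> \<Longrightarrow> ball y s \<subseteq> D \<Longrightarrow> norm (G y) \<le> 1 - \<kappa> * s"
    using Hopf_estimate by metis
  obtain \<epsilon> where \<epsilon>: "0 < \<epsilon>" "\<epsilon> \<le> \<rho>" "ball (f 0) \<epsilon> \<subseteq> D" using center_ball by blast
  have f0: "f 0 \<in> D" using f_in by simp
  have bound: "norm (G (f \<zeta> + t *\<^sub>R (f 0 - f \<zeta>))) \<le> (1 - \<kappa> * (t * \<epsilon>)) * norm \<zeta>" if \<zeta>: "norm \<zeta> < 1" and t: "0 < t" "t \<le> 1" for \<zeta> t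
  proof (rule Schwarz_bound[where g = "\<lambda>\<zeta>. G (f \<zeta> + t *\<^sub>R (f 0 - f \<zeta>))", OF segment_disc_holomorphic[OF f0]])
    have "t * \<epsilon> \<le> 1 * \<rho>" using t \<epsilon> by (intro mult_mono) auto
    then have te: "0 < t * \<epsilon>" "t * \<epsilon> \<le> \<rho>" using t \<epsilon> by auto
    have "\<kappa> * (t * \<epsilon>) \<le> \<kappa> * \<rho>" using te \<kappa> by (intro mult_left_mono) auto
    then show "0 < 1 - \<kappa> * (t * \<epsilon>)" using \<kappa>(2) by linarith
    show "norm (G (f z + t *\<^sub>R (f 0 - f z))) \<le> 1 - \<kappa> * (t * \<epsilon>)" if "norm z < 1" for z
      using ball_toward[OF \<epsilon>(3,1) f_in[OF that] t] convex_step[OF f_in[OF that] f0] t te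
      by (intro \<kappa>(3)) auto
  qed (use t \<zeta> G_f[of 0] in auto)
  show thesis
  proof (rule that[of "\<kappa> * \<epsilon>"])
    show "0 < \<kappa> * \<epsilon>" using \<kappa> \<epsilon> by simp
    fix \<zeta> :: complex assume \<zeta>: "norm \<zeta> < 1"
    have G0: "G (f \<zeta> + 0 *\<^sub>R (f 0 - f \<zeta>)) = \<zeta>" using G_f[OF \<zeta>] by simp
    have "Re (cnj (G (f \<zeta> + 0 *\<^sub>R (f 0 - f \<zeta>))) * ((f 0 - f \<zeta>) \<odot> w \<zeta>))
        \<le> norm (G (f \<zeta> + 0 *\<^sub>R (f 0 - f \<zeta>))) * (- (\<kappa> * \<epsilon> * norm \<zeta>))"
    proof (rule norm_growth_derivative[where m = "\<lambda>t. (1 - \<kappa> * (t * \<epsilon>)) * norm \<zeta>", OF real_line_deriv[OF G_hol f_in[OF \<zeta>]]])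
      show "((\<lambda>t. (1 - \<kappa> * (t * \<epsilon>)) * norm \<zeta>) has_real_derivative - (\<kappa> * \<epsilon> * norm \<zeta>)) (at 0)"
        by (auto intro!: derivative_eq_intros)
    qed (use bound[OF \<zeta>] G0 in auto)
    then have "Re (cnj \<zeta> * ((f 0 - f \<zeta>) \<odot> w \<zeta>)) \<le> - (\<kappa> * \<epsilon> * (norm \<zeta>)\<^sup>2)"
      unfolding G0 by (simp add: power2_eq_square mult_ac)
    moreover have "cnj \<zeta> * ((f 0 - f \<zeta>) \<odot> w \<zeta>) = - (cnj \<zeta> * ((f \<zeta> - f 0) \<odot> w \<zeta>))"
      by (simp add: scalar_product_diff_left algebra_simps)
    ultimately show "\<kappa> * \<epsilon> * (norm \<zeta>)\<^sup>2 \<le> Re (cnj \<zeta> * ((f \<zeta> - f 0) \<odot> w \<zeta>))" by simp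
  qed
qed

text \<open>
  The self-map \<open>h \<xi> = G (f \<xi> + t (z - f \<xi>))\<close> has \<open>norm (h 0) \<le> C * t\<close>, and Schwarz-Pick bounds
  it at \<open>\<zeta>\<close> by the hyperbolic sum of \<open>norm \<zeta>\<close> and \<open>C * t\<close>, whose derivative at \<open>t = 0\<close> is
  \<open>C * (1 - (norm \<zeta>)^2)\<close>. Thus \<open>w \<zeta>\<close> nearly supports \<open>D\<close> itself when \<open>\<zeta>\<close> is near the circle.
\<close>

lemma almost_support:
  obtains C where "0 < C"
    "\<And>z \<zeta>. z \<in> D \<Longrightarrow> norm \<zeta> < 1 \<Longrightarrow> Re (cnj \<zeta> * ((z - f \<zeta>) \<odot> w \<zeta>)) \<le> C * (1 - (norm \<zeta>)\<^sup>2)"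
proof -
  obtain B where B: "0 < B" "\<And>x y. x \<in> D \<Longrightarrow> y \<in> D \<Longrightarrow> norm (x - y) \<le> B" using diameter_bound by blast
  obtain \<epsilon> where \<epsilon>: "0 < \<epsilon>" "\<epsilon> \<le> \<rho>" "ball (f 0) \<epsilon> \<subseteq> D" using center_ball by blast
  have f0: "f 0 \<in> D" "G (f 0) = 0" using f_in G_f by auto
  define C where "C = B / \<epsilon>"
  have C: "0 < C" using B \<epsilon> by (simp add: C_def)
  have at: "norm (G (f 0 + t *\<^sub>R (z - f 0))) \<le> C * t" if z: "z \<in> D" and t: "0 < t" "t \<le> 1" for z t
  proof (cases "C * t < 1")
    case True
    define e where "e = (\<epsilon> / B) *\<^sub>R (z - f 0)"
    have "\<epsilon> / B * norm (z - f 0) \<le> \<epsilon> / B * B" using B(2)[OF z f0(1)] B(1) \<epsilon> by (intro mult_left_mono) auto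
    then have ne: "norm e \<le> \<epsilon>" using B \<epsilon> by (simp add: e_def)
    have inD: "f 0 + \<xi> *s e \<in> D" if "norm \<xi> < 1" for \<xi>
    proof -
      have "norm \<xi> * norm e \<le> norm \<xi> * \<epsilon>" using ne by (intro mult_left_mono) auto
      also have "\<dots> < 1 * \<epsilon>" using that \<epsilon> by (intro mult_strict_right_mono)
      finally have "f 0 + \<xi> *s e \<in> ball (f 0) \<epsilon>" by (simp add: dist_norm norm_cmult_vec)
      then show ?thesis using \<epsilon>(3) by blast
    qed
    have "(\<lambda>\<xi>. G (f 0 + \<xi> *s e)) holomorphic_on ball 0 1"
      by (rule holomorphic_fun_on_line(1)[OF G_hol D_open]) (use inD in auto)
    moreover have "norm (complex_of_real (C * t)) < 1" using True C t by (simp del: of_real_mult)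
    ultimately have "norm (G (f 0 + of_real (C * t) *s e)) \<le> norm (complex_of_real (C * t))"
      using Schwarz_Lemma(1)[of "\<lambda>\<xi>. G (f 0 + \<xi> *s e)" "of_real (C * t)"] G_less[OF inD] f0(2)
      by (simp del: of_real_mult)
    moreover have "of_real (C * t) *s e = (C * t) *\<^sub>R e"
      by (simp add: vec_eq_iff scaleR_conv_of_real[where 'a = complex])
    then have "of_real (C * t) *s e = t *\<^sub>R (z - f 0)" using B \<epsilon> by (simp add: e_def C_def)
    ultimately show ?thesis using C t by (simp add: norm_mult)
  next
    case False
    have "f 0 + t *\<^sub>R (z - f 0) \<in> D" using convex_step[OF f0(1) z] t by simp
    from G_less[OF this] show ?thesis using False by linarith
  qed
  show thesis
  proof (rule that[OF C])
    fix z and \<zeta> :: complex assume z: "z \<in> D" and \<zeta>: "norm \<zeta> < 1"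
    define r where "r = norm \<zeta>"
    have r: "0 \<le> r" "r < 1" using \<zeta> by (auto simp: r_def)
    have G0: "G (f \<zeta> + 0 *\<^sub>R (z - f \<zeta>)) = \<zeta>" using G_f[OF \<zeta>] by simp
    have bound: "norm (G (f \<zeta> + t *\<^sub>R (z - f \<zeta>))) \<le> (r + C * t) / (1 + r * (C * t))" if t: "0 < t" "t \<le> 1" for t
    proof -
      define h where "h \<xi> = G (f \<xi> + t *\<^sub>R (z - f \<xi>))" for \<xi>
      have hh: "h holomorphic_on ball 0 1" unfolding h_def by (rule segment_disc_holomorphic) (use z t in auto)
      have hl: "norm (h \<xi>) < 1" if "norm \<xi> < 1" for \<xi>
        using convex_step[OF f_in[OF that] z] t G_less by (simp add: h_def)
      define a where "a = norm (h 0)"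
      have a: "0 \<le> a" "a \<le> C * t" using at[OF z t] by (auto simp: a_def h_def)
      have "pseudo_dist (h 0) (h \<zeta>) \<le> r"
        using Schwarz_Pick[OF hh hl, of 0 \<zeta>] \<zeta> by (simp add: pseudo_dist_def r_def)
      then have 1: "norm (h \<zeta>) \<le> (a + r) / (1 + a * r)"
        unfolding a_def using hl \<zeta> by (intro norm_le_of_pseudo_dist) auto
      have d: "0 < 1 + a * r" "0 < 1 + r * (C * t)" using a r C t by (auto intro!: add_pos_nonneg)
      have "(a + r) * (1 + r * (C * t)) \<le> (r + C * t) * (1 + a * r)"
      proof -
        have "(r + C * t) * (1 + a * r) - (a + r) * (1 + r * (C * t)) = (C * t - a) * (1 - r * r)"
          by (simp add: algebra_simps)
        moreover have "0 \<le> (C * t - a) * (1 - r * r)"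
          using a r mult_le_one[of r r] by (intro mult_nonneg_nonneg) auto
        ultimately show ?thesis by linarith
      qed
      then have "(a + r) / (1 + a * r) \<le> (r + C * t) / (1 + r * (C * t))"
        using d by (simp add: divide_le_eq le_divide_eq mult.commute)
      then show ?thesis using 1 by (simp add: h_def)
    qed
    have "Re (cnj (G (f \<zeta> + 0 *\<^sub>R (z - f \<zeta>))) * ((z - f \<zeta>) \<odot> w \<zeta>))
        \<le> norm (G (f \<zeta> + 0 *\<^sub>R (z - f \<zeta>))) * (C * (1 - r\<^sup>2))"
    proof (rule norm_growth_derivative[where m = "\<lambda>t. (r + C * t) / (1 + r * (C * t))", OF real_line_deriv[OF G_hol f_in[OF \<zeta>]]])
      show "((\<lambda>t. (r + C * t) / (1 + r * (C * t))) has_real_derivative C * (1 - r\<^sup>2)) (at 0)"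
        by (auto intro!: derivative_eq_intros simp: power2_eq_square algebra_simps)
    qed (use bound G0 in \<open>auto simp: r_def\<close>)
    also have "\<dots> \<le> 1 * (C * (1 - r\<^sup>2))"
      unfolding G0 using \<zeta> C r by (intro mult_right_mono mult_nonneg_nonneg) (auto simp: power_le_one)
    finally show "Re (cnj \<zeta> * ((z - f \<zeta>) \<odot> w \<zeta>)) \<le> C * (1 - (norm \<zeta>)\<^sup>2)" unfolding G0 by (simp add: r_def)
  qed
qed

text \<open>
  By Harnack's inequality \<open>f \<zeta>\<close> has depth at least proportional to \<open>1 - norm \<zeta>\<close> in \<open>D\<close>, and the
  Schwarz-Pick inequality for \<open>G\<close> on a disc of this radius bounds the gradient by the quotient
  of \<open>1 - (norm \<zeta>)^2\<close> and the depth.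
\<close>

lemma w_bounded:
  obtains W where "0 < W" "\<And>\<zeta>. norm \<zeta> < 1 \<Longrightarrow> norm (w \<zeta>) \<le> W"
proof -
  obtain \<epsilon> where \<epsilon>: "0 < \<epsilon>" "\<epsilon> \<le> \<rho>" "ball (f 0) \<epsilon> \<subseteq> D" using center_ball by blast
  have depth: "f \<zeta> + v \<in> D" if \<zeta>: "norm \<zeta> < 1" and v: "norm v < \<epsilon> / 2 * (1 - norm \<zeta>)" for \<zeta> v
  proof (rule ccontr)
    assume out: "f \<zeta> + v \<notin> D"
    have ne: "D \<noteq> {}" using f_in[OF \<zeta>] by blast
    obtain u where u: "norm u = 1" "\<And>z. z \<in> D \<Longrightarrow> u \<bullet> z < u \<bullet> (f \<zeta> + v)"
      using support_open_convex[OF D_open D_convex out ne] by blast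
    define F where "F \<mu> = (f \<zeta> + v - f \<mu>) \<odot> cnj_vec u" for \<mu>
    have ReF: "Re (F \<mu>) = u \<bullet> (f \<zeta> + v) - u \<bullet> f \<mu>" for \<mu>
      using inner_cnj_vec[of "cnj_vec u" "f \<zeta> + v - f \<mu>"] by (simp add: F_def inner_diff_right)
    have "(1 - norm \<zeta>) / (1 + norm \<zeta>) * Re (F 0) \<le> Re (F \<zeta>)"
    proof (rule Harnack_disc[OF _ _ \<zeta>])
      show "F holomorphic_on ball 0 1" unfolding F_def scalar_product_def vector_minus_component
        by (intro holomorphic_intros f_hol)
      show "0 < Re (F z)" if "norm z < 1" for z using u(2)[OF f_in[OF that]] by (simp add: ReF)
    qed
    moreover have "Re (F \<zeta>) \<le> norm v"
      using norm_cauchy_schwarz[of u v] u(1) by (simp add: ReF inner_right_distrib)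
    moreover have "\<epsilon> / 2 * (1 - norm \<zeta>) \<le> (1 - norm \<zeta>) / (1 + norm \<zeta>) * Re (F 0)"
    proof -
      have "\<epsilon> \<le> Re (F 0)"
      proof (rule field_le_mult_one_interval)
        fix s :: real assume s: "0 < s" "s < 1"
        have "f 0 + (s * \<epsilon>) *\<^sub>R u \<in> ball (f 0) \<epsilon>" using s \<epsilon> u(1) by (simp add: dist_norm)
        then have "u \<bullet> (f 0 + (s * \<epsilon>) *\<^sub>R u) < u \<bullet> (f \<zeta> + v)" using \<epsilon>(3) u(2) by blast
        moreover have "u \<bullet> u = 1" using u(1) by (simp add: norm_eq_1)
        ultimately show "s * \<epsilon> \<le> Re (F 0)" by (simp add: ReF inner_right_distrib)
      qed
      moreover have "1 / 2 \<le> 1 / (1 + norm \<zeta>)" using \<zeta> by (intro divide_left_mono) (auto intro!: mult_pos_pos add_pos_nonneg)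
      ultimately have "(1 / 2) * \<epsilon> \<le> (1 / (1 + norm \<zeta>)) * Re (F 0)" using \<epsilon> by (intro mult_mono) auto
      then have "(1 - norm \<zeta>) * ((1 / 2) * \<epsilon>) \<le> (1 - norm \<zeta>) * ((1 / (1 + norm \<zeta>)) * Re (F 0))"
        using \<zeta> by (intro mult_left_mono) auto
      then show ?thesis by (simp add: mult_ac)
    qed
    ultimately show False using v by linarith
  qed
  show thesis
  proof (rule that[of "4 / \<epsilon>"])
    show "0 < 4 / \<epsilon>" using \<epsilon> by simp
    fix \<zeta> :: complex assume \<zeta>: "norm \<zeta> < 1"
    define d where "d = \<epsilon> / 2 * (1 - norm \<zeta>)"
    have d: "0 < d" using \<epsilon> \<zeta> by (simp add: d_def)
    have wn: "0 < norm (w \<zeta>)" using w_nonzero[OF \<zeta>] by simp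
    define v where "v = (d / norm (w \<zeta>)) *\<^sub>R cnj_vec (w \<zeta>)"
    have nv: "norm v = d" using wn d by (simp add: v_def)
    define g where "g \<xi> = G (f \<zeta> + \<xi> *s v)" for \<xi>
    have inD: "f \<zeta> + \<xi> *s v \<in> D" if "norm \<xi> < 1" for \<xi>
    proof -
      have "norm \<xi> * d < 1 * d" using that d by (intro mult_strict_right_mono)
      then show ?thesis by (intro depth[OF \<zeta>]) (simp add: norm_cmult_vec nv d_def)
    qed
    have gh: "g holomorphic_on ball 0 1" unfolding g_def
      by (rule holomorphic_fun_on_line(1)[OF G_hol D_open]) (use inD in auto)
    have "(g has_field_derivative (v \<odot> cgrad G (f \<zeta> + 0 *s v))) (at 0)"
      unfolding g_def by (rule holomorphic_fun_on_line(2)[OF G_hol D_open, of "ball 0 1"]) (use inD in auto)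
    then have dg: "deriv g 0 = v \<odot> w \<zeta>" by (simp add: DERIV_imp_deriv)
    have "norm (deriv g 0) \<le> 1 - (norm (g 0))\<^sup>2"
      by (rule Schwarz_Pick_deriv[OF gh]) (use inD G_less in \<open>auto simp: g_def\<close>)
    then have "norm (v \<odot> w \<zeta>) \<le> 1 - (norm \<zeta>)\<^sup>2" unfolding dg by (simp add: g_def G_f[OF \<zeta>])
    moreover have "v \<odot> w \<zeta> = (d / norm (w \<zeta>)) *\<^sub>R of_real ((norm (w \<zeta>))\<^sup>2)"
      by (simp only: v_def scalar_product_scaleR_left cnj_vec_scalar_product)
    then have "norm (v \<odot> w \<zeta>) = d * norm (w \<zeta>)"
      using wn d by (simp add: power2_eq_square norm_mult norm_divide)
    ultimately have "d * norm (w \<zeta>) \<le> (1 - norm \<zeta>) * (1 + norm \<zeta>)" by (simp add: power2_eq_square algebra_simps)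
    also have "\<dots> \<le> (1 - norm \<zeta>) * 2" using \<zeta> by (intro mult_left_mono) auto
    finally have "(1 - norm \<zeta>) * (\<epsilon> / 2 * norm (w \<zeta>)) \<le> (1 - norm \<zeta>) * 2" by (simp add: d_def mult_ac)
    then have "\<epsilon> / 2 * norm (w \<zeta>) \<le> 2" by (rule mult_left_le_imp_le) (use \<zeta> in simp)
    then show "norm (w \<zeta>) \<le> 4 / \<epsilon>" using \<epsilon> by (simp add: field_simps)
  qed
qed

section \<open>Supports of Kobayashi balls in strongly convex domains\<close>

text \<open>
  Near the circle, \<open>f \<zeta>\<close> lies in a ball of radius \<open>\<rho>\<close> in \<open>D\<close> with some centre \<open>p\<close>. Since the
  normal direction at \<open>f \<zeta>\<close> almost supports \<open>D\<close> and this ball, it is almost the direction from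
  \<open>p\<close> to \<open>f \<zeta>\<close>; a field with a definite inward component therefore decreases the distance to \<open>p\<close>
  to first order, and the perturbed disc stays in the same ball. Away from the circle \<open>f\<close> has a
  positive distance from the boundary.
\<close>

lemma inward_perturbation:
  assumes g_bd: "\<And>\<zeta>. norm \<zeta> < 1 \<Longrightarrow> norm (g \<zeta>) \<le> M" and e: "0 < e"
    and inward: "\<And>\<zeta>. 1 / 2 \<le> norm \<zeta> \<Longrightarrow> norm \<zeta> < 1 \<Longrightarrow> Re (cnj \<zeta> * (g \<zeta> \<odot> w \<zeta>)) \<le> - e"
  obtains s where "0 < s" "\<And>\<zeta>. norm \<zeta> < 1 \<Longrightarrow> f \<zeta> + s *\<^sub>R g \<zeta> \<in> D"
proof -
  define N where "N = max M 1"
  have N: "0 < N" "\<And>\<zeta>. norm \<zeta> < 1 \<Longrightarrow> norm (g \<zeta>) \<le> N" using g_bd by (auto simp: N_def max_def intro: order_trans)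
  obtain W where W: "0 < W" "\<And>\<zeta>. norm \<zeta> < 1 \<Longrightarrow> norm (w \<zeta>) \<le> W" using w_bounded by blast
  obtain B where B: "0 < B" "\<And>x y. x \<in> D \<Longrightarrow> y \<in> D \<Longrightarrow> norm (x - y) \<le> B" using diameter_bound by blast
  obtain C where C: "0 < C"
    "\<And>z \<zeta>. z \<in> D \<Longrightarrow> norm \<zeta> < 1 \<Longrightarrow> Re (cnj \<zeta> * ((z - f \<zeta>) \<odot> w \<zeta>)) \<le> C * (1 - (norm \<zeta>)\<^sup>2)"
    using almost_support by blast
  obtain c where c: "0 < c" "\<And>\<zeta>. norm \<zeta> < 1 \<Longrightarrow> c * (norm \<zeta>)\<^sup>2 \<le> Re (cnj \<zeta> * ((f \<zeta> - f 0) \<odot> w \<zeta>))"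
    using radial_lower_bound by blast
  have f0: "f 0 \<in> D" using f_in by simp
  define c1 where "c1 = c / (4 * B)"
  have c1: "0 < c1" using c B by (simp add: c1_def)
  have n_lower: "c1 \<le> norm (normal \<zeta>)" if "1 / 2 \<le> norm \<zeta>" "norm \<zeta> < 1" for \<zeta>
  proof -
    have "c * (norm \<zeta>)\<^sup>2 \<le> normal \<zeta> \<bullet> (f \<zeta> - f 0)" using c(2)[OF that(2)] by (simp add: inner_normal)
    also have "\<dots> \<le> norm (normal \<zeta>) * norm (f \<zeta> - f 0)" by (rule norm_cauchy_schwarz)
    also have "\<dots> \<le> norm (normal \<zeta>) * B" using B(2)[OF f_in[OF that(2)] f0] by (intro mult_left_mono) auto
    finally have 1: "c * (norm \<zeta>)\<^sup>2 \<le> norm (normal \<zeta>) * B" .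
    have "(1 / 2)\<^sup>2 \<le> (norm \<zeta>)\<^sup>2" using that(1) by (intro power_mono) auto
    then have "c * (1 / 4) \<le> c * (norm \<zeta>)\<^sup>2" using c(1) by (intro mult_left_mono) (auto simp: power2_eq_square)
    then have "c / 4 \<le> norm (normal \<zeta>) * B" using 1 by simp
    then show ?thesis using B(1) by (simp add: c1_def divide_le_eq field_simps)
  qed
  have n_upper: "norm (normal \<zeta>) \<le> W" if "norm \<zeta> < 1" for \<zeta>
  proof -
    have "norm \<zeta> * norm (w \<zeta>) \<le> 1 * W" using that W by (intro mult_mono) auto
    then show ?thesis by (simp add: normal_def norm_cmult_vec)
  qed
  \<comment> \<open>\<open>2 * c2\<close> is the decrease rate of half the squared distance to the centre that the inward
    condition yields for the exact normal; half of it absorbs the error in the normal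
    direction.\<close>
  define c2 where "c2 = \<rho> * e / (2 * W)"
  have c2: "0 < c2" using rho_pos e W by (simp add: c2_def)
  \<comment> \<open>\<open>\<delta>0\<close> bounds \<open>1 - (norm \<zeta>)^2\<close> so that the radius vector deviates from \<open>\<rho>\<close> times the unit
    normal by at most \<open>c2 / N\<close>; the square arises because the support inequality controls the
    squared deviation.\<close>
  define \<delta>0 where "\<delta>0 = (c2 / N)\<^sup>2 / (2 * \<rho> * (C / c1))"
  have \<delta>0: "0 < \<delta>0" using c2 N rho_pos C c1 by (simp add: \<delta>0_def)
  define r1 where "r1 = max (1 / 2) (1 - \<delta>0 / 2)"
  have r1: "1 / 2 \<le> r1" "r1 < 1" "1 - \<delta>0 / 2 \<le> r1" using \<delta>0 by (auto simp: r1_def)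
  \<comment> \<open>For steps up to \<open>s1\<close> the quadratic term \<open>s\<^sup>2 N\<^sup>2\<close> is at most the linear gain \<open>2 s c2\<close>.\<close>
  define s1 where "s1 = 2 * c2 / N\<^sup>2"
  have s1: "0 < s1" using c2 N by (simp add: s1_def)
  have near: "f \<zeta> + s *\<^sub>R g \<zeta> \<in> D" if \<zeta>: "r1 < norm \<zeta>" "norm \<zeta> < 1" and s: "0 < s" "s \<le> s1" for \<zeta> s
  proof -
    define \<omega> where "\<omega> = normal \<zeta>"
    define \<delta> where "\<delta> = 1 - (norm \<zeta>)\<^sup>2"
    have half: "1 / 2 \<le> norm \<zeta>" using \<zeta> r1 by linarith
    have \<omega>: "c1 \<le> norm \<omega>" "0 < norm \<omega>" "norm \<omega> \<le> W"
      using n_lower[OF half \<zeta>(2)] n_upper[OF \<zeta>(2)] c1 by (auto simp: \<omega>_def)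
    have "\<delta> = (1 - norm \<zeta>) * (1 + norm \<zeta>)" by (simp add: \<delta>_def power2_eq_square algebra_simps)
    also have "\<dots> \<le> (\<delta>0 / 2) * 2" using \<zeta> r1 \<delta>0 by (intro mult_mono) auto
    finally have \<delta>: "\<delta> \<le> \<delta>0" by simp
    have \<delta>n: "0 \<le> \<delta>" using \<zeta>(2) by (simp add: \<delta>_def power_le_one)
    have x: "f \<zeta> \<in> D" by (rule f_in[OF \<zeta>(2)])
    then obtain t where t: "0 < t" "ball (f \<zeta>) t \<subseteq> D" using D_open open_contains_ball by blast
    have "ball (f \<zeta>) (min t \<rho>) \<subseteq> D" using t(2) by (meson min.cobounded1 order_trans subset_ball)
    then obtain p where p: "ball p \<rho> \<subseteq> D" "dist (f \<zeta>) p \<le> \<rho> - min t \<rho>"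
      using interior_ball[OF x, of "min t \<rho>"] t rho_pos by auto
    define a where "a = f \<zeta> - p"
    have na: "norm a < \<rho>" using p(2) t(1) rho_pos by (auto simp: a_def dist_norm)
    have key: "\<rho> * norm \<omega> \<le> C * \<delta> + \<omega> \<bullet> a"
    proof (rule field_le_mult_one_interval)
      fix \<tau> :: real assume \<tau>: "0 < \<tau>" "\<tau> < 1"
      define z where "z = p + (\<tau> * \<rho> / norm \<omega>) *\<^sub>R \<omega>"
      have "\<tau> * \<rho> < 1 * \<rho>" using \<tau> rho_pos by (intro mult_strict_right_mono)
      then have "z \<in> ball p \<rho>" using \<tau> rho_pos \<omega>(2) by (simp add: z_def dist_norm)
      then have "z \<in> D" using p(1) by blast
      from C(2)[OF this \<zeta>(2)] have "\<omega> \<bullet> (z - f \<zeta>) \<le> C * \<delta>" by (simp add: \<omega>_def inner_normal \<delta>_def)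
      moreover have "z - f \<zeta> = (\<tau> * \<rho> / norm \<omega>) *\<^sub>R \<omega> - a" by (simp add: z_def a_def)
      moreover have "\<omega> \<bullet> ((\<tau> * \<rho> / norm \<omega>) *\<^sub>R \<omega>) = \<tau> * \<rho> * norm \<omega>"
        using \<omega>(2) by (simp add: dot_square_norm power2_eq_square)
      ultimately show "\<tau> * (\<rho> * norm \<omega>) \<le> C * \<delta> + \<omega> \<bullet> a" by (simp add: inner_diff_right)
    qed
    define E where "E = (1 / norm \<omega>) *\<^sub>R \<omega>"
    have nE: "norm E = 1" using \<omega>(2) by (simp add: E_def)
    have "\<rho> - C * \<delta> / norm \<omega> \<le> E \<bullet> a"
    proof -
      have "(\<rho> * norm \<omega> - C * \<delta>) / norm \<omega> \<le> (\<omega> \<bullet> a) / norm \<omega>" using key \<omega>(2) by (intro divide_right_mono) auto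
      then show ?thesis using \<omega>(2) by (simp add: E_def diff_divide_distrib)
    qed
    moreover have "C * \<delta> / norm \<omega> \<le> C * \<delta>0 / c1"
      using C \<delta> \<delta>n \<omega> c1 by (intro frac_le mult_left_mono mult_nonneg_nonneg) auto
    ultimately have Ea: "\<rho> - C * \<delta>0 / c1 \<le> E \<bullet> a" by linarith
    have "(norm (\<rho> *\<^sub>R E - a))\<^sup>2 = \<rho>\<^sup>2 - 2 * \<rho> * (E \<bullet> a) + (norm a)\<^sup>2"
      unfolding power2_norm_eq_inner using nE
      by (simp add: inner_diff_left inner_diff_right inner_commute norm_eq_1 power2_eq_square algebra_simps)
    also have "\<dots> \<le> \<rho>\<^sup>2 - 2 * \<rho> * (\<rho> - C * \<delta>0 / c1) + \<rho>\<^sup>2"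
      using Ea na rho_pos by (intro add_mono diff_mono mult_left_mono power_mono) auto
    also have "\<dots> = 2 * \<rho> * (C / c1) * \<delta>0" by (simp add: power2_eq_square algebra_simps)
    also have "\<dots> = (c2 / N)\<^sup>2" using rho_pos C c1 by (simp add: \<delta>0_def)
    finally have "norm (\<rho> *\<^sub>R E - a) \<le> c2 / N" by (rule power2_le_imp_le) (use c2 N in simp)
    then have "norm (\<rho> *\<^sub>R E - a) * norm (g \<zeta>) \<le> c2 / N * N"
      using N c2 \<zeta> by (intro mult_mono) auto
    then have d1: "- ((\<rho> *\<^sub>R E - a) \<bullet> g \<zeta>) \<le> c2"
      using norm_cauchy_schwarz[of "- (\<rho> *\<^sub>R E - a)" "g \<zeta>"] N unfolding norm_minus_cancel inner_minus_left by simp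
    have "\<omega> \<bullet> g \<zeta> \<le> - e" using inward[OF half \<zeta>(2)] by (simp add: \<omega>_def inner_normal)
    then have "(\<omega> \<bullet> g \<zeta>) / norm \<omega> \<le> - e / norm \<omega>" by (rule divide_right_mono) simp
    then have "E \<bullet> g \<zeta> \<le> - e / norm \<omega>" by (simp add: E_def)
    also have "\<dots> \<le> - e / W" using e \<omega> by (simp add: frac_le)
    finally have "\<rho> * (E \<bullet> g \<zeta>) \<le> \<rho> * (- e / W)" using rho_pos by (intro mult_left_mono) auto
    also have "\<dots> = - 2 * c2" by (simp add: c2_def)
    finally have "(\<rho> *\<^sub>R E) \<bullet> g \<zeta> \<le> - 2 * c2" by simp
    then have ag: "a \<bullet> g \<zeta> \<le> - c2" using d1 by (simp add: inner_diff_left)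
    have "(norm (a + s *\<^sub>R g \<zeta>))\<^sup>2 = (norm a)\<^sup>2 + 2 * s * (a \<bullet> g \<zeta>) + s * (s * (norm (g \<zeta>))\<^sup>2)"
      unfolding power2_norm_eq_inner
      by (simp add: inner_add_left inner_add_right inner_commute algebra_simps)
    also have "\<dots> \<le> (norm a)\<^sup>2 + 2 * s * (- c2) + s * (s1 * N\<^sup>2)"
      using ag s N(1) N(2)[OF \<zeta>(2)] s1 by (intro add_mono mult_left_mono mult_mono power_mono) auto
    also have "s1 * N\<^sup>2 = 2 * c2" using N by (simp add: s1_def)
    finally have "(norm (a + s *\<^sub>R g \<zeta>))\<^sup>2 \<le> (norm a)\<^sup>2" by simp
    then have "norm (a + s *\<^sub>R g \<zeta>) \<le> norm a" by (rule power2_le_imp_le) simp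
    then have "f \<zeta> + s *\<^sub>R g \<zeta> \<in> ball p \<rho>"
      using na by (simp add: a_def dist_norm norm_minus_commute algebra_simps)
    then show ?thesis using p(1) by blast
  qed
  define K where "K = f ` cball 0 r1"
  have "compact K" unfolding K_def
    using holomorphic_on_vec_imp_continuous_on[OF f_hol] r1
    by (intro compact_continuous_image) (auto intro: continuous_on_subset)
  moreover have "K \<subseteq> D" using f_in r1 by (auto simp: K_def)
  ultimately obtain \<eta> where \<eta>: "0 < \<eta>" "(\<Union>x\<in>K. ball x \<eta>) \<subseteq> D"
    using compact_subset_open_imp_ball_epsilon_subset[OF _ D_open] by blast
  define s where "s = min s1 (\<eta> / (2 * N))"
  have s: "0 < s" "s \<le> s1" "s * N < \<eta>"
  proof -
    have "s \<le> \<eta> / (2 * N)" by (simp add: s_def)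
    then have "s * N \<le> \<eta> / 2" using N(1) by (simp add: pos_le_divide_eq mult_ac)
    then show "s * N < \<eta>" using \<eta> by simp
  qed (use s1 \<eta> N in \<open>auto simp: s_def\<close>)
  show thesis
  proof (rule that[OF s(1)])
    fix \<zeta> :: complex assume \<zeta>: "norm \<zeta> < 1"
    show "f \<zeta> + s *\<^sub>R g \<zeta> \<in> D"
    proof (cases "r1 < norm \<zeta>")
      case True then show ?thesis using near \<zeta> s by blast
    next
      case False
      have "s * norm (g \<zeta>) \<le> s * N" using N(2)[OF \<zeta>] s by (intro mult_left_mono) auto
      then have "s * norm (g \<zeta>) < \<eta>" using s(3) by linarith
      then have "f \<zeta> + s *\<^sub>R g \<zeta> \<in> ball (f \<zeta>) \<eta>" using s(1) by (simp add: dist_norm)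
      moreover have "f \<zeta> \<in> K" using False by (simp add: K_def)
      ultimately show ?thesis using \<eta>(2) by blast
    qed
  qed
qed

text \<open>
  Adding a small multiple of the field to \<open>f\<close> gives a competing disc with the same centre, whose
  value at \<open>\<zeta>\<close> is in the closure of the ball.
\<close>

lemma support_on_inward_fields:
  assumes \<zeta>: "norm \<zeta> < 1" "\<zeta> \<noteq> 0"
    and u: "\<And>z. z \<in> kobayashi_ball D (f 0) (norm \<zeta>) \<Longrightarrow> u \<bullet> z \<le> u \<bullet> f \<zeta>"
    and g: "\<And>i. (\<lambda>\<xi>. g \<xi> $ i) holomorphic_on ball 0 1" "g 0 = 0"
    and g_bd: "\<And>\<xi>. norm \<xi> < 1 \<Longrightarrow> norm (g \<xi>) \<le> M" and e: "0 < e"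
    and inward: "\<And>\<xi>. 1 / 2 \<le> norm \<xi> \<Longrightarrow> norm \<xi> < 1 \<Longrightarrow> Re (cnj \<xi> * (g \<xi> \<odot> w \<xi>)) \<le> - e"
  shows "u \<bullet> g \<zeta> \<le> 0"
proof -
  obtain s where s: "0 < s" "\<And>\<xi>. norm \<xi> < 1 \<Longrightarrow> f \<xi> + s *\<^sub>R g \<xi> \<in> D"
    using inward_perturbation[of g M e] g_bd e inward by metis
  define \<phi> where "\<phi> \<xi> = f \<xi> + s *\<^sub>R g \<xi>" for \<xi>
  have hol: "(\<lambda>\<xi>. \<phi> \<xi> $ i) holomorphic_on ball 0 1" for i
    unfolding \<phi>_def vector_add_component vector_scaleR_component scaleR_conv_of_real[where 'a = complex]
    by (intro holomorphic_intros f_hol g(1))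
  have disc: "holomorphic_disc \<phi> D" using hol s(2) by (auto simp: holomorphic_disc_def \<phi>_def)
  have f0: "f 0 \<in> D" using f_in by simp
  obtain \<kappa> :: "nat \<Rightarrow> complex" where \<kappa>: "\<And>n. norm (\<kappa> n) < 1" and \<kappa>l: "(\<lambda>n. \<kappa> n * \<zeta>) \<longlonglongrightarrow> \<zeta>"
    using radial_approach by blast
  have "isCont \<phi> \<zeta>"
    using holomorphic_on_vec_imp_continuous_on[OF hol] \<zeta> by (simp add: continuous_on_eq_continuous_at)
  then have "(\<lambda>n. \<phi> (\<kappa> n * \<zeta>)) \<longlonglongrightarrow> \<phi> \<zeta>" using \<kappa>l isCont_tendsto_compose by blast
  then have lim: "(\<lambda>n. u \<bullet> \<phi> (\<kappa> n * \<zeta>)) \<longlonglongrightarrow> u \<bullet> \<phi> \<zeta>" by (intro tendsto_intros)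
  have "u \<bullet> \<phi> (\<kappa> n * \<zeta>) \<le> u \<bullet> f \<zeta>" for n
  proof -
    have "norm (\<kappa> n * \<zeta>) < norm \<zeta>" using mult_strict_right_mono[OF \<kappa>[of n], of "norm \<zeta>"] \<zeta> by (simp add: norm_mult)
    then have "\<phi> (\<kappa> n * \<zeta>) \<in> kobayashi_ball D (f 0) (norm \<zeta>)"
      unfolding mem_kobayashi_ball_iff[OF D_open D_bounded D_convex f0]
      using disc \<zeta> g(2) by (intro exI[of _ \<phi>] exI[of _ "\<kappa> n * \<zeta>"]) (auto simp: \<phi>_def)
    then show ?thesis by (rule u)
  qed
  then have "u \<bullet> \<phi> \<zeta> \<le> u \<bullet> f \<zeta>" using lim by (intro tendsto_upperbound[OF lim]) auto
  then show ?thesis using s(1) by (simp add: \<phi>_def inner_add_right mult_le_0_iff)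
qed

text \<open>
  The quotient \<open>p\<close> has no zeros and a bounded inverse; it serves as a denominator that corrects
  the pairing of a field with \<open>w\<close> by a multiple of \<open>f - f 0\<close>.
\<close>

lemma radial_factor:
  obtains p c where "p holomorphic_on ball 0 1" "\<And>\<zeta>. norm \<zeta> < 1 \<Longrightarrow> (f \<zeta> - f 0) \<odot> w \<zeta> = \<zeta> * p \<zeta>"
    "0 < c" "\<And>\<zeta>. norm \<zeta> < 1 \<Longrightarrow> c \<le> Re (p \<zeta>)"
proof -
  obtain c where c: "0 < c" "\<And>\<zeta>. norm \<zeta> < 1 \<Longrightarrow> c * (norm \<zeta>)\<^sup>2 \<le> Re (cnj \<zeta> * ((f \<zeta> - f 0) \<odot> w \<zeta>))"
    using radial_lower_bound by blast
  have "(\<lambda>\<zeta>. (f \<zeta> - f 0) \<odot> w \<zeta>) holomorphic_on ball 0 1"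
    unfolding scalar_product_def vector_minus_component by (intro holomorphic_intros f_hol w_hol)
  then obtain p where p: "p holomorphic_on ball 0 1" "\<And>\<zeta>. norm \<zeta> < 1 \<Longrightarrow> (f \<zeta> - f 0) \<odot> w \<zeta> = \<zeta> * p \<zeta>"
    using Schwarz3[of "\<lambda>\<zeta>. (f \<zeta> - f 0) \<odot> w \<zeta>" 1] by auto
  have off: "c \<le> Re (p \<zeta>)" if "norm \<zeta> < 1" "\<zeta> \<noteq> 0" for \<zeta>
  proof -
    have "cnj \<zeta> * (\<zeta> * p \<zeta>) = of_real ((norm \<zeta>)\<^sup>2) * p \<zeta>" by (simp only: complex_norm_square mult_ac)
    then have "Re (cnj \<zeta> * (\<zeta> * p \<zeta>)) = (norm \<zeta>)\<^sup>2 * Re (p \<zeta>)" by (simp only: times_complex.sel Re_complex_of_real Im_complex_of_real mult_zero_left diff_zero)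
    then have "c * (norm \<zeta>)\<^sup>2 \<le> Re (p \<zeta>) * (norm \<zeta>)\<^sup>2"
      using c(2)[OF that(1)] unfolding p(2)[OF that(1)] by (simp only: mult.commute)
    then show ?thesis using that(2) by simp
  qed
  have "c \<le> Re (p 0)"
  proof (rule tendsto_lowerbound[OF tendsto_Re])
    show "(p \<longlongrightarrow> p 0) (at 0)"
      using holomorphic_on_imp_continuous_on[OF p(1)] by (simp add: continuous_on_eq_continuous_at isCont_def)
    have "eventually (\<lambda>x :: complex. x \<in> ball 0 1 - {0}) (at 0)" by (rule eventually_at_in_open) auto
    then show "eventually (\<lambda>x. c \<le> Re (p x)) (at 0)" by eventually_elim (use off in auto)
  qed simp
  then show thesis using that p c(1) off by metis
qed

text \<open>
  For every \<open>v\<close> in the open half space of the normal there is a field \<open>g\<close> as in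
  \<open>support_on_inward_fields\<close> whose value at \<open>\<zeta>\<close> is a positive multiple of \<open>v\<close>, so each support
  has its half space determined by \<open>w \<zeta>\<close>.
\<close>

lemma unique_support:
  assumes \<zeta>: "norm \<zeta> < 1" "\<zeta> \<noteq> 0"
    and P: "supporting_hyperplane (kobayashi_ball D (f 0) (norm \<zeta>)) (f \<zeta>) P"
  shows "P = {y. normal \<zeta> \<bullet> y = normal \<zeta> \<bullet> f \<zeta>}"
proof -
  obtain u where u: "u \<noteq> 0" "P = {y. u \<bullet> y = u \<bullet> f \<zeta>}"
    "\<And>z. z \<in> kobayashi_ball D (f 0) (norm \<zeta>) \<Longrightarrow> u \<bullet> z \<le> u \<bullet> f \<zeta>"
    using P unfolding supporting_hyperplane_def by blast
  obtain p c where p: "p holomorphic_on ball 0 1" "\<And>\<zeta>. norm \<zeta> < 1 \<Longrightarrow> (f \<zeta> - f 0) \<odot> w \<zeta> = \<zeta> * p \<zeta>"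
    and c: "0 < c" "\<And>\<zeta>. norm \<zeta> < 1 \<Longrightarrow> c \<le> Re (p \<zeta>)"
    using radial_factor by blast
  have pc: "c \<le> norm (p \<xi>)" if "norm \<xi> < 1" for \<xi> using c(2)[OF that] complex_Re_le_cmod[of "p \<xi>"] by linarith
  have p0: "p \<xi> \<noteq> 0" if "norm \<xi> < 1" for \<xi> using pc[OF that] c(1) by auto
  obtain W where W: "0 < W" "\<And>\<zeta>. norm \<zeta> < 1 \<Longrightarrow> norm (w \<zeta>) \<le> W" using w_bounded by blast
  obtain B where B: "0 < B" "\<And>x y. x \<in> D \<Longrightarrow> y \<in> D \<Longrightarrow> norm (x - y) \<le> B" using diameter_bound by blast
  have f0: "f 0 \<in> D" using f_in by simp
  have "u \<bullet> v \<le> 0" if v: "normal \<zeta> \<bullet> v < 0" for v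
  proof -
    define v1 where "v1 = cnj \<zeta> *s v"
    define \<beta> where "\<beta> = v1 \<odot> w \<zeta>"
    have Re\<beta>: "Re \<beta> < 0" using v by (simp add: \<beta>_def v1_def inner_normal scalar_product_cmult_left)
    \<comment> \<open>The multiple of \<open>f - f 0\<close> turns the pairing \<open>g \<xi> \<odot> w \<xi>\<close> into exactly \<open>\<xi> * \<beta>\<close>, hence
      inward on every circle, and it vanishes at \<open>\<xi> = \<zeta>\<close>. The factor \<open>cnj \<zeta>\<close> in \<open>v1\<close> makes \<open>g \<zeta>\<close>
      a positive multiple of \<open>v\<close>.\<close>
    define g where "g \<xi> = \<xi> *s v1 + ((\<beta> - v1 \<odot> w \<xi>) / p \<xi>) *s (f \<xi> - f 0)" for \<xi>
    have "u \<bullet> g \<zeta> \<le> 0"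
    proof (rule support_on_inward_fields[OF \<zeta> u(3)])
      show "(\<lambda>\<xi>. g \<xi> $ i) holomorphic_on ball 0 1" for i
        unfolding g_def vector_add_component vector_smult_component vector_minus_component scalar_product_def
        by (intro holomorphic_intros f_hol w_hol p(1)) (use p0 in auto)
      show "g 0 = 0" by (simp add: g_def)
      show "norm (g \<xi>) \<le> norm v1 + (norm \<beta> + norm v1 * W) / c * B" if \<xi>: "norm \<xi> < 1" for \<xi>
      proof -
        have "norm (v1 \<odot> w \<xi>) \<le> norm v1 * W"
          by (rule order_trans[OF norm_scalar_product_le]) (use W(2)[OF \<xi>] in \<open>auto intro: mult_left_mono\<close>)
        then have "norm (\<beta> - v1 \<odot> w \<xi>) \<le> norm \<beta> + norm v1 * W"
          using norm_triangle_ineq4[of \<beta> "v1 \<odot> w \<xi>"] by linarith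
        then have "norm ((\<beta> - v1 \<odot> w \<xi>) / p \<xi>) \<le> (norm \<beta> + norm v1 * W) / c"
          unfolding norm_divide using pc[OF \<xi>] c(1) W by (intro frac_le) auto
        then have "norm ((\<beta> - v1 \<odot> w \<xi>) / p \<xi>) * norm (f \<xi> - f 0) \<le> (norm \<beta> + norm v1 * W) / c * B"
          using B(2)[OF f_in[OF \<xi>] f0] c(1) W by (intro mult_mono) auto
        moreover have "norm \<xi> * norm v1 \<le> norm v1" using \<xi> by (simp add: mult_left_le_one_le)
        ultimately show ?thesis unfolding g_def
          by (intro order_trans[OF norm_triangle_ineq] add_mono) (simp_all only: norm_cmult_vec)
      qed
      show "0 < - Re \<beta> / 4" using Re\<beta> by simp
      show "Re (cnj \<xi> * (g \<xi> \<odot> w \<xi>)) \<le> - (- Re \<beta> / 4)" if \<xi>: "1 / 2 \<le> norm \<xi>" "norm \<xi> < 1" for \<xi>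
      proof -
        have "g \<xi> \<odot> w \<xi> = \<xi> * (v1 \<odot> w \<xi>) + ((\<beta> - v1 \<odot> w \<xi>) / p \<xi>) * (\<xi> * p \<xi>)"
          by (simp only: g_def scalar_product_add_left scalar_product_cmult_left p(2)[OF \<xi>(2)])
        also have "\<dots> = \<xi> * \<beta>" using p0[OF \<xi>(2)] by (simp add: field_simps)
        finally have "cnj \<xi> * (g \<xi> \<odot> w \<xi>) = of_real ((norm \<xi>)\<^sup>2) * \<beta>" by (simp only: complex_norm_square mult_ac)
        then have "Re (cnj \<xi> * (g \<xi> \<odot> w \<xi>)) = (norm \<xi>)\<^sup>2 * Re \<beta>" by (simp del: of_real_power)
        moreover have "(1 / 2)\<^sup>2 \<le> (norm \<xi>)\<^sup>2" using \<xi> by (intro power_mono) auto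
        then have "(norm \<xi>)\<^sup>2 * Re \<beta> \<le> (1 / 2)\<^sup>2 * Re \<beta>" using Re\<beta> by (intro mult_right_mono_neg) auto
        ultimately show ?thesis by (simp add: power2_eq_square)
      qed
    qed
    moreover have "g \<zeta> = (norm \<zeta>)\<^sup>2 *\<^sub>R v"
    proof -
      have "g \<zeta> = (\<zeta> * cnj \<zeta>) *s v" by (simp add: g_def \<beta>_def v1_def)
      then show ?thesis
        by (simp add: vec_eq_iff scaleR_conv_of_real[where 'a = complex] complex_norm_square[symmetric])
    qed
    ultimately show ?thesis using \<zeta>(2) by (simp add: mult_le_0_iff)
  qed
  then obtain k where "0 < k" "u = k *\<^sub>R normal \<zeta>"
    using halfspace_inclusion[OF normal_nonzero[OF \<zeta>] u(1)] by blast
  then show ?thesis using u(2) by auto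
qed

end

text \<open>
  Harnack's inequality keeps a Kobayashi ball at a positive distance from every hyperplane that
  supports \<open>D\<close>.
\<close>

lemma kobayashi_ball_frontier_in_domain:
  fixes D :: "(complex ^ 'n) set"
  assumes D: "open D" "bounded D" "convex D" and q: "q \<in> D" and R: "0 < R" "R < 1"
    and x: "x \<in> frontier (kobayashi_ball D q R)"
  shows "x \<in> D"
proof (rule ccontr)
  assume out: "x \<notin> D"
  obtain u where u: "\<And>z. z \<in> D \<Longrightarrow> u \<bullet> z < u \<bullet> x"
    using support_open_convex[OF D(1,3) out] q by blast
  define \<gamma> where "\<gamma> = (1 - R) / (1 + R) * (u \<bullet> x - u \<bullet> q)"
  have \<gamma>: "0 < \<gamma>" using u[OF q] R by (simp add: \<gamma>_def)
  have le: "u \<bullet> z \<le> u \<bullet> x - \<gamma>" if z: "z \<in> kobayashi_ball D q R" for z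
  proof -
    obtain \<phi> \<sigma> where \<phi>: "holomorphic_disc \<phi> D" "\<phi> 0 = q" "norm \<sigma> < 1" "norm \<sigma> < R" "\<phi> \<sigma> = z"
      using z mem_kobayashi_ball_iff[OF D q] by blast
    have \<phi>h: "(\<lambda>\<zeta>. \<phi> \<zeta> $ i) holomorphic_on ball 0 1" for i using \<phi>(1) by (simp add: holomorphic_disc_def)
    have \<phi>D: "\<phi> \<zeta> \<in> D" if "norm \<zeta> < 1" for \<zeta> using \<phi>(1) that by (auto simp: holomorphic_disc_def)
    define F where "F \<mu> = (x - \<phi> \<mu>) \<odot> cnj_vec u" for \<mu>
    have ReF: "Re (F \<mu>) = u \<bullet> x - u \<bullet> \<phi> \<mu>" for \<mu>
      using inner_cnj_vec[of "cnj_vec u" "x - \<phi> \<mu>"] by (simp add: F_def inner_diff_right)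
    have "(1 - norm \<sigma>) / (1 + norm \<sigma>) * Re (F 0) \<le> Re (F \<sigma>)"
    proof (rule Harnack_disc[OF _ _ \<phi>(3)])
      show "F holomorphic_on ball 0 1" unfolding F_def scalar_product_def vector_minus_component
        by (intro holomorphic_intros \<phi>h)
      show "0 < Re (F z)" if "norm z < 1" for z using u[OF \<phi>D[OF that]] by (simp add: ReF)
    qed
    moreover have "(1 - R) / (1 + R) \<le> (1 - norm \<sigma>) / (1 + norm \<sigma>)"
      using \<phi>(4) R by (intro frac_le) (auto intro: add_pos_nonneg)
    then have "\<gamma> \<le> (1 - norm \<sigma>) / (1 + norm \<sigma>) * Re (F 0)"
      unfolding \<gamma>_def using u[OF q] by (simp only: ReF \<phi>(2)) (intro mult_right_mono, auto)
    ultimately show ?thesis using \<phi>(5) by (simp add: ReF)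
  qed
  have "kobayashi_ball D q R \<subseteq> {z. u \<bullet> z \<le> u \<bullet> x - \<gamma>}" using le by blast
  then have "closure (kobayashi_ball D q R) \<subseteq> {z. u \<bullet> z \<le> u \<bullet> x - \<gamma>}"
    by (rule closure_minimal) (rule closed_halfspace_le)
  moreover have "x \<in> closure (kobayashi_ball D q R)" using x by (simp add: frontier_def)
  ultimately show False using \<gamma> by auto
qed

text \<open>
  A boundary point of the ball lies in \<open>D\<close>, hence on a geodesic from \<open>q\<close>, and at the parameter
  \<open>R\<close>: smaller parameters give points of the ball, and the left inverse excludes larger ones.
\<close>

theorem strongly_convex_unique_supports:
  fixes D :: "(complex ^ 'n) set"
  assumes D: "open D" "convex D" and sc: "strongly_convex D" and q: "q \<in> D" and R: "0 < R" "R < 1"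
  shows "unique_supporting_hyperplanes (kobayashi_ball D q R)"
  unfolding unique_supporting_hyperplanes_def
proof
  let ?B = "kobayashi_ball D q R"
  fix x assume x: "x \<in> frontier ?B"
  have bd: "bounded D" using sc by (simp add: strongly_convex_def)
  have xD: "x \<in> D" by (rule kobayashi_ball_frontier_in_domain[OF D(1) bd D(2) q R x])
  have op: "open ?B" by (rule kobayashi_ball_open[OF D(1) bd D(2) q])
  have xB: "x \<notin> ?B" using x op by (simp add: frontier_def interior_open)
  have xcl: "x \<in> closure ?B" using x by (simp add: frontier_def)
  have "holomorphic_disc (\<lambda>_. q) D" using q by (auto simp: holomorphic_disc_def)
  then have "q \<in> ?B" unfolding mem_kobayashi_ball_iff[OF D(1) bd D(2) q]
    using R by (intro exI[of _ "\<lambda>_. q"] exI[of _ 0]) auto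
  then have "q \<noteq> x" using xB by blast
  then obtain f G \<sigma> where f: "holomorphic_disc f D" "f 0 = q" "0 < \<sigma>" "\<sigma> < 1" "f (of_real \<sigma>) = x" "left_inverse D f G"
    using geodesic_through_two_points[OF D(1) bd D(2) q xD] by metis
  obtain \<rho> where "interior_balls D \<rho>" using strongly_convex_interior_balls[OF sc D(1)] q by blast
  then interpret smooth_geodesic D f G \<rho> using D bd f by unfold_locales
  have "\<sigma> = R"
  proof (rule antisym)
    have "\<not> \<sigma> < R"
    proof
      assume "\<sigma> < R"
      then have "x \<in> ?B" unfolding mem_kobayashi_ball_iff[OF D(1) bd D(2) q]
        using f by (intro exI[of _ f] exI[of _ "of_real \<sigma>"]) auto
      then show False using xB by simp
    qed
    then show "R \<le> \<sigma>" by simp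
    obtain X where X: "\<And>n. X n \<in> ?B" "X \<longlonglongrightarrow> x" using xcl unfolding closure_sequential by blast
    have "isCont G x"
      using holomorphic_fun_on_imp_continuous_on[OF G_hol] xD D(1) by (simp add: continuous_on_eq_continuous_at)
    then have "(\<lambda>n. norm (G (X n))) \<longlonglongrightarrow> norm (G x)"
      by (intro tendsto_norm isCont_tendsto_compose[OF _ X(2)])
    moreover have "norm (G (X n)) \<le> R" for n
      using kobayashi_ball_function_less[OF D(1) bd D(2) q X(1) G_hol] f(2,6) G_f[of 0]
      by (auto simp: left_inverse_def intro: less_imp_le)
    ultimately have "norm (G x) \<le> R" by (intro tendsto_upperbound) auto
    then show "\<sigma> \<le> R" using G_f[of "of_real \<sigma>"] f(3-5) by simp
  qed
  then have *: "norm (complex_of_real \<sigma>) < 1" "complex_of_real \<sigma> \<noteq> 0" "norm (complex_of_real \<sigma>) = R"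
    using f(3,4) by auto
  show "\<exists>!P. supporting_hyperplane ?B x P"
    using normal_supports[OF *(1,2)] unique_support[OF *(1,2)] unfolding *(3) f(2,5) by blast
qed

section \<open>Left inverses with affine fibres and their uniqueness\<close>

theorem theorem2p1:
  fixes D :: "(complex ^ 'n) set"
    and f :: "complex \<Rightarrow> complex ^ 'n"
    and G :: "complex ^ 'n \<Rightarrow> complex"
  defines "H \<equiv> lempert_fun_of f G"
  assumes "open D" and "D \<noteq> {}" and "bounded D" and "convex D"
    and "complex_geodesic D f"
    and "left_inverse D f G"
  shows "(\<forall>z\<in>D. \<exists>!\<zeta>. \<zeta> \<in> unit_disc \<and> scalar_product (z - f \<zeta>) (cgrad G (f \<zeta>)) = 0)
    \<and> H ` D \<subseteq> unit_disc \<and> holomorphic_fun_on H D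
    \<and> lempert_left_inverse D f H
    \<and> (\<forall>\<zeta>\<in>unit_disc. cgrad H (f \<zeta>) = cgrad G (f \<zeta>))
    \<and> (lempert_left_inverse D f G \<longrightarrow> (\<forall>z\<in>D. H z = G z))
    \<and> ((\<forall>R. 0 < R \<and> R < 1 \<longrightarrow> unique_supporting_hyperplanes (kobayashi_ball D (f 0) R))
        \<longrightarrow> (\<forall>L. lempert_left_inverse D f L \<longrightarrow> (\<forall>z\<in>D. L z = H z)))
    \<and> (strongly_convex D \<longrightarrow>
        (\<forall>R. 0 < R \<and> R < 1 \<longrightarrow> unique_supporting_hyperplanes (kobayashi_ball D (f 0) R))
        \<and> (\<forall>L. lempert_left_inverse D f L \<longrightarrow> (\<forall>z\<in>D. L z = H z)))"
proof -
  interpret geodesic D f G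
    using assms(2,4,5,6,7) by unfold_locales (auto simp: complex_geodesic_def)
  have inv: "H ` D \<subseteq> unit_disc" "holomorphic_fun_on H D"
    using H_left_inverse unfolding H_def left_inverse_def by auto
  have uniq: "\<forall>L. lempert_left_inverse D f L \<longrightarrow> (\<forall>z\<in>D. L z = H z)"
    if "\<forall>R. 0 < R \<and> R < 1 \<longrightarrow> unique_supporting_hyperplanes (kobayashi_ball D (f 0) R)"
    unfolding H_def using unique_lempert_left_inverse that by blast
  have sc: "\<forall>R. 0 < R \<and> R < 1 \<longrightarrow> unique_supporting_hyperplanes (kobayashi_ball D (f 0) R)" if "strongly_convex D"
    using strongly_convex_unique_supports[OF D_open D_convex that] f_in[of 0] by simp
  show ?thesis
    using H_unique inv H_lempert cgrad_H lempert_eq_H uniq sc unfolding H_def[symmetric] by auto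
qed

end
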